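(* Let $\theta>0$ be a fixed real number independent of $N$, and for each $N$ let $B_N=A_N+\theta\,u_Nu_N^*$, where $A_N$ is a Wigner matrix and $u_N$ is uniformly distributed on the unit sphere of $\mathbb R^N$, as specified in the context. Let $v_1,\dots,v_N$ be orthonormal eigenvectors of $B_N$ corresponding to its eigenvalues $\lambda_1\ge\cdots\ge\lambda_N$. Let $0<c\le 1$ be a constant. Then, as $N\to\infty$, $$\sum_{i=1}^{\lfloor cN\rfloor}\langle v_i,u_N\rangle^2\longrightarrow \mathcal P(\theta;c)\quad\text{in probability},\qquad \mathcal P(\theta;c)\ge c,$$ where $$\mathcal P(\theta;c):=\int_m^2\mu_{\mathrm{sc}}(x)\,p(x;\theta)\,dx,\qquad p(x;\theta)=\frac{1}{\theta\left(\theta+\frac1\theta-x\right)},$$ and the threshold $m$ is defined implicitly by $c=\int_m^2\mu_{\mathrm{sc}}(x)\,dx$. Moreover, $\mathcal P(\theta;c)$ is an increasing function of both $c$ and $\theta$.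
   Context: Wigner matrix: $A_N=\frac{1}{\sqrt N}W_N$, where $W_N=(W_{ij})$ is an $N\times N$ real symmetric random matrix such that: (i) the entries $\{W_{ij}: i\le j\}$ are independent; (ii) the entries are symmetrically distributed with zero odd moments, $\mathbb E W_{ij}^{2k+1}=0$ for all $i,j,k$; (iii) $\mathbb E W_{ij}^2=1$ for $i<j$, and the $\mathbb E W_{ii}^2$ are uniformly bounded; (iv) (subGaussian assumption) there is $\beta>0$ such that $\mathbb E W_{ij}^{2k}\le(\beta k)^k$ for all $k$ and all $i,j$. The vector $u_N$ is uniformly distributed on the unit sphere $\mathbb S^{N-1}\subset\mathbb R^N$ and is independent of $A_N$. The semicircle density is $\mu_{\mathrm{sc}}(x)=\frac{1}{2\pi}\sqrt{4-x^2}\,\mathbb I_{[-2,2]}(x)$.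
   Formalization: For θ>1 the claim is false (at c=1 the sum is 1 but P(θ;1)=1/θ²), so P(θ;c) is replaced throughout by P(θ;c)+(1−1/θ²) when θ>1; for θ≤1 it is unchanged. Monotonicity in θ is nondecreasing for all c, strict only for c<1. *)

theory Defs
  imports "HOL-Probability.Probability" "Jordan_Normal_Form.Char_Poly"
begin

text \<open>
  Conventions. Everything lives on a sequence of probability spaces \<open>M N\<close>; the size \<open>N = 0\<close> is
  ignored. Rows, columns, eigenvalues and eigenvectors are indexed from 0, so that the first
  \<open>k\<close> eigenvectors are those with index \<open>i < k\<close>. Vectors and matrices of size \<open>N\<close> are those of
  Jordan_Normal_Form, whose size is not part of the type. \<open>W N i j\<close> and \<open>u N i\<close> are the random
  coordinates; their values at indices \<open>\<ge> N\<close> are irrelevant.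
\<close>

definition upper_pairs :: "nat \<Rightarrow> (nat \<times> nat) set" where
  "upper_pairs N = {(i, j). i \<le> j \<and> j < N}"

text \<open>
  Integrability is stated explicitly because the Lebesgue integral of a non-integrable function is
  0 by convention. The constants \<open>C\<close> and \<open>\<beta>\<close> do not depend on \<open>N\<close>.
\<close>

definition wigner_entries ::
  "(nat \<Rightarrow> 'a measure) \<Rightarrow> (nat \<Rightarrow> nat \<Rightarrow> nat \<Rightarrow> 'a \<Rightarrow> real) \<Rightarrow> bool" where
  "wigner_entries M W \<longleftrightarrow>
     (\<forall>N>0. prob_space.indep_vars (M N) (\<lambda>_. borel) (\<lambda>(i, j). W N i j) (upper_pairs N)) \<and>
     (\<forall>N>0. \<forall>i<N. \<forall>j<N. \<forall>\<omega>\<in>space (M N). W N i j \<omega> = W N j i \<omega>) \<and>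
     (\<forall>N>0. \<forall>i<N. \<forall>j<N. distr (M N) borel (W N i j) = distr (M N) borel (\<lambda>\<omega>. - W N i j \<omega>)) \<and>
     (\<forall>N>0. \<forall>i<N. \<forall>j<N. \<forall>k. integrable (M N) (\<lambda>\<omega>. W N i j \<omega> ^ k)) \<and>
     (\<forall>N>0. \<forall>i<N. \<forall>j<N. \<forall>k. (LINT \<omega>|M N. W N i j \<omega> ^ (2 * k + 1)) = 0) \<and>
     (\<forall>N>0. \<forall>i<N. \<forall>j<N. i < j \<longrightarrow> (LINT \<omega>|M N. (W N i j \<omega>)\<^sup>2) = 1) \<and>
     (\<exists>C. \<forall>N>0. \<forall>i<N. (LINT \<omega>|M N. (W N i i \<omega>)\<^sup>2) \<le> C) \<and>
     (\<exists>\<beta>>0. \<forall>N>0. \<forall>i<N. \<forall>j<N. \<forall>k.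
        (LINT \<omega>|M N. W N i j \<omega> ^ (2 * k)) \<le> (\<beta> * real k) ^ k)"

definition wigner_mat :: "nat \<Rightarrow> (nat \<Rightarrow> nat \<Rightarrow> 'a \<Rightarrow> real) \<Rightarrow> 'a \<Rightarrow> real mat" where
  "wigner_mat N X \<omega> = (1 / sqrt (real N)) \<cdot>\<^sub>m mat N N (\<lambda>(i, j). X i j \<omega>)"

definition random_vec :: "nat \<Rightarrow> (nat \<Rightarrow> 'a \<Rightarrow> real) \<Rightarrow> 'a \<Rightarrow> real Matrix.vec" where
  "random_vec N x \<omega> = Matrix.vec N (\<lambda>i. x i \<omega>)"

definition spiked_mat ::
  "real \<Rightarrow> nat \<Rightarrow> (nat \<Rightarrow> nat \<Rightarrow> 'a \<Rightarrow> real) \<Rightarrow> (nat \<Rightarrow> 'a \<Rightarrow> real) \<Rightarrow> 'a \<Rightarrow> real mat" where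
  "spiked_mat \<theta> N X x \<omega> = wigner_mat N X \<omega> + \<theta> \<cdot>\<^sub>m mat N N (\<lambda>(i, j). x i \<omega> * x j \<omega>)"

text \<open>
  The uniform distribution on the unit sphere of \<open>N\<close>-space is the rotation invariant probability
  measure on it: the law of the vector is carried by the sphere and preserved by every
  orthogonal matrix.
\<close>

definition uniform_on_sphere :: "'a measure \<Rightarrow> nat \<Rightarrow> (nat \<Rightarrow> 'a \<Rightarrow> real) \<Rightarrow> bool" where
  "uniform_on_sphere P N x \<longleftrightarrow>
     (\<forall>i<N. x i \<in> borel_measurable P) \<and>
     (AE \<omega> in P. (\<Sum>i<N. (x i \<omega>)\<^sup>2) = 1) \<and>
     (\<forall>Q\<in>carrier_mat N N. Q * transpose_mat Q = 1\<^sub>m N \<longrightarrow>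
        distr P (Pi\<^sub>M {..<N} (\<lambda>_. borel))
          (\<lambda>\<omega>. \<lambda>i\<in>{..<N}. vec_index (Q *\<^sub>v random_vec N x \<omega>) i) =
        distr P (Pi\<^sub>M {..<N} (\<lambda>_. borel)) (\<lambda>\<omega>. \<lambda>i\<in>{..<N}. x i \<omega>))"

text \<open>
  Independence of the two generated sigma-algebras; \<open>indep_var\<close> does not apply because the two
  random variables have values of different types.
\<close>

definition indep_mat_vec ::
  "'a measure \<Rightarrow> nat \<Rightarrow> (nat \<Rightarrow> nat \<Rightarrow> 'a \<Rightarrow> real) \<Rightarrow> (nat \<Rightarrow> 'a \<Rightarrow> real) \<Rightarrow> bool" where
  "indep_mat_vec P N X x \<longleftrightarrow>
     prob_space.indep_set P
       {(\<lambda>\<omega>. \<lambda>(i, j)\<in>{..<N} \<times> {..<N}. X i j \<omega>) -` A \<inter> space P | A.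
          A \<in> sets (Pi\<^sub>M ({..<N} \<times> {..<N}) (\<lambda>_. borel))}
       {(\<lambda>\<omega>. \<lambda>i\<in>{..<N}. x i \<omega>) -` A \<inter> space P | A. A \<in> sets (Pi\<^sub>M {..<N} (\<lambda>_. borel))}"

definition ordered_eigenbasis ::
  "nat \<Rightarrow> real mat \<Rightarrow> (nat \<Rightarrow> real) \<Rightarrow> (nat \<Rightarrow> real Matrix.vec) \<Rightarrow> bool" where
  "ordered_eigenbasis N B l v \<longleftrightarrow>
     (\<forall>i<N. eigenvector B (v i) (l i)) \<and>
     (\<forall>i<N. \<forall>j<N. scalar_prod (v i) (v j) = (if i = j then 1 else 0)) \<and>
     (\<forall>i j. i \<le> j \<and> j < N \<longrightarrow> l j \<le> l i)"

definition tendsto_in_prob ::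
  "(nat \<Rightarrow> 'a measure) \<Rightarrow> (nat \<Rightarrow> 'a \<Rightarrow> real) \<Rightarrow> real \<Rightarrow> bool" where
  "tendsto_in_prob M X l \<longleftrightarrow>
     (\<forall>\<epsilon>>0. (\<lambda>N. measure (M N) {\<omega> \<in> space (M N). \<bar>X N \<omega> - l\<bar> > \<epsilon>}) \<longlonglongrightarrow> 0)"

definition sc_density :: "real \<Rightarrow> real" where
  "sc_density x = 1 / (2 * pi) * sqrt (4 - x\<^sup>2) * indicator {-2..2} x"

text \<open>For \<open>0 < c \<le> 1\<close> the threshold is unique once it is required to lie in the support.\<close>

definition sc_threshold :: "real \<Rightarrow> real" where
  "sc_threshold c =
     (THE m. -2 \<le> m \<and> m \<le> 2 \<and> c = (LINT x:{m..2}|lborel. sc_density x))"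

definition overlap_profile :: "real \<Rightarrow> real \<Rightarrow> real" where
  "overlap_profile x \<theta> = 1 / (\<theta> * (\<theta> + 1 / \<theta> - x))"

definition overlap_integral :: "real \<Rightarrow> real \<Rightarrow> real" where
  "overlap_integral \<theta> c =
     (LINT x:{sc_threshold c..2}|lborel. sc_density x * overlap_profile x \<theta>)"

text \<open>
  For \<open>\<theta> > 1\<close> the top eigenvalue of the spiked matrix leaves the interval \<open>[-2, 2]\<close>. Its
  eigenvector carries a share \<open>1 - 1 / \<theta>\<^sup>2\<close> of the spike, which the integral over \<open>[m, 2]\<close> does
  not see: at \<open>c = 1\<close> the overlaps sum to 1, whereas the integral is \<open>1 / \<theta>\<^sup>2\<close>.
\<close>

definition outlier_mass :: "real \<Rightarrow> real" where
  "outlier_mass \<theta> = (if \<theta> \<le> 1 then 0 else 1 - 1 / \<theta>\<^sup>2)"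

end

theory Submission
  imports Defs
begin

text \<open>
  Write \<open>B\<close> for the spiked matrix, \<open>G = (B - z)\<^sup>-\<^sup>1\<close> with \<open>Im z > 0\<close>, \<open>s\<close> for the normalized trace of \<open>G\<close>
  and \<open>g = u\<^sup>T G u\<close>. In an eigenbasis, \<open>s\<close> is the Stieltjes transform of the empirical measure of the
  eigenvalues, and \<open>g\<close> is that of the measure that puts the squared overlap of each eigenvector with
  \<open>u\<close> at its eigenvalue. The sum in question is the mass that the second measure gives to the top
  \<open>c N\<close> eigenvalues, so it is enough to find the limits of both measures.

  The limits come from two self-consistent equations. From \<open>(B - z) G = 1\<close>, integration by parts in
  the entries of the noise replaces the noise acting on \<open>G\<close> by \<open>- s\<close>, which leads to
  \<open>1 + z s + s\<^sup>2 = 0\<close> and \<open>1 + (z - \<theta>) g + s g = 0\<close> up to small errors. As the entries are not Gaussian,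
  the integration by parts is a Taylor expansion in one entry, whose first and third moments vanish
  (\<open>expectation_by_parts\<close>, \<open>expectation_quadratic_form\<close>). Because the expansion tolerates a bounded
  smooth factor, each residual can be multiplied by its own conjugate, and its second moment is seen
  to be \<open>O(1 / sqrt N)\<close> directly (\<open>residuals_small\<close>).

  Put \<open>z = w + 1 / w\<close> with \<open>\<bar>w\<bar> < 1\<close>. Then \<open>s\<close> tends to \<open>- w\<close> and \<open>g\<close> to \<open>- w / (1 - \<theta> w)\<close> in probability
  (\<open>stieltjes_close\<close>). The first is the Stieltjes transform of the semicircle law, by the generating
  function of the Chebyshev polynomials (\<open>integral_sc_generating\<close>). By partial fractions the second
  belongs to the measure with density \<open>\<mu>(x) p(x; \<theta>)\<close>, where \<open>\<mu>\<close> is the semicircle density, and an atom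
  at the outlier \<open>\<theta> + 1 / \<theta>\<close> when \<open>\<theta> > 1\<close> (\<open>stieltjes_overlap\<close>). The imaginary part of a Stieltjes
  transform is a Poisson integral, and finitely many of these control the mass of an interval
  (\<open>mass_lower_bound\<close>). Counting eigenvalues with the semicircle law identifies the first \<open>c N\<close> of them
  with those above the threshold \<open>m\<close>, up to a window around \<open>m\<close> that may be taken arbitrarily small,
  and the overlap measure gives the limit of the sum (\<open>top_overlap_sum\<close>).

  The remaining claims concern this limit measure, whose total mass is 1 for every \<open>\<theta>\<close>. The profile
  \<open>p(x; \<theta>)\<close> increases in \<open>x\<close>, so the part above the threshold has at least its share \<open>c\<close>; and the difference
  of the profiles for two values of \<open>\<theta>\<close> changes sign exactly once, which gives monotonicity in \<open>\<theta>\<close>.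
\<close>

section \<open>Resolvents of real symmetric matrices\<close>

definition symm :: "nat \<Rightarrow> (nat \<Rightarrow> nat \<Rightarrow> real) \<Rightarrow> bool" where
  "symm n B \<longleftrightarrow> (\<forall>i<n. \<forall>j<n. B i j = B j i)"

definition shifted_mat :: "nat \<Rightarrow> (nat \<Rightarrow> nat \<Rightarrow> real) \<Rightarrow> complex \<Rightarrow> complex mat" where
  "shifted_mat n B z = mat n n (\<lambda>(i, j). of_real (B i j) - (if i = j then z else 0))"

text \<open>
  The inverse of \<open>B - z\<close>, written with the adjugate so that its entries are visibly rational, hence
  measurable, functions of the entries of \<open>B\<close>. Matrices are functions of two indices, which makes
  it easy to shift a single entry.
\<close>

definition resolvent :: "nat \<Rightarrow> (nat \<Rightarrow> nat \<Rightarrow> real) \<Rightarrow> complex \<Rightarrow> nat \<Rightarrow> nat \<Rightarrow> complex" where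
  "resolvent n B z i j = adj_mat (shifted_mat n B z) $$ (i, j) / Determinant.det (shifted_mat n B z)"

lemma shifted_mat_carrier [simp]: "shifted_mat n B z \<in> carrier_mat n n"
  by (simp add: shifted_mat_def)

lemma shifted_mat_mult_vec:
  assumes "i < n"
  shows "(\<Sum>j<n. shifted_mat n B z $$ (i, j) * x j) = (\<Sum>j<n. of_real (B i j) * x j) - z * x i"
proof -
  have "(\<Sum>j<n. shifted_mat n B z $$ (i, j) * x j) =
        (\<Sum>j<n. of_real (B i j) * x j - (if j = i then z * x i else 0))"
    using assms by (intro sum.cong) (auto simp: shifted_mat_def algebra_simps)
  also have "\<dots> = (\<Sum>j<n. of_real (B i j) * x j) - z * x i"
    using assms by (simp add: sum_subtractf)
  finally show ?thesis .
qed

lemma vec_mult_shifted_mat: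
  assumes "j < n"
  shows "(\<Sum>i<n. x i * shifted_mat n B z $$ (i, j)) = (\<Sum>i<n. x i * of_real (B i j)) - z * x j"
proof -
  have "(\<Sum>i<n. x i * shifted_mat n B z $$ (i, j)) =
        (\<Sum>i<n. x i * of_real (B i j) - (if i = j then z * x j else 0))"
    using assms by (intro sum.cong) (auto simp: shifted_mat_def algebra_simps)
  also have "\<dots> = (\<Sum>i<n. x i * of_real (B i j)) - z * x j"
    using assms by (simp add: sum_subtractf)
  finally show ?thesis .
qed

text \<open>
  Taking the inner product of \<open>(B - z) x\<close> with \<open>x\<close> gives coercivity: off the real axis the norm of
  \<open>x\<close> is controlled by that of \<open>(B - z) x\<close>. Invertibility of the shifted matrix and all norm bounds
  on the resolvent come from this one identity.
\<close>

lemma resolvent_energy: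
  fixes x :: "nat \<Rightarrow> complex"
  assumes "symm n B"
  shows "Im z * (\<Sum>i<n. (cmod (x i))\<^sup>2) =
         - Im (\<Sum>i<n. cnj (x i) * ((\<Sum>j<n. of_real (B i j) * x j) - z * x i))"
proof -
  let ?Q = "\<Sum>i<n. \<Sum>j<n. of_real (B i j) * cnj (x i) * x j"
  have "cnj ?Q = (\<Sum>i<n. \<Sum>j<n. of_real (B i j) * x i * cnj (x j))"
    by simp
  also have "\<dots> = (\<Sum>j<n. \<Sum>i<n. of_real (B i j) * x i * cnj (x j))"
    by (rule sum.swap)
  also have "\<dots> = ?Q"
    using assms by (intro sum.cong) (auto simp: symm_def)
  finally have "Im (cnj ?Q) = Im ?Q" by (rule arg_cong)
  then have Q: "Im ?Q = 0" by (simp del: cnj_sum Im_sum)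
  \<comment> \<open>The quadratic form of B is real, so only the shift by z contributes to the imaginary part.\<close>
  have "(\<Sum>i<n. cnj (x i) * ((\<Sum>j<n. of_real (B i j) * x j) - z * x i)) =
        ?Q - z * (\<Sum>i<n. cnj (x i) * x i)"
    by (simp add: algebra_simps sum_subtractf sum_distrib_left)
  also have "(\<Sum>i<n. cnj (x i) * x i) = of_real (\<Sum>i<n. (cmod (x i))\<^sup>2)"
    by (simp add: complex_norm_square mult.commute del: of_real_power)
  finally show ?thesis
    using Q by (simp del: of_real_sum)
qed

lemma resolvent_l2_bound:
  fixes x y :: "nat \<Rightarrow> complex"
  assumes "symm n B" "Im z > 0"
    and y: "\<And>i. i < n \<Longrightarrow> (\<Sum>j<n. of_real (B i j) * x j) - z * x i = y i"
  shows "(\<Sum>i<n. (cmod (x i))\<^sup>2) \<le> (\<Sum>i<n. (cmod (y i))\<^sup>2) / (Im z)\<^sup>2"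
proof -
  let ?X = "\<Sum>i<n. (cmod (x i))\<^sup>2" and ?Y = "\<Sum>i<n. (cmod (y i))\<^sup>2" and ?e = "Im z"
  have "?e * ?X = - Im (\<Sum>i<n. cnj (x i) * y i)"
    using resolvent_energy[OF assms(1), of z x] y by simp
  also have "\<dots> \<le> cmod (\<Sum>i<n. cnj (x i) * y i)"
    using abs_Im_le_cmod[of "\<Sum>i<n. cnj (x i) * y i"] by linarith
  also have "\<dots> \<le> (\<Sum>i<n. cmod (cnj (x i) * y i))" by (rule norm_sum)
  also have "\<dots> \<le> (\<Sum>i<n. (?e * (cmod (x i))\<^sup>2 + (cmod (y i))\<^sup>2 / ?e) / 2)"
  proof (rule sum_mono)
    fix i
    have "0 \<le> (?e * cmod (x i) - cmod (y i))\<^sup>2 / ?e" using assms by simp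
    also have "\<dots> = ?e * (cmod (x i))\<^sup>2 + (cmod (y i))\<^sup>2 / ?e - 2 * (cmod (x i) * cmod (y i))"
      using assms by (simp add: field_simps power2_eq_square)
    finally show "cmod (cnj (x i) * y i) \<le> (?e * (cmod (x i))\<^sup>2 + (cmod (y i))\<^sup>2 / ?e) / 2"
      by (simp add: norm_mult)
  qed
  also have "\<dots> = (?e * ?X + ?Y / ?e) / 2"
    by (simp add: sum_divide_distrib sum.distrib sum_distrib_left add_divide_distrib)
  finally have "?e * ?X \<le> ?Y / ?e" by simp
  then show ?thesis using assms by (simp add: field_simps power2_eq_square)
qed

lemma det_shifted_mat_nonzero:
  assumes "symm n B" "Im z > 0"
  shows "Determinant.det (shifted_mat n B z) \<noteq> 0"
proof
  assume "Determinant.det (shifted_mat n B z) = 0"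
  then obtain v where v: "v \<in> carrier_vec n" "v \<noteq> 0\<^sub>v n" "shifted_mat n B z *\<^sub>v v = 0\<^sub>v n"
    using det_0_iff_vec_prod_zero_field[of "shifted_mat n B z" n] by auto
  have "(\<Sum>j<n. of_real (B i j) * vec_index v j) - z * vec_index v i = 0" if i: "i < n" for i
  proof -
    have "vec_index (shifted_mat n B z *\<^sub>v v) i = (\<Sum>j<n. shifted_mat n B z $$ (i, j) * vec_index v j)"
      using i v(1) by (auto simp: scalar_prod_def shifted_mat_def intro!: sum.cong)
    then show ?thesis using v(3) i shifted_mat_mult_vec[OF i, of B z "vec_index v"] by simp
  qed
  then have "(\<Sum>i<n. (cmod (vec_index v i))\<^sup>2) \<le> 0"
    using resolvent_l2_bound[OF assms, of "vec_index v" "\<lambda>_. 0"] by simp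
  then have "(\<Sum>i<n. (cmod (vec_index v i))\<^sup>2) = 0"
    by (meson sum_nonneg zero_le_power2 antisym)
  then have "\<forall>i<n. vec_index v i = 0"
    by (subst (asm) sum_nonneg_eq_0_iff) auto
  then have "v = 0\<^sub>v n" using v(1) by (intro eq_vecI) auto
  then show False using v by simp
qed

lemma resolvent_right_inverse:
  assumes "symm n B" "Im z > 0" "i < n" "j < n"
  shows "(\<Sum>k<n. of_real (B i k) * resolvent n B z k j) - z * resolvent n B z i j = (if i = j then 1 else 0)"
proof -
  let ?C = "shifted_mat n B z"
  have d: "Determinant.det ?C \<noteq> 0" using det_shifted_mat_nonzero assms by blast
  have adj: "adj_mat ?C \<in> carrier_mat n n" by (rule adj_mat(1)) simp
  have "(?C * adj_mat ?C) $$ (i, j) = (\<Sum>k<n. ?C $$ (i, k) * adj_mat ?C $$ (k, j))"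
    using assms adj by (auto simp: scalar_prod_def shifted_mat_def intro!: sum.cong)
  moreover have "(?C * adj_mat ?C) $$ (i, j) = (if i = j then Determinant.det ?C else 0)"
    using assms by (subst adj_mat(2)[of _ n]) auto
  ultimately have "(\<Sum>k<n. ?C $$ (i, k) * (adj_mat ?C $$ (k, j) / Determinant.det ?C)) = (if i = j then 1 else 0)"
    using d by (simp add: sum_divide_distrib[symmetric] split: if_splits)
  then show ?thesis
    using shifted_mat_mult_vec[OF assms(3), of B z "\<lambda>k. resolvent n B z k j"] by (simp add: resolvent_def)
qed

lemma resolvent_left_inverse:
  assumes "symm n B" "Im z > 0" "i < n" "j < n"
  shows "(\<Sum>k<n. resolvent n B z i k * of_real (B k j)) - z * resolvent n B z i j = (if i = j then 1 else 0)"
proof -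
  let ?C = "shifted_mat n B z"
  have d: "Determinant.det ?C \<noteq> 0" using det_shifted_mat_nonzero assms by blast
  have adj: "adj_mat ?C \<in> carrier_mat n n" by (rule adj_mat(1)) simp
  have "(adj_mat ?C * ?C) $$ (i, j) = (\<Sum>k<n. adj_mat ?C $$ (i, k) * ?C $$ (k, j))"
    using assms adj by (auto simp: scalar_prod_def shifted_mat_def intro!: sum.cong)
  moreover have "(adj_mat ?C * ?C) $$ (i, j) = (if i = j then Determinant.det ?C else 0)"
    using assms by (subst adj_mat(3)[of _ n]) auto
  ultimately have "(\<Sum>k<n. adj_mat ?C $$ (i, k) / Determinant.det ?C * ?C $$ (k, j)) = (if i = j then 1 else 0)"
    using d by (simp add: sum_divide_distrib[symmetric] split: if_splits)
  then show ?thesis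
    using vec_mult_shifted_mat[OF assms(4), of "\<lambda>k. resolvent n B z i k" B z] by (simp add: resolvent_def)
qed

text \<open>
  Uniqueness of the solution of \<open>(B - z) x = y\<close>. It replaces matrix algebra in what follows: the
  symmetry of the resolvent, the resolvent identity and the spectral formula are all obtained by
  exhibiting a solution.
\<close>

lemma resolvent_solves:
  fixes x y :: "nat \<Rightarrow> complex"
  assumes "symm n B" "Im z > 0"
    and y: "\<And>i. i < n \<Longrightarrow> (\<Sum>j<n. of_real (B i j) * x j) - z * x i = y i"
    and "p < n"
  shows "x p = (\<Sum>q<n. resolvent n B z p q * y q)"
proof -
  let ?G = "resolvent n B z"
  have "(\<Sum>q<n. ?G p q * y q) = (\<Sum>q<n. ?G p q * ((\<Sum>j<n. of_real (B q j) * x j) - z * x q))"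
    using y by (intro sum.cong) auto
  also have "\<dots> = (\<Sum>q<n. \<Sum>j<n. ?G p q * of_real (B q j) * x j) - (\<Sum>j<n. z * ?G p j * x j)"
    by (simp add: algebra_simps sum_subtractf sum_distrib_left)
  also have "(\<Sum>q<n. \<Sum>j<n. ?G p q * of_real (B q j) * x j) = (\<Sum>j<n. \<Sum>q<n. ?G p q * of_real (B q j) * x j)"
    by (rule sum.swap)
  also have "\<dots> - (\<Sum>j<n. z * ?G p j * x j) =
      (\<Sum>j<n. ((\<Sum>q<n. ?G p q * of_real (B q j)) - z * ?G p j) * x j)"
    by (simp add: algebra_simps sum_subtractf sum_distrib_left)
  also have "\<dots> = (\<Sum>j<n. (if p = j then x j else 0))"
    using resolvent_left_inverse[OF assms(1,2,4)] by (intro sum.cong) auto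
  also have "\<dots> = x p" using assms(4) by simp
  finally show ?thesis by simp
qed

lemma resolvent_symmetric:
  assumes "symm n B" "Im z > 0" "i < n" "p < n"
  shows "resolvent n B z i p = resolvent n B z p i"
proof -
  have "resolvent n B z i p = (\<Sum>q<n. resolvent n B z p q * (if i = q then 1 else 0))"
  \<comment> \<open>Since B is symmetric, row i of the resolvent solves the same linear system as column i.\<close>
  proof (rule resolvent_solves[OF assms(1,2) _ assms(4)])
    fix j assume j: "j < n"
    show "(\<Sum>k<n. of_real (B j k) * resolvent n B z i k) - z * resolvent n B z i j = (if i = j then 1 else 0)"
    proof -
      have "(\<Sum>k<n. of_real (B j k) * resolvent n B z i k) = (\<Sum>k<n. resolvent n B z i k * of_real (B k j))"
        using assms(1) j by (intro sum.cong) (auto simp: symm_def)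
      then show ?thesis using resolvent_left_inverse[OF assms(1,2,3) j] by simp
    qed
  qed
  also have "\<dots> = (\<Sum>q<n. if i = q then resolvent n B z p q else 0)"
    by (intro sum.cong) auto
  also have "\<dots> = resolvent n B z p i" using assms(3) by simp
  finally show ?thesis .
qed

lemma resolvent_identity:
  assumes "symm n B" "symm n B'" "Im z > 0" "p < n" "q < n"
  shows "resolvent n B' z p q - resolvent n B z p q =
     - (\<Sum>k<n. \<Sum>l<n. resolvent n B z p k * of_real (B' k l - B k l) * resolvent n B' z l q)"
proof -
  let ?G = "resolvent n B z" and ?H = "resolvent n B' z"
  have "?H p q = (\<Sum>k<n. ?G p k * ((if k = q then 1 else 0) - (\<Sum>l<n. of_real (B' k l - B k l) * ?H l q)))"
  proof (rule resolvent_solves[OF assms(1,3) _ assms(4)])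
    fix i assume "i < n"
    then show "(\<Sum>j<n. of_real (B i j) * ?H j q) - z * ?H i q =
       (if i = q then 1 else 0) - (\<Sum>l<n. of_real (B' i l - B i l) * ?H l q)"
      using resolvent_right_inverse[OF assms(2,3) _ assms(5), of i]
      by (simp add: algebra_simps sum_subtractf)
  qed
  also have "\<dots> = (\<Sum>k<n. (if k = q then ?G p k else 0) - (\<Sum>l<n. ?G p k * of_real (B' k l - B k l) * ?H l q))"
    by (intro sum.cong) (auto simp: algebra_simps sum_distrib_left)
  also have "\<dots> = ?G p q - (\<Sum>k<n. \<Sum>l<n. ?G p k * of_real (B' k l - B k l) * ?H l q)"
    using assms by (simp add: sum_subtractf)
  finally show ?thesis by simp
qed

lemma measurable_det:
  fixes C :: "'a \<Rightarrow> complex mat"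
  assumes "\<And>x. C x \<in> carrier_mat n n"
    and "\<And>i j. i < n \<Longrightarrow> j < n \<Longrightarrow> (\<lambda>x. C x $$ (i, j)) \<in> borel_measurable M"
  shows "(\<lambda>x. Determinant.det (C x)) \<in> borel_measurable M"
proof -
  have "(\<lambda>x. Determinant.det (C x)) =
     (\<lambda>x. \<Sum>p | p permutes {0..<n}. signof p * (\<Prod>i = 0..<n. C x $$ (i, p i)))"
    using assms(1) by (simp add: det_def'[of _ n])
  moreover have "\<dots> \<in> borel_measurable M"
  proof (intro borel_measurable_sum borel_measurable_times borel_measurable_const borel_measurable_prod)
    fix p i assume "p \<in> {p. p permutes {0..<n}}" "i \<in> {0..<n}"
    then show "(\<lambda>x. C x $$ (i, p i)) \<in> borel_measurable M"
      using permutes_in_image[of p "{0..<n}" i] by (intro assms(2)) auto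
  qed
  ultimately show ?thesis by simp
qed

lemma measurable_resolvent:
  assumes "\<And>i j. i < n \<Longrightarrow> j < n \<Longrightarrow> (\<lambda>x. B x i j) \<in> borel_measurable M" and "p < n" "q < n"
  shows "(\<lambda>x. resolvent n (B x) z p q) \<in> borel_measurable M"
proof -
  let ?C = "\<lambda>x. shifted_mat n (B x) z"
  have C: "(\<lambda>x. ?C x $$ (i, j)) \<in> borel_measurable M" if "i < n" "j < n" for i j
  proof -
    have "(\<lambda>x. ?C x $$ (i, j)) = (\<lambda>x. of_real (B x i j) - (if i = j then z else 0))"
      using that by (simp add: shifted_mat_def)
    then show ?thesis using assms(1)[OF that] by simp
  qed
  have d: "(\<lambda>x. Determinant.det (?C x)) \<in> borel_measurable M"
    by (rule measurable_det[of _ n]) (auto intro: C)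
  have "(\<lambda>x. Determinant.det (mat_delete (?C x) q p)) \<in> borel_measurable M"
  proof (rule measurable_det[of _ "n - 1"])
    fix i j assume ij: "i < n - 1" "j < n - 1"
    have "(\<lambda>x. mat_delete (?C x) q p $$ (i, j)) =
      (\<lambda>x. ?C x $$ (if i < q then i else Suc i, if j < p then j else Suc j))"
      using ij by (auto simp: mat_delete_def shifted_mat_def)
    then show "(\<lambda>x. mat_delete (?C x) q p $$ (i, j)) \<in> borel_measurable M"
      using ij by (auto intro!: C)
  qed (auto simp: mat_delete_def shifted_mat_def)
  then have "(\<lambda>x. adj_mat (?C x) $$ (p, q)) \<in> borel_measurable M"
    using assms(2,3) by (simp add: adj_mat_def cofactor_def shifted_mat_def)
  with d show ?thesis unfolding resolvent_def by simp
qed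

section \<open>Dependence of the resolvent on a single entry\<close>

definition unit_vec_fun :: "nat \<Rightarrow> nat \<Rightarrow> real" where
  "unit_vec_fun k i = (if i = k then 1 else 0)"

definition in_unit_ball :: "nat \<Rightarrow> (nat \<Rightarrow> real) \<Rightarrow> bool" where
  "in_unit_ball n x \<longleftrightarrow> (\<Sum>i<n. (x i)\<^sup>2) \<le> 1"

definition res_form ::
  "nat \<Rightarrow> (nat \<Rightarrow> nat \<Rightarrow> real) \<Rightarrow> complex \<Rightarrow> (nat \<Rightarrow> real) \<Rightarrow> (nat \<Rightarrow> real) \<Rightarrow> complex" where
  "res_form n B z x y = (\<Sum>p<n. \<Sum>q<n. of_real (x p) * resolvent n B z p q * of_real (y q))"

text \<open>
  The positions tied together by symmetry. As a set it has one element on the diagonal, so that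
  diagonal and off-diagonal perturbations are treated alike.
\<close>

definition entry_pairs :: "nat \<Rightarrow> nat \<Rightarrow> (nat \<times> nat) set" where
  "entry_pairs i j = {(i, j), (j, i)}"

definition shift_entry ::
  "(nat \<Rightarrow> nat \<Rightarrow> real) \<Rightarrow> nat \<Rightarrow> nat \<Rightarrow> real \<Rightarrow> nat \<Rightarrow> nat \<Rightarrow> real" where
  "shift_entry B i j t k l = B k l + (if (k, l) \<in> entry_pairs i j then t else 0)"

lemma in_unit_ball_unit_vec_fun [simp]: "in_unit_ball n (unit_vec_fun k)"
proof -
  have "(\<Sum>i<n. (unit_vec_fun k i)\<^sup>2) = (\<Sum>i<n. if i = k then 1 else 0)"
    by (intro sum.cong) (auto simp: unit_vec_fun_def)
  then show ?thesis by (simp add: in_unit_ball_def)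
qed

lemma finite_entry_pairs [simp]: "finite (entry_pairs i j)"
  by (simp add: entry_pairs_def)

lemma card_entry_pairs: "card (entry_pairs i j) \<le> 2"
  by (cases "i = j") (simp_all add: entry_pairs_def)

lemma symm_shift_entry: "symm n B \<Longrightarrow> symm n (shift_entry B i j t)"
  by (auto simp: symm_def shift_entry_def entry_pairs_def)

lemma shift_entry_add: "shift_entry (shift_entry B i j s) i j t = shift_entry B i j (s + t)"
  by (auto simp: shift_entry_def fun_eq_iff)

lemma res_form_unit_left:
  "p < n \<Longrightarrow> res_form n B z (unit_vec_fun p) y = (\<Sum>q<n. resolvent n B z p q * of_real (y q))"
proof -
  assume p: "p < n"
  have "res_form n B z (unit_vec_fun p) y =
     (\<Sum>k<n. if k = p then (\<Sum>q<n. resolvent n B z p q * of_real (y q)) else 0)"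
    unfolding res_form_def by (intro sum.cong) (auto simp: unit_vec_fun_def)
  then show ?thesis using p by simp
qed

lemma res_form_unit_unit:
  assumes "p < n" "q < n"
  shows "res_form n B z (unit_vec_fun p) (unit_vec_fun q) = resolvent n B z p q"
proof -
  have "res_form n B z (unit_vec_fun p) (unit_vec_fun q) =
      (\<Sum>k<n. if k = q then resolvent n B z p q else 0)"
    unfolding res_form_unit_left[OF assms(1)]
    by (intro sum.cong) (auto simp: unit_vec_fun_def)
  then show ?thesis using assms by simp
qed

lemma res_form_expand_left:
  "res_form n B z x y = (\<Sum>p<n. of_real (x p) * res_form n B z (unit_vec_fun p) y)"
  unfolding res_form_def[of n B z x y]
  by (intro sum.cong refl) (simp add: res_form_unit_left sum_distrib_left mult.assoc)

lemma res_form_symmetric: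
  assumes "symm n B" "Im z > 0"
  shows "res_form n B z x y = res_form n B z y x"
proof -
  have "res_form n B z x y = (\<Sum>q<n. \<Sum>p<n. of_real (x p) * resolvent n B z p q * of_real (y q))"
    unfolding res_form_def by (rule sum.swap)
  also have "\<dots> = res_form n B z y x"
    unfolding res_form_def using resolvent_symmetric[OF assms] by (intro sum.cong) auto
  finally show ?thesis .
qed

lemma res_form_solves:
  assumes "symm n B" "Im z > 0" "i < n"
  shows "(\<Sum>j<n. of_real (B i j) * res_form n B z (unit_vec_fun j) y) -
    z * res_form n B z (unit_vec_fun i) y = of_real (y i)"
proof -
  let ?x = "\<lambda>p. res_form n B z (unit_vec_fun p) y"
  have "(\<Sum>j<n. of_real (B i j) * ?x j) - z * ?x i =
    (\<Sum>j<n. \<Sum>q<n. of_real (B i j) * resolvent n B z j q * of_real (y q))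
     - (\<Sum>q<n. z * resolvent n B z i q * of_real (y q))"
    using assms(3) by (simp add: res_form_unit_left sum_distrib_left mult.assoc)
  also have "(\<Sum>j<n. \<Sum>q<n. of_real (B i j) * resolvent n B z j q * of_real (y q)) =
     (\<Sum>q<n. \<Sum>j<n. of_real (B i j) * resolvent n B z j q * of_real (y q))"
    by (rule sum.swap)
  also have "\<dots> - (\<Sum>q<n. z * resolvent n B z i q * of_real (y q)) =
    (\<Sum>q<n. ((\<Sum>j<n. of_real (B i j) * resolvent n B z j q) - z * resolvent n B z i q) * of_real (y q))"
    by (simp add: sum_subtractf sum_distrib_left sum_distrib_right algebra_simps)
  also have "\<dots> = (\<Sum>q<n. if i = q then of_real (y q) else 0)"
    using resolvent_right_inverse[OF assms] by (intro sum.cong) auto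
  also have "\<dots> = of_real (y i)" using assms(3) by simp
  finally show ?thesis .
qed

text \<open>
  The point is that the sum of all \<open>n\<close> squares is bounded independently of \<open>n\<close>: the vector
  \<open>(B - z)\<^sup>-\<^sup>1 y\<close> has norm at most \<open>1 / Im z\<close>.
\<close>

lemma res_form_l2:
  assumes "symm n B" "Im z > 0" "in_unit_ball n y"
  shows "(\<Sum>p<n. (cmod (res_form n B z (unit_vec_fun p) y))\<^sup>2) \<le> 1 / (Im z)\<^sup>2"
proof -
  have "(\<Sum>p<n. (cmod (res_form n B z (unit_vec_fun p) y))\<^sup>2) \<le>
      (\<Sum>p<n. (cmod (of_real (y p)))\<^sup>2) / (Im z)\<^sup>2"
    by (rule resolvent_l2_bound[OF assms(1,2) res_form_solves[OF assms(1,2)]])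
  also have "\<dots> \<le> 1 / (Im z)\<^sup>2"
    using assms(3) by (intro divide_right_mono) (auto simp: in_unit_ball_def)
  finally show ?thesis .
qed

lemma sum_mult_le_l2:
  fixes f g :: "nat \<Rightarrow> real"
  assumes "(\<Sum>i<n. (f i)\<^sup>2) \<le> a\<^sup>2" "(\<Sum>i<n. (g i)\<^sup>2) \<le> b\<^sup>2" "0 \<le> a" "0 \<le> b"
  shows "(\<Sum>i<n. \<bar>f i\<bar> * \<bar>g i\<bar>) \<le> a * b"
proof -
  have "(\<Sum>i<n. \<bar>f i\<bar> * \<bar>g i\<bar>) \<le> L2_set f {..<n} * L2_set g {..<n}"
    by (rule L2_set_mult_ineq)
  also have "\<dots> \<le> a * b"
    using assms by (intro mult_mono) (auto simp: L2_set_def real_le_lsqrt sum_nonneg)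
  finally show ?thesis .
qed

lemma res_form_bound:
  assumes "symm n B" "Im z > 0" "in_unit_ball n x" "in_unit_ball n y"
  shows "cmod (res_form n B z x y) \<le> 1 / Im z"
proof -
  have "cmod (res_form n B z x y) \<le> (\<Sum>p<n. \<bar>x p\<bar> * \<bar>cmod (res_form n B z (unit_vec_fun p) y)\<bar>)"
    unfolding res_form_expand_left[of n B z x y] by (rule sum_norm_le) (simp add: norm_mult)
  also have "\<dots> \<le> 1 * (1 / Im z)"
    using assms res_form_l2[OF assms(1,2,4)]
    by (intro sum_mult_le_l2) (auto simp: in_unit_ball_def power_divide)
  finally show ?thesis by simp
qed

lemma res_form_identity:
  assumes "symm n B" "Im z > 0" "i < n" "j < n"
  shows "res_form n (shift_entry B i j t) z x y - res_form n B z x y =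
    - of_real t * (\<Sum>(k, l)\<in>entry_pairs i j.
        res_form n B z x (unit_vec_fun k) * res_form n (shift_entry B i j t) z (unit_vec_fun l) y)"
proof -
  let ?B = "shift_entry B i j t"
  let ?G = "resolvent n B z" and ?H = "resolvent n ?B z"
  have d: "?H p q - ?G p q = - of_real t * (\<Sum>(k, l)\<in>entry_pairs i j. ?G p k * ?H l q)"
    if "p < n" "q < n" for p q
  proof -
    have "?H p q - ?G p q = - (\<Sum>k<n. \<Sum>l<n. ?G p k * of_real (?B k l - B k l) * ?H l q)"
      using that assms by (intro resolvent_identity symm_shift_entry)
    also have "(\<Sum>k<n. \<Sum>l<n. ?G p k * of_real (?B k l - B k l) * ?H l q) =
       (\<Sum>(k, l)\<in>{..<n} \<times> {..<n}. ?G p k * of_real (?B k l - B k l) * ?H l q)"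
      by (rule sum.cartesian_product)
    also have "\<dots> = (\<Sum>(k, l)\<in>entry_pairs i j. ?G p k * of_real (?B k l - B k l) * ?H l q)"
      using assms
      by (intro sum.mono_neutral_right) (auto simp: entry_pairs_def shift_entry_def split: if_splits)
    also have "\<dots> = of_real t * (\<Sum>(k, l)\<in>entry_pairs i j. ?G p k * ?H l q)"
      unfolding sum_distrib_left by (intro sum.cong) (auto simp: entry_pairs_def shift_entry_def)
    finally show ?thesis by simp
  qed
  have lt: "k < n" "l < n" if "(k, l) \<in> entry_pairs i j" for k l
    using that assms by (auto simp: entry_pairs_def)
  have ek: "(\<Sum>p<n. of_real (x p) * ?G p k) = res_form n B z x (unit_vec_fun k)" if "k < n" for k
    unfolding res_form_expand_left[of n B z x] using that
    by (intro sum.cong) (auto simp: res_form_unit_unit)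
  have "res_form n ?B z x y - res_form n B z x y =
     (\<Sum>p<n. \<Sum>q<n. of_real (x p) * (?H p q - ?G p q) * of_real (y q))"
    by (simp add: res_form_def algebra_simps sum_subtractf)
  also have "\<dots> = (\<Sum>p<n. \<Sum>q<n. \<Sum>(k, l)\<in>entry_pairs i j.
       - of_real t * ((of_real (x p) * ?G p k) * (?H l q * of_real (y q))))"
    by (intro sum.cong refl) (simp add: d sum_distrib_left sum_distrib_right case_prod_unfold mult_ac sum_negf)
  also have "\<dots> = (\<Sum>p<n. \<Sum>(k, l)\<in>entry_pairs i j. \<Sum>q<n.
       - of_real t * ((of_real (x p) * ?G p k) * (?H l q * of_real (y q))))"
    unfolding case_prod_unfold by (intro sum.cong refl sum.swap)
  also have "\<dots> = (\<Sum>(k, l)\<in>entry_pairs i j. \<Sum>p<n. \<Sum>q<n.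
       - of_real t * ((of_real (x p) * ?G p k) * (?H l q * of_real (y q))))"
    unfolding case_prod_unfold by (rule sum.swap)
  also have "\<dots> = (\<Sum>(k, l)\<in>entry_pairs i j.
       - of_real t * ((\<Sum>p<n. of_real (x p) * ?G p k) * (\<Sum>q<n. ?H l q * of_real (y q))))"
    unfolding sum_product by (simp add: sum_distrib_left case_prod_unfold)
  also have "\<dots> = (\<Sum>(k, l)\<in>entry_pairs i j.
       - of_real t * (res_form n B z x (unit_vec_fun k) * res_form n ?B z (unit_vec_fun l) y))"
    using lt by (intro sum.cong refl) (auto simp: ek res_form_unit_left)
  finally show ?thesis by (simp add: sum_distrib_left case_prod_unfold)
qed

text \<open>
  Derivatives of resolvent forms are read off from the resolvent identity, which yields a
  remainder that is quadratic in the increment.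
\<close>

lemma has_vector_derivative_quadratic_bound:
  fixes f :: "real \<Rightarrow> 'b::real_normed_vector"
  assumes "\<And>h. norm (f (t + h) - f t - h *\<^sub>R D) \<le> C * h\<^sup>2"
  shows "(f has_vector_derivative D) (at t)"
  unfolding has_vector_derivative_def has_derivative_at
proof
  show "bounded_linear (\<lambda>h. h *\<^sub>R D)" by (rule bounded_linear_scaleR_left)
  show "(\<lambda>h. norm (f (t + h) - f t - h *\<^sub>R D) / norm h) \<midarrow>0\<rightarrow> 0"
  proof (rule tendsto_sandwich[where f = "\<lambda>_. 0" and h = "\<lambda>h. C * \<bar>h\<bar>"])
    show "\<forall>\<^sub>F h in at 0. norm (f (t + h) - f t - h *\<^sub>R D) / norm h \<le> C * \<bar>h\<bar>"
    proof (rule eventually_mono[OF eventually_at_ball'[of 1]])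
      fix h :: real assume "h \<in> ball 0 1 \<and> h \<noteq> 0 \<and> h \<in> UNIV"
      then show "norm (f (t + h) - f t - h *\<^sub>R D) / norm h \<le> C * \<bar>h\<bar>"
        using assms[of h] by (simp add: field_simps power2_eq_square abs_mult_self_eq)
    qed simp
    show "((\<lambda>h. C * \<bar>h\<bar>) \<longlongrightarrow> 0) (at 0)" by (auto intro!: tendsto_eq_intros)
  qed auto
qed

lemma res_form_has_derivative:
  assumes B: "symm n B" and z: "Im z > 0" and ij: "i < n" "j < n"
    and x: "in_unit_ball n x" and y: "in_unit_ball n y"
  shows "((\<lambda>t. res_form n (shift_entry B i j t) z x y) has_vector_derivative
     (- (\<Sum>(k, l)\<in>entry_pairs i j.
        res_form n (shift_entry B i j t) z x (unit_vec_fun k) *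
        res_form n (shift_entry B i j t) z (unit_vec_fun l) y))) (at t)"
proof (rule has_vector_derivative_quadratic_bound)
  fix h
  let ?B = "shift_entry B i j t" and ?B' = "shift_entry B i j (t + h)"
  have B': "?B' = shift_entry ?B i j h" by (simp add: shift_entry_add)
  have S: "symm n ?B" "symm n ?B'" using B by (auto intro: symm_shift_entry)
  let ?e = unit_vec_fun and ?c = "1 / Im z"
  have c: "cmod (res_form n A z (?e k) (?e l)) \<le> ?c" "cmod (res_form n A z x (?e k)) \<le> ?c"
      "cmod (res_form n A z (?e k) y) \<le> ?c" if "symm n A" for A k l
    using that z x y by (auto intro!: res_form_bound)
  \<comment> \<open>The form is Lipschitz in the entry, again by the resolvent identity.\<close>
  have d: "cmod (res_form n ?B' z (?e l) y - res_form n ?B z (?e l) y) \<le> \<bar>h\<bar> * (2 * (?c * ?c))" for l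
  proof -
    have "cmod (\<Sum>(k, m)\<in>entry_pairs i j. res_form n ?B z (?e l) (?e k) * res_form n ?B' z (?e m) y)
       \<le> real (card (entry_pairs i j)) * (?c * ?c)"
      using z
      by (intro sum_norm_bound) (auto simp: norm_mult simp del: times_divide_eq_left times_divide_eq_right intro!: mult_mono c S)
    also have "\<dots> \<le> 2 * (?c * ?c)" using card_entry_pairs[of i j] by (intro mult_right_mono) auto
    finally show ?thesis
      using res_form_identity[OF S(1) z ij, of h "?e l" y]
      by (simp only: B' norm_mult norm_minus_cancel norm_of_real mult_left_mono abs_ge_zero)
  qed
  have "res_form n ?B' z x y - res_form n ?B z x y -
      h *\<^sub>R (- (\<Sum>(k, l)\<in>entry_pairs i j. res_form n ?B z x (?e k) * res_form n ?B z (?e l) y)) =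
      - of_real h * (\<Sum>(k, l)\<in>entry_pairs i j. res_form n ?B z x (?e k) *
         (res_form n ?B' z (?e l) y - res_form n ?B z (?e l) y))"
    using res_form_identity[OF S(1) z ij, of h x y]
    by (simp add: B' scaleR_conv_of_real case_prod_unfold right_diff_distrib sum_subtractf)
  moreover have "cmod (\<Sum>(k, l)\<in>entry_pairs i j. res_form n ?B z x (?e k) *
         (res_form n ?B' z (?e l) y - res_form n ?B z (?e l) y)) \<le> real (card (entry_pairs i j)) * (?c * (\<bar>h\<bar> * (2 * (?c * ?c))))"
    using z
    by (intro sum_norm_bound) (auto simp: norm_mult simp del: times_divide_eq_left times_divide_eq_right intro!: mult_mono c d S)
  moreover have "\<dots> \<le> 2 * (?c * (\<bar>h\<bar> * (2 * (?c * ?c))))"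
    using card_entry_pairs[of i j] z by (intro mult_right_mono) auto
  ultimately have "cmod (res_form n ?B' z x y - res_form n ?B z x y -
      h *\<^sub>R (- (\<Sum>(k, l)\<in>entry_pairs i j. res_form n ?B z x (?e k) * res_form n ?B z (?e l) y)))
      \<le> \<bar>h\<bar> * (2 * (?c * (\<bar>h\<bar> * (2 * (?c * ?c)))))"
    by (simp only: norm_mult norm_minus_cancel norm_of_real) (rule mult_left_mono, auto)
  also have "\<dots> = (4 * ?c ^ 3) * \<bar>h\<bar>\<^sup>2"
    by (simp add: power2_eq_square power3_eq_cube mult_ac)
  finally show "cmod (res_form n ?B' z x y - res_form n ?B z x y -
      h *\<^sub>R (- (\<Sum>(k, l)\<in>entry_pairs i j. res_form n ?B z x (?e k) * res_form n ?B z (?e l) y)))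
      \<le> (4 * ?c ^ 3) * h\<^sup>2" by simp
qed

text \<open>
  The derivatives are existential witnesses and all orders share one bound, which makes closure under
  sums, products and conjugation a short induction.
\<close>

fun smooth_bound :: "nat \<Rightarrow> real \<Rightarrow> (real \<Rightarrow> complex) \<Rightarrow> bool" where
  "smooth_bound 0 C f \<longleftrightarrow> (\<forall>t. cmod (f t) \<le> C)"
| "smooth_bound (Suc k) C f \<longleftrightarrow> (\<forall>t. cmod (f t) \<le> C) \<and>
     (\<exists>f'. (\<forall>t. (f has_vector_derivative f' t) (at t)) \<and> smooth_bound k C f')"

lemma smooth_bound_mono:
  assumes "C \<le> C'"
  shows "smooth_bound k C f \<Longrightarrow> smooth_bound k C' f"
proof (induction k arbitrary: f)
  case 0
  then show ?case using order_trans[OF _ assms] by simp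
next
  case (Suc k)
  then obtain f' where "\<forall>t. (f has_vector_derivative f' t) (at t)" "smooth_bound k C f'"
    "\<forall>t. cmod (f t) \<le> C" by auto
  with Suc.IH[of f'] show ?case using order_trans[OF _ assms] unfolding smooth_bound.simps by blast
qed

lemma smooth_bound_norm: "smooth_bound k C f \<Longrightarrow> cmod (f t) \<le> C"
  by (cases k) auto

lemma smooth_bound_Suc_imp: "smooth_bound (Suc k) C f \<Longrightarrow> smooth_bound k C f"
proof (induction k arbitrary: f)
  case (Suc k)
  then obtain f' where "\<forall>t. (f has_vector_derivative f' t) (at t)" "smooth_bound (Suc k) C f'"
    "\<forall>t. cmod (f t) \<le> C" by auto
  with Suc.IH[of f'] show ?case by auto
qed auto

lemma smooth_bound_const: "cmod c \<le> C \<Longrightarrow> smooth_bound k C (\<lambda>_. c)"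
proof (induction k arbitrary: c)
  case (Suc k)
  have "smooth_bound k C (\<lambda>_. 0)"
    using order_trans[OF norm_ge_zero Suc.prems] by (intro Suc.IH) simp
  with Suc.prems show ?case by (auto intro!: exI[of _ "\<lambda>_. 0"])
qed auto

lemma smooth_bound_add:
  "smooth_bound k C f \<Longrightarrow> smooth_bound k D g \<Longrightarrow> smooth_bound k (C + D) (\<lambda>t. f t + g t)"
proof (induction k arbitrary: f g)
  case (Suc k)
  then obtain f' g' where "\<forall>t. (f has_vector_derivative f' t) (at t)" "smooth_bound k C f'"
    "\<forall>t. (g has_vector_derivative g' t) (at t)" "smooth_bound k D g'" by auto
  with Suc show ?case
    by (auto intro!: exI[of _ "\<lambda>t. f' t + g' t"] has_vector_derivative_add norm_triangle_mono)
qed (auto intro!: norm_triangle_mono)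

lemma smooth_bound_sum:
  "(\<And>i. i \<in> I \<Longrightarrow> smooth_bound k C (f i)) \<Longrightarrow> finite I \<Longrightarrow>
     smooth_bound k (real (card I) * C) (\<lambda>t. \<Sum>i\<in>I. f i t)"
proof (induction I rule: infinite_finite_induct)
  case (insert x F)
  have "smooth_bound k (C + real (card F) * C) (\<lambda>t. f x t + (\<Sum>i\<in>F. f i t))"
    using insert by (intro smooth_bound_add) auto
  then show ?case using insert by (simp add: algebra_simps)
qed (auto intro: smooth_bound_const)

lemma smooth_bound_mult:
  "smooth_bound k C f \<Longrightarrow> smooth_bound k D g \<Longrightarrow> smooth_bound k (2 ^ k * C * D) (\<lambda>t. f t * g t)"
proof (induction k arbitrary: f g)
  case 0
  then have "cmod (f t) * cmod (g t) \<le> C * D" for t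
    using order_trans[OF norm_ge_zero, of "f t" C] by (intro mult_mono) auto
  then show ?case by (simp add: norm_mult)
next
  case (Suc k)
  then obtain f' g' where *: "\<forall>t. (f has_vector_derivative f' t) (at t)" "smooth_bound k C f'"
    "\<forall>t. (g has_vector_derivative g' t) (at t)" "smooth_bound k D g'" by auto
  have n: "cmod (f t) \<le> C" "cmod (g t) \<le> D" for t using Suc.prems by auto
  then have pos: "0 \<le> C" "0 \<le> D" using order_trans[OF norm_ge_zero n(1)[of 0]] order_trans[OF norm_ge_zero n(2)[of 0]] by auto
  have "smooth_bound k (2 ^ k * C * D + 2 ^ k * C * D) (\<lambda>t. f t * g' t + f' t * g t)"
    using * Suc.IH Suc.prems[THEN smooth_bound_Suc_imp] by (intro smooth_bound_add)
  moreover have "cmod (f t * g t) \<le> 2 * 2 ^ k * C * D" for t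
  proof -
    have "cmod (f t * g t) \<le> C * D" using n pos by (auto simp: norm_mult intro!: mult_mono)
    also have "\<dots> \<le> (2 * 2 ^ k) * (C * D)"
      using pos one_le_power[of "2::real" "Suc k"] mult_right_mono[of 1 "2 * 2 ^ k" "C * D"] by simp
    finally show ?thesis by (simp add: mult_ac)
  qed
  moreover have "((\<lambda>t. f t * g t) has_vector_derivative f t * g' t + f' t * g t) (at t)" for t
    using * by (intro has_vector_derivative_mult) auto
  moreover have "2 ^ k * C * D + 2 ^ k * C * D = 2 * 2 ^ k * C * D" by simp
  ultimately show ?case
    unfolding smooth_bound.simps power_Suc by (intro conjI exI[of _ "\<lambda>t. f t * g' t + f' t * g t"]) simp_all
qed

lemma smooth_bound_cmult:
  "smooth_bound k C f \<Longrightarrow> smooth_bound k (cmod c * C) (\<lambda>t. c * f t)"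
proof (induction k arbitrary: f)
  case (Suc k)
  then obtain f' where "\<forall>t. (f has_vector_derivative f' t) (at t)" "smooth_bound k C f'" by auto
  with Suc show ?case
    by (auto intro!: exI[of _ "\<lambda>t. c * f' t"] has_vector_derivative_mult_right simp: norm_mult mult_left_mono)
qed (auto simp: norm_mult mult_left_mono)

lemma smooth_bound_cnj: "smooth_bound k C f \<Longrightarrow> smooth_bound k C (\<lambda>t. cnj (f t))"
proof (induction k arbitrary: f)
  case (Suc k)
  then obtain f' where "\<forall>t. (f has_vector_derivative f' t) (at t)" "smooth_bound k C f'" by auto
  with Suc show ?case
    by (auto intro!: exI[of _ "\<lambda>t. cnj (f' t)"] has_vector_derivative_cnj)
qed auto

text \<open>
  A bound for the first \<open>k\<close> derivatives of a resolvent form at vectors of the unit ball. The recursion is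
  Leibniz' rule: each derivative is a sum of at most two products of such forms. What matters is
  that it depends on \<open>z\<close> and \<open>k\<close> alone.
\<close>

fun form_const :: "complex \<Rightarrow> nat \<Rightarrow> real" where
  "form_const z 0 = 1 / Im z"
| "form_const z (Suc k) = form_const z k + 2 * (2 ^ k * form_const z k * form_const z k)"

lemma form_const_ge: "Im z > 0 \<Longrightarrow> 1 / Im z \<le> form_const z k"
proof (induction k)
  case (Suc k)
  have "0 \<le> 1 / Im z" using Suc.prems by simp
  then have "0 \<le> form_const z k" using order_trans[OF _ Suc.IH[OF Suc.prems]] by simp
  then have "form_const z k \<le> form_const z (Suc k)" by simp
  then show ?case using Suc by linarith
qed auto

lemma res_form_smooth:
  assumes "symm n B" "Im z > 0" "i < n" "j < n" "in_unit_ball n x" "in_unit_ball n y"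
  shows "smooth_bound k (form_const z k) (\<lambda>t. res_form n (shift_entry B i j t) z x y)"
  using assms(5,6)
proof (induction k arbitrary: x y)
  case 0
  then show ?case using res_form_bound[OF symm_shift_entry[OF assms(1)] assms(2)] by simp
next
  case (Suc k)
  let ?C = "form_const z k"
  let ?f = "\<lambda>x y t. res_form n (shift_entry B i j t) z x y"
  have C: "1 / Im z \<le> ?C" using assms form_const_ge by blast
  have "0 \<le> 1 / Im z" using assms(2) by simp
  with C have C0: "0 \<le> ?C" by linarith
  have "smooth_bound k (real (card (entry_pairs i j)) * (2 ^ k * ?C * ?C))
      (\<lambda>t. \<Sum>p\<in>entry_pairs i j. ?f x (unit_vec_fun (fst p)) t * ?f (unit_vec_fun (snd p)) y t)"
    using Suc by (intro smooth_bound_sum smooth_bound_mult) auto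
  then have sb: "smooth_bound k (cmod (-1) * (real (card (entry_pairs i j)) * (2 ^ k * ?C * ?C)))
      (\<lambda>t. -1 * (\<Sum>p\<in>entry_pairs i j. ?f x (unit_vec_fun (fst p)) t * ?f (unit_vec_fun (snd p)) y t))"
    by (rule smooth_bound_cmult)
  have "real (card (entry_pairs i j)) * (2 ^ k * ?C * ?C) \<le> 2 * (2 ^ k * ?C * ?C)"
    using card_entry_pairs[of i j] C0 by (intro mult_right_mono) auto
  with C0 have "cmod (-1) * (real (card (entry_pairs i j)) * (2 ^ k * ?C * ?C)) \<le> form_const z (Suc k)"
    unfolding form_const.simps norm_minus_cancel norm_one by linarith
  from smooth_bound_mono[OF this sb] have "smooth_bound k (form_const z (Suc k))
      (\<lambda>t. - (\<Sum>(k, l)\<in>entry_pairs i j. ?f x (unit_vec_fun k) t * ?f (unit_vec_fun l) y t))"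
    by (simp only: mult_minus1 case_prod_unfold)
  moreover have "cmod (?f x y t) \<le> form_const z (Suc k)" for t
  proof -
    have "cmod (?f x y t) \<le> 1 / Im z"
      using assms(1,2) Suc.prems by (intro res_form_bound symm_shift_entry)
    also have "\<dots> \<le> form_const z (Suc k)" using assms(2) by (rule form_const_ge)
    finally show ?thesis .
  qed
  ultimately show ?case
    unfolding smooth_bound.simps using res_form_has_derivative[OF assms(1-4) Suc.prems]
    by (intro conjI allI exI)
qed

section \<open>Observables of a symmetric matrix\<close>

text \<open>
  The test functions \<open>F\<close> of the symmetric matrix for which integration by parts in every entry has
  a negligible error. \<open>D B i j\<close> is the derivative of \<open>F\<close> when the entries \<open>(i, j)\<close> and \<open>(j, i)\<close> move
  together. Three bounded derivatives in each entry control the Taylor remainder; the bound on the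
  Frobenius norm of the gradient, uniform in the matrix, controls the sum of the \<open>n\<^sup>2\<close> gradient
  terms.
\<close>

definition observable ::
  "nat \<Rightarrow> real \<Rightarrow> ((nat \<Rightarrow> nat \<Rightarrow> real) \<Rightarrow> complex) \<Rightarrow>
   ((nat \<Rightarrow> nat \<Rightarrow> real) \<Rightarrow> nat \<Rightarrow> nat \<Rightarrow> complex) \<Rightarrow> bool" where
  "observable n C F D \<longleftrightarrow> (\<forall>B. symm n B \<longrightarrow>
     cmod (F B) \<le> C \<and> (\<Sum>i<n. \<Sum>j<n. (cmod (D B i j))\<^sup>2) \<le> C\<^sup>2 \<and>
     (\<forall>i<n. \<forall>j<n. smooth_bound 3 C (\<lambda>t. F (shift_entry B i j t)) \<and>
        (\<forall>t. ((\<lambda>t. F (shift_entry B i j t)) has_vector_derivative D (shift_entry B i j t) i j) (at t))))"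

lemma observableD:
  assumes "observable n C F D" "symm n B"
  shows "cmod (F B) \<le> C" "(\<Sum>i<n. \<Sum>j<n. (cmod (D B i j))\<^sup>2) \<le> C\<^sup>2"
    "\<And>i j. i < n \<Longrightarrow> j < n \<Longrightarrow> smooth_bound 3 C (\<lambda>t. F (shift_entry B i j t))"
    "\<And>i j t. i < n \<Longrightarrow> j < n \<Longrightarrow> ((\<lambda>t. F (shift_entry B i j t)) has_vector_derivative
        D (shift_entry B i j t) i j) (at t)"
  using assms unfolding observable_def by blast+

lemma observable_const: "cmod c \<le> C \<Longrightarrow> observable n C (\<lambda>_. c) (\<lambda>_ _ _. 0)"
  by (simp add: observable_def smooth_bound_const)

lemma observable_cnj:
  "observable n C F D \<Longrightarrow> observable n C (\<lambda>B. cnj (F B)) (\<lambda>B i j. cnj (D B i j))"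
  unfolding observable_def by (auto intro: smooth_bound_cnj has_vector_derivative_cnj)

lemma norm_add_squared_le: "(cmod (a + b))\<^sup>2 \<le> 2 * (cmod a)\<^sup>2 + 2 * (cmod b)\<^sup>2"
proof -
  have "(cmod (a + b))\<^sup>2 \<le> (cmod a + cmod b)\<^sup>2"
    by (intro power_mono norm_triangle_ineq norm_ge_zero)
  also have "\<dots> \<le> 2 * (cmod a)\<^sup>2 + 2 * (cmod b)\<^sup>2"
    using sum_squares_bound[of "cmod a" "cmod b"] by (simp add: power2_eq_square algebra_simps)
  finally show ?thesis .
qed

lemma observable_add:
  assumes F: "observable n C F D" and G: "observable n C' G E"
  shows "observable n (2 * (C + C')) (\<lambda>B. F B + G B) (\<lambda>B i j. D B i j + E B i j)"
  unfolding observable_def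
proof (intro allI impI conjI)
  fix B assume B: "symm n B"
  note F = observableD[OF F B] and G = observableD[OF G B]
  have pos: "0 \<le> C" "0 \<le> C'"
    using order_trans[OF norm_ge_zero F(1)] order_trans[OF norm_ge_zero G(1)] by auto
  have "cmod (F B + G B) \<le> C + C'"
    using F(1) G(1) by (rule norm_triangle_mono)
  also have "\<dots> \<le> 2 * (C + C')" using pos by simp
  finally show "cmod (F B + G B) \<le> 2 * (C + C')" .
  have "(\<Sum>i<n. \<Sum>j<n. (cmod (D B i j + E B i j))\<^sup>2) \<le>
     (\<Sum>i<n. \<Sum>j<n. 2 * (cmod (D B i j))\<^sup>2 + 2 * (cmod (E B i j))\<^sup>2)"
    by (intro sum_mono norm_add_squared_le)
  also have "\<dots> = 2 * (\<Sum>i<n. \<Sum>j<n. (cmod (D B i j))\<^sup>2) + 2 * (\<Sum>i<n. \<Sum>j<n. (cmod (E B i j))\<^sup>2)"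
    by (simp add: sum.distrib sum_distrib_left)
  also have "\<dots> \<le> 2 * C\<^sup>2 + 2 * C'\<^sup>2" using F(2) G(2) by (intro add_mono mult_left_mono) auto
  also have "\<dots> \<le> (2 * (C + C'))\<^sup>2"
    using pos by (simp add: power2_eq_square algebra_simps)
  finally show "(\<Sum>i<n. \<Sum>j<n. (cmod (D B i j + E B i j))\<^sup>2) \<le> (2 * (C + C'))\<^sup>2" .
  fix i j assume ij: "i < n" "j < n"
  have "smooth_bound 3 (C + C') (\<lambda>t. F (shift_entry B i j t) + G (shift_entry B i j t))"
    using F(3) G(3) ij by (intro smooth_bound_add)
  then show "smooth_bound 3 (2 * (C + C')) (\<lambda>t. F (shift_entry B i j t) + G (shift_entry B i j t))"
    using pos by (intro smooth_bound_mono[of "C + C'" "2 * (C + C')"]) auto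
  fix t
  show "((\<lambda>t. F (shift_entry B i j t) + G (shift_entry B i j t)) has_vector_derivative
     D (shift_entry B i j t) i j + E (shift_entry B i j t) i j) (at t)"
    using F(4) G(4) ij by (intro has_vector_derivative_add)
qed

lemma observable_mult:
  assumes F: "observable n C F D" and G: "observable n C' G E"
  shows "observable n (8 * C * C') (\<lambda>B. F B * G B) (\<lambda>B i j. F B * E B i j + D B i j * G B)"
  unfolding observable_def
proof (intro allI impI conjI)
  fix B assume B: "symm n B"
  note F = observableD[OF F B] and G = observableD[OF G B]
  have pos: "0 \<le> C" "0 \<le> C'"
    using order_trans[OF norm_ge_zero F(1)] order_trans[OF norm_ge_zero G(1)] by auto
  have "cmod (F B * G B) \<le> C * C'" using F(1) G(1) pos by (simp add: norm_mult mult_mono)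
  also have "\<dots> \<le> 8 * C * C'" using pos by simp
  finally show "cmod (F B * G B) \<le> 8 * C * C'" .
  have "(\<Sum>i<n. \<Sum>j<n. (cmod (F B * E B i j + D B i j * G B))\<^sup>2) \<le>
     (\<Sum>i<n. \<Sum>j<n. 2 * (C\<^sup>2 * (cmod (E B i j))\<^sup>2) + 2 * (C'\<^sup>2 * (cmod (D B i j))\<^sup>2))"
  proof (intro sum_mono)
    fix i j
    have "(cmod (F B * E B i j + D B i j * G B))\<^sup>2 \<le>
       2 * ((cmod (F B))\<^sup>2 * (cmod (E B i j))\<^sup>2) + 2 * ((cmod (G B))\<^sup>2 * (cmod (D B i j))\<^sup>2)"
      using norm_add_squared_le[of "F B * E B i j" "D B i j * G B"]
      by (simp add: norm_mult power_mult_distrib mult_ac)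
    also have "\<dots> \<le> 2 * (C\<^sup>2 * (cmod (E B i j))\<^sup>2) + 2 * (C'\<^sup>2 * (cmod (D B i j))\<^sup>2)"
      using F(1) G(1) by (intro add_mono mult_left_mono mult_right_mono power_mono) auto
    finally show "(cmod (F B * E B i j + D B i j * G B))\<^sup>2 \<le>
      2 * (C\<^sup>2 * (cmod (E B i j))\<^sup>2) + 2 * (C'\<^sup>2 * (cmod (D B i j))\<^sup>2)" .
  qed
  also have "\<dots> = 2 * (C\<^sup>2 * (\<Sum>i<n. \<Sum>j<n. (cmod (E B i j))\<^sup>2)) + 2 * (C'\<^sup>2 * (\<Sum>i<n. \<Sum>j<n. (cmod (D B i j))\<^sup>2))"
    by (simp add: sum.distrib sum_distrib_left)
  also have "\<dots> \<le> 2 * (C\<^sup>2 * C'\<^sup>2) + 2 * (C'\<^sup>2 * C\<^sup>2)"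
    using F(2) G(2) by (intro add_mono mult_left_mono) auto
  also have "\<dots> \<le> (8 * C * C')\<^sup>2"
    using pos by (simp add: power_mult_distrib)
  finally show "(\<Sum>i<n. \<Sum>j<n. (cmod (F B * E B i j + D B i j * G B))\<^sup>2) \<le> (8 * C * C')\<^sup>2" .
  fix i j assume ij: "i < n" "j < n"
  have "smooth_bound 3 (2 ^ 3 * C * C') (\<lambda>t. F (shift_entry B i j t) * G (shift_entry B i j t))"
    using F(3) G(3) ij by (intro smooth_bound_mult)
  then show "smooth_bound 3 (8 * C * C') (\<lambda>t. F (shift_entry B i j t) * G (shift_entry B i j t))"
    by simp
  fix t
  show "((\<lambda>t. F (shift_entry B i j t) * G (shift_entry B i j t)) has_vector_derivative
     F (shift_entry B i j t) * E (shift_entry B i j t) i j + D (shift_entry B i j t) i j * G (shift_entry B i j t)) (at t)"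
    using F(4) G(4) ij by (intro has_vector_derivative_mult)
qed

definition res_trace :: "nat \<Rightarrow> (nat \<Rightarrow> nat \<Rightarrow> real) \<Rightarrow> complex \<Rightarrow> complex" where
  "res_trace n B z = (\<Sum>p<n. res_form n B z (unit_vec_fun p) (unit_vec_fun p)) / of_nat n"

definition form_deriv :: "nat \<Rightarrow> (nat \<Rightarrow> nat \<Rightarrow> real) \<Rightarrow> complex \<Rightarrow> (nat \<Rightarrow> real) \<Rightarrow> (nat \<Rightarrow> real) \<Rightarrow>
    nat \<Rightarrow> nat \<Rightarrow> complex" where
  "form_deriv n B z x y i j = - (\<Sum>(k, l)\<in>entry_pairs i j.
     res_form n B z x (unit_vec_fun k) * res_form n B z (unit_vec_fun l) y)"

lemma sum_entry_pairs_le: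
  fixes f :: "nat \<Rightarrow> nat \<Rightarrow> real"
  assumes "\<And>k l. 0 \<le> f k l"
  shows "(\<Sum>(k, l)\<in>entry_pairs i j. f k l) \<le> f i j + f j i"
  using assms[of i j] assms[of j i] by (cases "i = j") (auto simp: entry_pairs_def)

lemma form_deriv_norm:
  "cmod (form_deriv n B z x y i j) \<le>
     cmod (res_form n B z x (unit_vec_fun i)) * cmod (res_form n B z (unit_vec_fun j) y) +
     cmod (res_form n B z x (unit_vec_fun j)) * cmod (res_form n B z (unit_vec_fun i) y)"
proof -
  have "cmod (form_deriv n B z x y i j) \<le> (\<Sum>(k, l)\<in>entry_pairs i j.
     cmod (res_form n B z x (unit_vec_fun k)) * cmod (res_form n B z (unit_vec_fun l) y))"
    unfolding form_deriv_def norm_minus_cancel by (rule sum_norm_le) (auto simp: norm_mult)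
  also have "\<dots> \<le> cmod (res_form n B z x (unit_vec_fun i)) * cmod (res_form n B z (unit_vec_fun j) y) +
     cmod (res_form n B z x (unit_vec_fun j)) * cmod (res_form n B z (unit_vec_fun i) y)"
    by (rule sum_entry_pairs_le) simp
  finally show ?thesis .
qed

definition obs_const :: "complex \<Rightarrow> real" where
  "obs_const z = form_const z 3 + 2 / (Im z)\<^sup>2"

text \<open>
  The gradient is built from products \<open>g i * g j\<close> of components of \<open>(B - z)\<^sup>-\<^sup>1 u\<close>, whose squares have
  bounded sum.
\<close>

lemma observable_form:
  assumes z: "Im z > 0" and u: "in_unit_ball n u"
  shows "observable n (obs_const z) (\<lambda>B. res_form n B z u u) (\<lambda>B. form_deriv n B z u u)"
  unfolding observable_def
proof (intro allI impI conjI)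
  fix B assume B: "symm n B"
  have c3: "1 / Im z \<le> form_const z 3" using form_const_ge[OF z] .
  have pos: "0 \<le> 1 / Im z" "0 \<le> 2 / (Im z)\<^sup>2" using z by auto
  have c: "form_const z 3 \<le> obs_const z" "2 / (Im z)\<^sup>2 \<le> obs_const z"
    using c3 pos unfolding obs_const_def by linarith+
  show "cmod (res_form n B z u u) \<le> obs_const z"
    using res_form_bound[OF B z u u] c3 c by linarith
  let ?g = "\<lambda>i. cmod (res_form n B z (unit_vec_fun i) u)"
  have s: "res_form n B z u (unit_vec_fun i) = res_form n B z (unit_vec_fun i) u" for i
    using res_form_symmetric[OF B z] .
  have "(\<Sum>i<n. \<Sum>j<n. (cmod (form_deriv n B z u u i j))\<^sup>2) \<le> (\<Sum>i<n. \<Sum>j<n. 4 * ((?g i)\<^sup>2 * (?g j)\<^sup>2))"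
  proof (intro sum_mono)
    fix i j
    have "cmod (form_deriv n B z u u i j) \<le> 2 * (?g i * ?g j)"
      using form_deriv_norm[of n B z u u i j] by (simp add: s mult.commute)
    then have "(cmod (form_deriv n B z u u i j))\<^sup>2 \<le> (2 * (?g i * ?g j))\<^sup>2" by (intro power_mono) auto
    then show "(cmod (form_deriv n B z u u i j))\<^sup>2 \<le> 4 * ((?g i)\<^sup>2 * (?g j)\<^sup>2)"
      by (simp add: power_mult_distrib)
  qed
  also have "\<dots> = 4 * ((\<Sum>i<n. (?g i)\<^sup>2) * (\<Sum>j<n. (?g j)\<^sup>2))"
    unfolding sum_product by (simp add: sum_distrib_left)
  also have "\<dots> \<le> 4 * ((1 / (Im z)\<^sup>2) * (1 / (Im z)\<^sup>2))"
    using res_form_l2[OF B z u] by (intro mult_left_mono mult_mono) (auto intro: sum_nonneg)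
  also have "\<dots> = (2 / (Im z)\<^sup>2)\<^sup>2" by (simp add: power2_eq_square)
  also have "\<dots> \<le> (obs_const z)\<^sup>2" using c pos by (intro power_mono)
  finally show "(\<Sum>i<n. \<Sum>j<n. (cmod (form_deriv n B z u u i j))\<^sup>2) \<le> (obs_const z)\<^sup>2" .
  fix i j assume ij: "i < n" "j < n"
  show "smooth_bound 3 (obs_const z) (\<lambda>t. res_form n (shift_entry B i j t) z u u)"
    using smooth_bound_mono[OF c(1) res_form_smooth[OF B z ij u u]] .
  fix t
  show "((\<lambda>t. res_form n (shift_entry B i j t) z u u) has_vector_derivative
        form_deriv n (shift_entry B i j t) z u u i j) (at t)"
    using res_form_has_derivative[OF B z ij u u] unfolding form_deriv_def .
qed

text \<open>
  A single entry moves the normalized trace by \<open>O(1/n)\<close>, so the gradient, with its \<open>n\<^sup>2\<close> entries,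
  has bounded Frobenius norm.
\<close>

lemma observable_trace:
  assumes z: "Im z > 0" and n: "n > 0"
  shows "observable n (obs_const z) (\<lambda>B. res_trace n B z)
    (\<lambda>B i j. (\<Sum>p<n. form_deriv n B z (unit_vec_fun p) (unit_vec_fun p) i j) / of_nat n)"
  unfolding observable_def
proof (intro allI impI conjI)
  fix B assume B: "symm n B"
  have c3: "1 / Im z \<le> form_const z 3" using form_const_ge[OF z] .
  have pos: "0 \<le> 1 / Im z" "0 \<le> 2 / (Im z)\<^sup>2" using z by auto
  have c: "form_const z 3 \<le> obs_const z" "2 / (Im z)\<^sup>2 \<le> obs_const z"
    using c3 pos unfolding obs_const_def by linarith+
  let ?e = unit_vec_fun
  have "cmod (\<Sum>p<n. res_form n B z (?e p) (?e p)) \<le> real (card {..<n}) * (1 / Im z)"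
    by (rule sum_norm_bound) (intro res_form_bound B z, auto)
  then have "cmod (res_trace n B z) \<le> 1 / Im z"
    using n by (simp add: res_trace_def norm_divide field_simps)
  then show "cmod (res_trace n B z) \<le> obs_const z" using c3 c by linarith
  have d: "cmod ((\<Sum>p<n. form_deriv n B z (?e p) (?e p) i j) / of_nat n) \<le> (2 / (Im z)\<^sup>2) / n" for i j
  proof -
    let ?g = "\<lambda>i p. cmod (res_form n B z (?e p) (?e i))"
    have s: "res_form n B z (?e i) (?e p) = res_form n B z (?e p) (?e i)" for i p
      using res_form_symmetric[OF B z] .
    have "cmod (\<Sum>p<n. form_deriv n B z (?e p) (?e p) i j) \<le> (\<Sum>p<n. 2 * (\<bar>?g i p\<bar> * \<bar>?g j p\<bar>))"
    proof (rule sum_norm_le)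
      fix p
      show "cmod (form_deriv n B z (?e p) (?e p) i j) \<le> 2 * (\<bar>?g i p\<bar> * \<bar>?g j p\<bar>)"
        using form_deriv_norm[of n B z "?e p" "?e p" i j] by (simp add: s mult.commute)
    qed
    also have "\<dots> = 2 * (\<Sum>p<n. \<bar>?g i p\<bar> * \<bar>?g j p\<bar>)" by (simp add: sum_distrib_left)
    also have "\<dots> \<le> 2 * ((1 / Im z) * (1 / Im z))"
      using res_form_l2[OF B z in_unit_ball_unit_vec_fun] pos
      by (intro mult_left_mono sum_mult_le_l2) (auto simp: power_divide)
    finally show ?thesis using n
      using divide_right_mono[of _ "2 * (1 / Im z * (1 / Im z))" "real n"]
      by (simp add: norm_divide power2_eq_square)
  qed
  have "(\<Sum>i<n. \<Sum>j<n. (cmod ((\<Sum>p<n. form_deriv n B z (?e p) (?e p) i j) / of_nat n))\<^sup>2) \<le>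
      (\<Sum>i<n. \<Sum>j<n. ((2 / (Im z)\<^sup>2) / n)\<^sup>2)"
    by (intro sum_mono power_mono d) auto
  also have "\<dots> = (2 / (Im z)\<^sup>2)\<^sup>2" using n by (simp add: power2_eq_square)
  also have "\<dots> \<le> (obs_const z)\<^sup>2" using c pos by (intro power_mono)
  finally show "(\<Sum>i<n. \<Sum>j<n. (cmod ((\<Sum>p<n. form_deriv n B z (?e p) (?e p) i j) / of_nat n))\<^sup>2) \<le> (obs_const z)\<^sup>2" .
  fix i j assume ij: "i < n" "j < n"
  have "smooth_bound 3 (real (card {..<n}) * form_const z 3)
     (\<lambda>t. \<Sum>p<n. res_form n (shift_entry B i j t) z (?e p) (?e p))"
    by (intro smooth_bound_sum res_form_smooth B z ij) auto
  then have "smooth_bound 3 (cmod (1 / of_nat n) * (real (card {..<n}) * form_const z 3))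
     (\<lambda>t. (1 / of_nat n) * (\<Sum>p<n. res_form n (shift_entry B i j t) z (?e p) (?e p)))"
    by (rule smooth_bound_cmult)
  then have "smooth_bound 3 (form_const z 3) (\<lambda>t. res_trace n (shift_entry B i j t) z)"
    using n by (simp add: res_trace_def norm_divide)
  then show "smooth_bound 3 (obs_const z) (\<lambda>t. res_trace n (shift_entry B i j t) z)"
    by (rule smooth_bound_mono[OF c(1)])
  fix t
  show "((\<lambda>t. res_trace n (shift_entry B i j t) z) has_vector_derivative
      (\<Sum>p<n. form_deriv n (shift_entry B i j t) z (?e p) (?e p) i j) / of_nat n) (at t)"
    unfolding res_trace_def form_deriv_def
    by (intro has_vector_derivative_divide has_vector_derivative_sum res_form_has_derivative B z ij) auto
qed

text \<open>
  One constant for all sizes and all vectors of the unit ball. Polynomials in the normalized trace of the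
  resolvent, the form at the spike and their conjugates have this property.
\<close>

definition uniform_observable ::
  "(nat \<Rightarrow> (nat \<Rightarrow> real) \<Rightarrow> (nat \<Rightarrow> nat \<Rightarrow> real) \<Rightarrow> complex) \<Rightarrow> bool" where
  "uniform_observable F \<longleftrightarrow>
     (\<exists>C. \<forall>n>0. \<forall>u. in_unit_ball n u \<longrightarrow> (\<exists>D. observable n C (F n u) D))"

lemma uniform_observable_const: "uniform_observable (\<lambda>n u B. c)"
  unfolding uniform_observable_def using observable_const[OF order_refl] by blast

lemma uniform_observable_trace:
  "Im z > 0 \<Longrightarrow> uniform_observable (\<lambda>n u B. res_trace n B z)"
  unfolding uniform_observable_def using observable_trace by blast

lemma uniform_observable_form:
  "Im z > 0 \<Longrightarrow> uniform_observable (\<lambda>n u B. res_form n B z u u)"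
  unfolding uniform_observable_def using observable_form by blast

lemma uniform_observable_cnj:
  "uniform_observable F \<Longrightarrow> uniform_observable (\<lambda>n u B. cnj (F n u B))"
  unfolding uniform_observable_def using observable_cnj by meson

lemma uniform_observable_add:
  "uniform_observable F \<Longrightarrow> uniform_observable G \<Longrightarrow> uniform_observable (\<lambda>n u B. F n u B + G n u B)"
  unfolding uniform_observable_def using observable_add by meson

lemma uniform_observable_mult:
  "uniform_observable F \<Longrightarrow> uniform_observable G \<Longrightarrow> uniform_observable (\<lambda>n u B. F n u B * G n u B)"
  unfolding uniform_observable_def using observable_mult by meson

section \<open>Integration by parts in one random entry\<close>

lemma vector_derivative_bound_pow:
  fixes h :: "real \<Rightarrow> complex"
  assumes h: "\<And>t. (h has_vector_derivative h' t) (at t)" "h 0 = 0"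
    and b: "\<And>t. norm (h' t) \<le> K * \<bar>t\<bar> ^ k"
  shows "norm (h t) \<le> K * \<bar>t\<bar> ^ Suc k"
proof -
  have K: "0 \<le> K" using order_trans[OF norm_ge_zero b[of 1]] by simp
  have "norm (h t - h 0) \<le> (K * \<bar>t\<bar> ^ k) * norm (t - 0)"
  proof (rule differentiable_bound[where S = "closed_segment 0 t" and f' = "\<lambda>s x. x *\<^sub>R h' s"])
    fix s assume s: "s \<in> closed_segment 0 t"
    show "(h has_derivative (\<lambda>x. x *\<^sub>R h' s)) (at s within closed_segment 0 t)"
      using h(1)[of s] unfolding has_vector_derivative_def by (rule has_derivative_at_withinI)
    have "\<bar>s\<bar> \<le> \<bar>t\<bar>" using s by (auto simp: closed_segment_eq_real_ivl split: if_splits)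
    then have "norm (h' s) \<le> K * \<bar>t\<bar> ^ k"
      using b[of s] K by (meson mult_left_mono order_trans power_mono abs_ge_zero)
    then show "onorm (\<lambda>x. x *\<^sub>R h' s) \<le> K * \<bar>t\<bar> ^ k"
      by (intro onorm_le) (simp add: mult.commute mult_left_mono)
  qed auto
  then show ?thesis using h(2) by (simp add: mult_ac)
qed

text \<open>
  Derivatives enter as arbitrary witnesses, chosen separately for each sample point; being
  limits of difference quotients they are measurable all the same.
\<close>

lemma measurable_vector_derivative:
  fixes f :: "'a \<Rightarrow> real \<Rightarrow> complex"
  assumes "\<And>x. x \<in> space N \<Longrightarrow> (f x has_vector_derivative D x) (at (t x))"
    and "\<And>h. (\<lambda>x. f x (t x + h)) \<in> borel_measurable N"
  shows "D \<in> borel_measurable N"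
proof (rule borel_measurable_LIMSEQ_metric)
  let ?h = "\<lambda>m. inverse (real (Suc m))"
  show "(\<lambda>x. (f x (t x + ?h m) - f x (t x + 0)) /\<^sub>R ?h m) \<in> borel_measurable N" for m
    by (intro borel_measurable_scaleR borel_measurable_diff assms(2)) simp
  fix x assume x: "x \<in> space N"
  have "((\<lambda>y. (f x (t x + y) - f x (t x)) /\<^sub>R y) \<longlongrightarrow> D x) (at 0)"
  proof -
    have "((\<lambda>y. norm (f x (t x + y) - f x (t x) - y *\<^sub>R D x) / norm y) \<longlongrightarrow> 0) (at 0)"
      using assms(1)[OF x] unfolding has_vector_derivative_def has_derivative_at by blast
    moreover have "norm (f x (t x + y) - f x (t x) - y *\<^sub>R D x) / norm y =
       norm ((f x (t x + y) - f x (t x)) /\<^sub>R y - D x)" if "y \<noteq> 0" for y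
    proof -
      have "(f x (t x + y) - f x (t x)) /\<^sub>R y - D x = (f x (t x + y) - f x (t x) - y *\<^sub>R D x) /\<^sub>R y"
        using that by (simp add: scaleR_diff_right)
      then show ?thesis using that by (simp add: divide_inverse_commute abs_inverse)
    qed
    then have "\<forall>\<^sub>F y in at 0. norm (f x (t x + y) - f x (t x) - y *\<^sub>R D x) / norm y =
       norm ((f x (t x + y) - f x (t x)) /\<^sub>R y - D x)" by (simp add: eventually_at_filter)
    ultimately have "((\<lambda>y. norm ((f x (t x + y) - f x (t x)) /\<^sub>R y - D x)) \<longlongrightarrow> 0) (at 0)"
      by (rule Lim_transform_eventually)
    then show ?thesis by (simp add: tendsto_norm_zero_iff LIM_zero_iff)
  qed
  moreover have "filterlim ?h (at 0) sequentially"
    unfolding filterlim_at using LIMSEQ_inverse_real_of_nat by (auto simp: eventually_sequentially)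
  ultimately show "(\<lambda>m. (f x (t x + ?h m) - f x (t x + 0)) /\<^sub>R ?h m) \<longlonglongrightarrow> D x"
    using filterlim_compose by fastforce
qed

lemma (in prob_space) integrable_bounded:
  fixes f :: "'a \<Rightarrow> complex"
  assumes "f \<in> borel_measurable M" "\<And>x. x \<in> space M \<Longrightarrow> cmod (f x) \<le> C"
  shows "integrable M f"
  by (rule integrable_const_bound[where B = C]) (use assms in auto)

lemma norm_integral_le:
  fixes f :: "'a \<Rightarrow> complex"
  assumes "integrable M f" "integrable M g" "\<And>x. x \<in> space M \<Longrightarrow> cmod (f x) \<le> g x"
  shows "cmod (LINT x|M. f x) \<le> (LINT x|M. g x)"
  by (rule order_trans[OF Bochner_Integration.integral_norm_bound])
     (use assms in \<open>auto intro!: integral_mono integrable_norm\<close>)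

lemma integral_linear_combination:
  fixes A B D R :: "'a \<Rightarrow> complex"
  assumes "integrable M A" "integrable M B" "integrable M D" "integrable M R"
  shows "(LINT x|M. A x + c * B x + d * D x + R x) =
    (LINT x|M. A x) + c * (LINT x|M. B x) + d * (LINT x|M. D x) + (LINT x|M. R x)"
  using assms by simp

text \<open>
  \<open>w\<close> is independent of the sub-sigma-algebra \<open>N\<close>. The complex-valued functions are singled out
  because they are the ones multiplied with powers of \<open>w\<close> under the expectation.
\<close>

definition indep_of :: "'a measure \<Rightarrow> ('a \<Rightarrow> real) \<Rightarrow> 'a measure \<Rightarrow> bool" where
  "indep_of M w N \<longleftrightarrow> space N = space M \<and> sets N \<subseteq> sets M \<and>
     (\<forall>F :: 'a \<Rightarrow> complex. F \<in> borel_measurable N \<longrightarrow> prob_space.indep_var M borel (\<lambda>x. complex_of_real (w x)) borel F)"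

lemma (in prob_space) expectation_indep_power:
  fixes F :: "'a \<Rightarrow> complex"
  assumes "indep_of M w N" "F \<in> borel_measurable N" "integrable M F" "integrable M (\<lambda>x. w x ^ k)"
  shows "(LINT x|M. of_real (w x ^ k) * F x) = of_real (LINT x|M. w x ^ k) * (LINT x|M. F x)"
    "integrable M (\<lambda>x. of_real (w x ^ k) * F x)"
proof -
  have "indep_var borel (\<lambda>x. complex_of_real (w x)) borel F" using assms by (auto simp: indep_of_def)
  then have "indep_var borel ((\<lambda>c. c ^ k) \<circ> (\<lambda>x. complex_of_real (w x))) borel (id \<circ> F)"
    by (rule indep_var_compose) auto
  then have i: "indep_var borel (\<lambda>x. complex_of_real (w x ^ k)) borel F"
    by (simp add: o_def id_def)
  show "(LINT x|M. of_real (w x ^ k) * F x) = of_real (LINT x|M. w x ^ k) * (LINT x|M. F x)"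
    using indep_var_lebesgue_integral[OF i] assms(3,4) by (simp del: of_real_power)
  show "integrable M (\<lambda>x. of_real (w x ^ k) * F x)"
    using indep_var_integrable[OF i] assms(3,4) by (simp del: of_real_power)
qed

lemma smooth_bound_3_taylor:
  assumes "smooth_bound 3 C f"
  obtains f1 f2 where "\<And>t. (f has_vector_derivative f1 t) (at t)"
    "\<And>t. (f1 has_vector_derivative f2 t) (at t)"
    "\<And>t. cmod (f1 t) \<le> C" "\<And>t. cmod (f2 t) \<le> C"
    "\<And>t. cmod (f1 t - f1 0 - t *\<^sub>R f2 0) \<le> C * \<bar>t\<bar> ^ 2"
    "\<And>t. cmod (f t - f 0 - t *\<^sub>R f1 0 - (t\<^sup>2 / 2) *\<^sub>R f2 0) \<le> C * \<bar>t\<bar> ^ 3"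
proof -
  obtain f1 f2 f3 where f: "\<And>t. (f has_vector_derivative f1 t) (at t)"
    "\<And>t. (f1 has_vector_derivative f2 t) (at t)" "\<And>t. (f2 has_vector_derivative f3 t) (at t)"
    and b: "\<And>t. cmod (f1 t) \<le> C" "\<And>t. cmod (f2 t) \<le> C" "\<And>t. cmod (f3 t) \<le> C"
    using assms by (auto simp: numeral_3_eq_3)
  have d: "((\<lambda>t. g t *\<^sub>R c) has_vector_derivative g' *\<^sub>R c) (at t)"
    if "(g has_real_derivative g') (at t)" for g g' t and c :: complex
    using has_vector_derivative_scaleR[OF that has_vector_derivative_const[of c]] by simp
  have d1: "((\<lambda>t. t *\<^sub>R c) has_vector_derivative c) (at t)"
    and d2: "((\<lambda>t. (t\<^sup>2 / 2) *\<^sub>R c) has_vector_derivative t *\<^sub>R c) (at t)" for t and c :: complex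
    using d[of "\<lambda>t. t" 1 t c] d[of "\<lambda>t. t\<^sup>2 / 2" t t c] by (auto intro!: derivative_eq_intros)
  note diff = has_vector_derivative_diff and const = has_vector_derivative_const
  \<comment> \<open>Three integrations of the bound on the third derivative.\<close>
  have b2: "cmod (f2 t - f2 0) \<le> C * \<bar>t\<bar> ^ 1" for t
    using vector_derivative_bound_pow[of "\<lambda>t. f2 t - f2 0" f3 C 0 t] b(3) diff[OF f(3) const] by simp
  have b1: "cmod (f1 t - f1 0 - t *\<^sub>R f2 0) \<le> C * \<bar>t\<bar> ^ 2" for t
    using vector_derivative_bound_pow[of "\<lambda>t. f1 t - f1 0 - t *\<^sub>R f2 0" "\<lambda>t. f2 t - f2 0" C 1 t]
      b2 diff[OF diff[OF f(2) const] d1, of "f1 0"] by (simp add: numeral_2_eq_2)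
  have b0: "cmod (f t - f 0 - t *\<^sub>R f1 0 - (t\<^sup>2 / 2) *\<^sub>R f2 0) \<le> C * \<bar>t\<bar> ^ 3" for t
    using vector_derivative_bound_pow[of "\<lambda>t. f t - f 0 - t *\<^sub>R f1 0 - (t\<^sup>2 / 2) *\<^sub>R f2 0"
      "\<lambda>t. f1 t - f1 0 - t *\<^sub>R f2 0" C 2 t]
      b1 diff[OF diff[OF diff[OF f(1) const] d1] d2, of "f 0"] by (simp add: numeral_3_eq_3)
  show thesis using that[OF f(1,2) b(1,2) b1 b0] .
qed

text \<open>
  Approximate Gaussian integration by parts, \<open>E[w f(a w)] = a E[w\<^sup>2] E[f'(a w)] + error\<close>, for a
  variable \<open>w\<close> whose first and third moments vanish and a random function \<open>f\<close> independent of \<open>w\<close>.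
  Both sides are expanded at 0; by the vanishing moments the errors are of order \<open>a\<^sup>3\<close>.
  The random weight \<open>Y\<close> in the bound on \<open>f\<close> is kept in the result: it will be \<open>\<bar>x i\<bar>\<close> for a unit
  vector \<open>x\<close>, and summing it over \<open>i\<close> gains a factor \<open>sqrt n\<close> over the trivial bound.
\<close>

lemma (in prob_space) expectation_by_parts:
  fixes f :: "'a \<Rightarrow> real \<Rightarrow> complex" and w Y :: "'a \<Rightarrow> real"
  assumes ind: "indep_of M w N"
    and w: "\<And>k. integrable M (\<lambda>x. w x ^ k)" "expectation w = 0" "expectation (\<lambda>x. w x ^ 3) = 0"
      "expectation (\<lambda>x. w x ^ 4) \<le> K" "(expectation (\<lambda>x. (w x)\<^sup>2))\<^sup>2 \<le> K"
    and a: "0 \<le> a" and C: "0 \<le> C"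
    and Y: "Y \<in> borel_measurable N" "\<And>x. 0 \<le> Y x" "\<And>x. x \<in> space M \<Longrightarrow> Y x \<le> 1"
    and f: "\<And>t. (\<lambda>x. f x t) \<in> borel_measurable N" "\<And>x. x \<in> space M \<Longrightarrow> smooth_bound 3 (C * Y x) (f x)"
    and F: "(\<lambda>x. f x (a * w x)) \<in> borel_measurable M" and G: "G \<in> borel_measurable M"
    and deriv: "\<And>x. x \<in> space M \<Longrightarrow> (f x has_vector_derivative G x) (at (a * w x))"
  shows "cmod ((LINT x|M. of_real (w x) * f x (a * w x)) -
      of_real (a * expectation (\<lambda>x. (w x)\<^sup>2)) * (LINT x|M. G x)) \<le> 2 * a ^ 3 * C * K * expectation Y"
proof -
  have sub: "g \<in> borel_measurable M" if "g \<in> borel_measurable N" for g :: "'a \<Rightarrow> 'b::topological_space"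
    using that ind measurable_mono[of borel borel N M] by (auto simp: indep_of_def)
  have spN: "space N = space M" using ind by (simp add: indep_of_def)
  have wm: "w \<in> borel_measurable M" using w(1)[of 1] by (simp add: borel_measurable_integrable)
  have Ym: "Y \<in> borel_measurable M" using sub Y by blast
  have "\<forall>x\<in>space M. \<exists>f1 f2. (\<forall>t. (f x has_vector_derivative f1 t) (at t)) \<and>
    (\<forall>t. (f1 has_vector_derivative f2 t) (at t)) \<and>
    (\<forall>t. cmod (f1 t) \<le> C * Y x) \<and> (\<forall>t. cmod (f2 t) \<le> C * Y x) \<and>
    (\<forall>t. cmod (f1 t - f1 0 - t *\<^sub>R f2 0) \<le> C * Y x * \<bar>t\<bar> ^ 2) \<and>
    (\<forall>t. cmod (f x t - f x 0 - t *\<^sub>R f1 0 - (t\<^sup>2 / 2) *\<^sub>R f2 0) \<le> C * Y x * \<bar>t\<bar> ^ 3)"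
    (is "\<forall>x\<in>space M. \<exists>f1 f2. ?P x f1 f2")
    using smooth_bound_3_taylor[OF f(2)] by (metis (no_types, lifting))
  from bchoice[OF this] obtain f1 where "\<forall>x\<in>space M. \<exists>f2. ?P x (f1 x) f2" by (elim exE)
  from bchoice[OF this] obtain f2 where "\<forall>x\<in>space M. ?P x (f1 x) (f2 x)" by (elim exE)
  then have T: "\<And>x t. x \<in> space M \<Longrightarrow> (f x has_vector_derivative f1 x t) (at t)"
    "\<And>x t. x \<in> space M \<Longrightarrow> (f1 x has_vector_derivative f2 x t) (at t)"
    "\<And>x t. x \<in> space M \<Longrightarrow> cmod (f1 x t) \<le> C * Y x"
    "\<And>x t. x \<in> space M \<Longrightarrow> cmod (f2 x t) \<le> C * Y x"
    "\<And>x t. x \<in> space M \<Longrightarrow> cmod (f1 x t - f1 x 0 - t *\<^sub>R f2 x 0) \<le> C * Y x * \<bar>t\<bar> ^ 2"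
    "\<And>x t. x \<in> space M \<Longrightarrow> cmod (f x t - f x 0 - t *\<^sub>R f1 x 0 - (t\<^sup>2 / 2) *\<^sub>R f2 x 0) \<le> C * Y x * \<bar>t\<bar> ^ 3"
    by blast+
  have f1m: "(\<lambda>x. f1 x t) \<in> borel_measurable N" for t
    by (rule measurable_vector_derivative[where f = f and t = "\<lambda>_. t"]) (auto simp: spN T f)
  have f2m: "(\<lambda>x. f2 x t) \<in> borel_measurable N" for t
    by (rule measurable_vector_derivative[where f = f1 and t = "\<lambda>_. t"]) (auto simp: spN T f1m)
  have le: "C * Y x \<le> C" if "x \<in> space M" for x
    using Y(3)[OF that] C by (simp add: mult_left_le)
  have i0: "integrable M (\<lambda>x. f x 0)"
    by (rule integrable_bounded[where C = C]) (auto intro!: sub f order_trans[OF smooth_bound_norm[OF f(2)] le])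
  have i1: "integrable M (\<lambda>x. f1 x 0)"
    by (rule integrable_bounded[where C = C]) (auto intro!: sub f1m order_trans[OF T(3) le])
  have i2: "integrable M (\<lambda>x. f2 x 0)"
    by (rule integrable_bounded[where C = C]) (auto intro!: sub f2m order_trans[OF T(4) le])
  have iY: "integrable M (\<lambda>x. complex_of_real (Y x))"
    by (rule integrable_bounded[where C = 1]) (use Ym Y in auto)
  have EY: "0 \<le> expectation Y" using Y by simp
  note P = expectation_indep_power[OF ind]
  have YP: "expectation (\<lambda>x. w x ^ k * Y x) = expectation (\<lambda>x. w x ^ k) * expectation Y"
      "integrable M (\<lambda>x. w x ^ k * Y x)" for k
  proof -
    note p = P[OF _ iY w(1)[of k]]
    have "(LINT x|M. complex_of_real (w x ^ k * Y x)) = of_real (expectation (\<lambda>x. w x ^ k) * expectation Y)"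
      using p(1) Y by (simp del: of_real_power)
    then show "expectation (\<lambda>x. w x ^ k * Y x) = expectation (\<lambda>x. w x ^ k) * expectation Y"
      by (simp only: integral_complex_of_real of_real_eq_iff)
    have "integrable M (\<lambda>x. complex_of_real (w x ^ k * Y x))" using p(2) Y by (simp del: of_real_power)
    from integrable_Re[OF this] show "integrable M (\<lambda>x. w x ^ k * Y x)" by (simp del: of_real_power of_real_mult)
  qed
  define m2 where "m2 = expectation (\<lambda>x. (w x)\<^sup>2)"
  define m4 where "m4 = expectation (\<lambda>x. w x ^ 4)"
  have m: "0 \<le> m2" "0 \<le> m4" by (simp_all add: m2_def m4_def)
  let ?r = "\<lambda>x. of_real (w x) * (f x (a * w x) - f x 0 - (a * w x) *\<^sub>R f1 x 0 - ((a * w x)\<^sup>2 / 2) *\<^sub>R f2 x 0)"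
  let ?q = "\<lambda>x. G x - f1 x 0 - (a * w x) *\<^sub>R f2 x 0"
  have rm: "?r \<in> borel_measurable M" using F sub[OF f1m] sub[OF f2m] sub[OF f(1)] wm by measurable
  have qm: "?q \<in> borel_measurable M" using G sub[OF f1m] sub[OF f2m] wm by measurable
  have rb: "cmod (?r x) \<le> C * a ^ 3 * (w x ^ 4 * Y x)" if x: "x \<in> space M" for x
  proof -
    have "cmod (?r x) \<le> \<bar>w x\<bar> * (C * Y x * \<bar>a * w x\<bar> ^ 3)"
      unfolding norm_mult norm_of_real using T(6)[OF x] by (intro mult_left_mono) auto
    also have "\<dots> = C * a ^ 3 * (\<bar>w x\<bar> ^ 4 * Y x)"
      using a by (simp add: abs_mult power_mult_distrib power4_eq_xxxx power3_eq_cube)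
    also have "\<bar>w x\<bar> ^ 4 = w x ^ 4" by simp
    finally show ?thesis .
  qed
  have Geq: "G x = f1 x (a * w x)" if "x \<in> space M" for x
    using vector_derivative_unique_at[OF deriv T(1)] that by blast
  have qb: "cmod (?q x) \<le> C * a\<^sup>2 * ((w x)\<^sup>2 * Y x)" if x: "x \<in> space M" for x
    using T(5)[OF x, of "a * w x"] by (simp add: Geq[OF x] power_mult_distrib mult_ac)
  have ir: "integrable M ?r"
    by (rule Bochner_Integration.integrable_bound[OF integrable_mult_right[OF YP(2)[of 4], of "C * a ^ 3"]])
       (use rm rb C a Y in \<open>auto intro!: AE_I2 simp: abs_mult\<close>)
  have iq: "integrable M ?q"
    by (rule Bochner_Integration.integrable_bound[OF integrable_mult_right[OF YP(2)[of 2], of "C * a\<^sup>2"]])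
       (use qm qb C a Y in \<open>auto intro!: AE_I2 simp: abs_mult\<close>)
  have Er: "cmod (LINT x|M. ?r x) \<le> C * a ^ 3 * (m4 * expectation Y)"
  proof -
    have "cmod (LINT x|M. ?r x) \<le> expectation (\<lambda>x. C * a ^ 3 * (w x ^ 4 * Y x))"
      by (rule norm_integral_le[OF ir]) (auto intro!: integrable_mult_right YP rb)
    then show ?thesis by (simp add: YP m4_def)
  qed
  have Eq: "cmod (LINT x|M. ?q x) \<le> C * a\<^sup>2 * (m2 * expectation Y)"
  proof -
    have "cmod (LINT x|M. ?q x) \<le> expectation (\<lambda>x. C * a\<^sup>2 * ((w x)\<^sup>2 * Y x))"
      by (rule norm_integral_le[OF iq]) (auto intro!: integrable_mult_right YP qb)
    then show ?thesis by (simp add: YP m2_def)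
  qed
  note p1 = P[OF f(1) i0 w(1)[of 1]] and p2 = P[OF f1m i1 w(1)[of 2]] and p3 = P[OF f2m i2 w(1)[of 3]]
    and p4 = P[OF f2m i2 w(1)[of 1]]
  have "of_real (w x) * f x (a * w x) = of_real (w x ^ 1) * f x 0 + of_real a * (of_real (w x ^ 2) * f1 x 0) +
     of_real (a\<^sup>2 / 2) * (of_real (w x ^ 3) * f2 x 0) + ?r x" for x
    by (simp add: scaleR_conv_of_real power2_eq_square power3_eq_cube algebra_simps)
  then have "(LINT x|M. of_real (w x) * f x (a * w x)) = (LINT x|M. of_real (w x ^ 1) * f x 0 +
     of_real a * (of_real (w x ^ 2) * f1 x 0) + of_real (a\<^sup>2 / 2) * (of_real (w x ^ 3) * f2 x 0) + ?r x)"
    by (intro Bochner_Integration.integral_cong refl)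
  also have "\<dots> = of_real (a * m2) * (LINT x|M. f1 x 0) + (LINT x|M. ?r x)"
    unfolding integral_linear_combination[OF p1(2) p2(2) p3(2) ir] p1(1) p2(1) p3(1) w(3)
    using w(2) by (simp add: m2_def)
  \<comment> \<open>The terms of order 0 and 2 are gone because the first and third moments of w vanish.\<close>
  finally have E1: "(LINT x|M. of_real (w x) * f x (a * w x)) = of_real (a * m2) * (LINT x|M. f1 x 0) + (LINT x|M. ?r x)" .
  \<comment> \<open>The vanishing third term gives the right-hand side the four-term shape of the linearity lemma.\<close>
  have "G x = f1 x 0 + of_real a * (of_real (w x ^ 1) * f2 x 0) + 0 * 0 + ?q x" for x
    by (simp add: scaleR_conv_of_real)
  then have "(LINT x|M. G x) = (LINT x|M. f1 x 0 + of_real a * (of_real (w x ^ 1) * f2 x 0) + 0 * 0 + ?q x)"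
    by (intro Bochner_Integration.integral_cong refl)
  also have "\<dots> = (LINT x|M. f1 x 0) + (LINT x|M. ?q x)"
    unfolding integral_linear_combination[OF i1 p4(2) integrable_zero iq] p4(1) using w(2) by simp
  finally have E2: "(LINT x|M. G x) = (LINT x|M. f1 x 0) + (LINT x|M. ?q x)" .
  have "cmod ((LINT x|M. of_real (w x) * f x (a * w x)) - of_real (a * m2) * (LINT x|M. G x)) =
      cmod ((LINT x|M. ?r x) - of_real (a * m2) * (LINT x|M. ?q x))"
    unfolding E1 E2 by (simp add: algebra_simps)
  also have "\<dots> \<le> C * a ^ 3 * (m4 * expectation Y) + (a * m2) * (C * a\<^sup>2 * (m2 * expectation Y))"
  proof (rule order_trans[OF norm_triangle_ineq4 add_mono[OF Er]])
    show "cmod (of_real (a * m2) * (LINT x|M. ?q x)) \<le> (a * m2) * (C * a\<^sup>2 * (m2 * expectation Y))"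
      unfolding norm_mult[of "of_real (a * m2)"] using Eq a m by (intro mult_mono) (auto simp: norm_mult)
  qed
  also have "\<dots> = (C * a ^ 3 * expectation Y) * (m4 + m2\<^sup>2)"
    by (simp add: power2_eq_square power3_eq_cube algebra_simps)
  also have "\<dots> \<le> (C * a ^ 3 * expectation Y) * (K + K)"
    using w(4,5) C a EY by (intro mult_left_mono) (auto simp: m2_def m4_def)
  finally show ?thesis by (simp add: m2_def algebra_simps)
qed

section \<open>The self-consistent equations\<close>

text \<open>
  A fixed size \<open>n\<close>. Of the law of the entries only the first four moments are kept, with a
  constant \<open>K\<close> that will be the same for all sizes. \<open>R i j\<close> is a sigma-algebra that carries everything
  except the entry \<open>(i, j)\<close>. The vector has norm 1 at every sample point, which makes the resolvent
  bounds pointwise.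
\<close>

locale spiked_wigner = prob_space M for M :: "'a measure" +
  fixes n :: nat and W :: "nat \<Rightarrow> nat \<Rightarrow> 'a \<Rightarrow> real" and u :: "'a \<Rightarrow> nat \<Rightarrow> real"
    and R :: "nat \<Rightarrow> nat \<Rightarrow> 'a measure" and K \<theta> :: real
  assumes n: "n > 0" and K: "K \<ge> 1"
    and W_sym: "\<And>i j \<omega>. i < n \<Longrightarrow> j < n \<Longrightarrow> \<omega> \<in> space M \<Longrightarrow> W i j \<omega> = W j i \<omega>"
    and W_integrable: "\<And>i j k. i < n \<Longrightarrow> j < n \<Longrightarrow> integrable M (\<lambda>\<omega>. W i j \<omega> ^ k)"
    and W_1: "\<And>i j. i < n \<Longrightarrow> j < n \<Longrightarrow> expectation (W i j) = 0"
    and W_2: "\<And>i j. i < n \<Longrightarrow> j < n \<Longrightarrow> i \<noteq> j \<Longrightarrow> expectation (\<lambda>\<omega>. (W i j \<omega>)\<^sup>2) = 1"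
    and W_22: "\<And>i j. i < n \<Longrightarrow> j < n \<Longrightarrow> (expectation (\<lambda>\<omega>. (W i j \<omega>)\<^sup>2))\<^sup>2 \<le> K"
    and W_3: "\<And>i j. i < n \<Longrightarrow> j < n \<Longrightarrow> expectation (\<lambda>\<omega>. W i j \<omega> ^ 3) = 0"
    and W_4: "\<And>i j. i < n \<Longrightarrow> j < n \<Longrightarrow> expectation (\<lambda>\<omega>. W i j \<omega> ^ 4) \<le> K"
    and u_norm: "\<And>\<omega>. \<omega> \<in> space M \<Longrightarrow> (\<Sum>i<n. (u \<omega> i)\<^sup>2) = 1"
    and indep: "\<And>i j. i < n \<Longrightarrow> j < n \<Longrightarrow> indep_of M (W i j) (R i j)"
    and W_rest: "\<And>i j k l. i < n \<Longrightarrow> j < n \<Longrightarrow> k < n \<Longrightarrow> l < n \<Longrightarrow> (k, l) \<notin> entry_pairs i j \<Longrightarrow>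
        W k l \<in> borel_measurable (R i j)"
    and u_rest: "\<And>i j k. i < n \<Longrightarrow> j < n \<Longrightarrow> k < n \<Longrightarrow> (\<lambda>\<omega>. u \<omega> k) \<in> borel_measurable (R i j)"
begin

definition a :: real where "a = 1 / sqrt (real n)"

definition B :: "'a \<Rightarrow> nat \<Rightarrow> nat \<Rightarrow> real" where
  "B \<omega> k l = a * W k l \<omega> + \<theta> * (u \<omega> k * u \<omega> l)"

text \<open>
  The spiked matrix with the entry \<open>(i, j)\<close> of the noise removed; it is independent of that entry.
\<close>

definition B_without :: "nat \<Rightarrow> nat \<Rightarrow> 'a \<Rightarrow> nat \<Rightarrow> nat \<Rightarrow> real" where
  "B_without i j \<omega> k l = (if (k, l) \<in> entry_pairs i j then 0 else a * W k l \<omega>) + \<theta> * (u \<omega> k * u \<omega> l)"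

lemma a_pos: "0 < a" and a_le_1: "a \<le> 1" and a_sq: "a\<^sup>2 * real n = 1" and a_sqrt: "a\<^sup>2 * sqrt (real n) = a"
  using n by (auto simp: a_def power_divide real_div_sqrt field_simps)

lemma a4: "a * a ^ 3 * (real n * sqrt (real n)) = a"
proof -
  have "a * a ^ 3 * (real n * sqrt (real n)) = (a\<^sup>2 * real n) * (a\<^sup>2 * sqrt (real n))"
    by (simp add: power2_eq_square power3_eq_cube)
  then show ?thesis by (simp add: a_sq a_sqrt)
qed

lemma rest_sub:
  assumes "i < n" "j < n" "g \<in> borel_measurable (R i j)"
  shows "g \<in> borel_measurable M"
proof -
  have "borel_measurable (R i j) \<subseteq> borel_measurable M"
    using indep[OF assms(1,2)] by (intro measurable_mono) (auto simp: indep_of_def)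
  then show ?thesis using assms(3) by auto
qed

lemma W_measurable: "i < n \<Longrightarrow> j < n \<Longrightarrow> W i j \<in> borel_measurable M"
  using borel_measurable_integrable[OF W_integrable[of i j 1]] by simp

lemma u_measurable: "k < n \<Longrightarrow> (\<lambda>\<omega>. u \<omega> k) \<in> borel_measurable M"
  using rest_sub[OF n n u_rest[OF n n]] .

lemma B_measurable: "k < n \<Longrightarrow> l < n \<Longrightarrow> (\<lambda>\<omega>. B \<omega> k l) \<in> borel_measurable M"
  unfolding B_def using W_measurable u_measurable by measurable

lemma B_without_measurable:
  "i < n \<Longrightarrow> j < n \<Longrightarrow> k < n \<Longrightarrow> l < n \<Longrightarrow> (\<lambda>\<omega>. B_without i j \<omega> k l) \<in> borel_measurable (R i j)"
  unfolding B_without_def using W_rest[of i j k l] u_rest[of i j]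
  by (cases "(k, l) \<in> entry_pairs i j") auto

lemma B_eq_shift:
  assumes "i < n" "j < n" "\<omega> \<in> space M"
  shows "shift_entry (B_without i j \<omega>) i j (a * W i j \<omega>) = B \<omega>"
  using W_sym[OF assms] by (auto simp: fun_eq_iff shift_entry_def B_without_def B_def entry_pairs_def)

lemma symm_B: "\<omega> \<in> space M \<Longrightarrow> symm n (B \<omega>)"
  using W_sym by (auto simp: symm_def B_def)

lemma symm_B_without: "\<omega> \<in> space M \<Longrightarrow> symm n (B_without i j \<omega>)"
  using W_sym by (auto simp: symm_def B_without_def entry_pairs_def)

lemma res_form_measurable:
  assumes "\<And>k l. k < n \<Longrightarrow> l < n \<Longrightarrow> (\<lambda>\<omega>. A \<omega> k l) \<in> borel_measurable N"
    and "\<And>k. k < n \<Longrightarrow> (\<lambda>\<omega>. x \<omega> k) \<in> borel_measurable N"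
    and "\<And>k. k < n \<Longrightarrow> (\<lambda>\<omega>. y \<omega> k) \<in> borel_measurable N"
  shows "(\<lambda>\<omega>. res_form n (A \<omega>) z (x \<omega>) (y \<omega>)) \<in> borel_measurable N"
  unfolding res_form_def
  by (intro borel_measurable_sum borel_measurable_times measurable_resolvent
        measurable_compose[OF _ borel_measurable_of_real] assms) auto

end

lemma sum_triple_le_l2:
  fixes \<alpha> \<beta> :: "nat \<Rightarrow> real" and \<gamma> :: "nat \<Rightarrow> nat \<Rightarrow> real"
  assumes "\<And>i. 0 \<le> \<alpha> i" "\<And>i. 0 \<le> \<beta> i" "\<And>i j. 0 \<le> \<gamma> i j" "0 \<le> p" "0 \<le> q" "0 \<le> r"
    and "(\<Sum>i<n. (\<alpha> i)\<^sup>2) \<le> p\<^sup>2" "(\<Sum>j<n. (\<beta> j)\<^sup>2) \<le> q\<^sup>2" "(\<Sum>i<n. \<Sum>j<n. (\<gamma> i j)\<^sup>2) \<le> r\<^sup>2"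
  shows "(\<Sum>i<n. \<Sum>j<n. \<alpha> i * \<beta> j * \<gamma> i j) \<le> p * q * r"
proof -
  let ?I = "{..<n} \<times> {..<n}"
  let ?f = "\<lambda>(i, j). \<alpha> i * \<beta> j" and ?g = "\<lambda>(i, j). \<gamma> i j"
  have "(\<Sum>i<n. \<Sum>j<n. \<alpha> i * \<beta> j * \<gamma> i j) = (\<Sum>k\<in>?I. \<bar>?f k\<bar> * \<bar>?g k\<bar>)"
    unfolding sum.cartesian_product using assms(1-3) by (intro sum.cong) auto
  also have "\<dots> \<le> L2_set ?f ?I * L2_set ?g ?I" by (rule L2_set_mult_ineq)
  also have "\<dots> \<le> (p * q) * r"
  proof (intro mult_mono)
    have "(\<Sum>k\<in>?I. (?f k)\<^sup>2) = (\<Sum>i<n. (\<alpha> i)\<^sup>2) * (\<Sum>j<n. (\<beta> j)\<^sup>2)"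
      unfolding sum_product sum.cartesian_product by (intro sum.cong) (auto simp: power_mult_distrib)
    also have "\<dots> \<le> (p * q)\<^sup>2"
      unfolding power_mult_distrib using assms by (intro mult_mono) (auto intro: sum_nonneg)
    finally show "L2_set ?f ?I \<le> p * q"
      using assms unfolding L2_set_def by (intro real_le_lsqrt) auto
    have "(\<Sum>k\<in>?I. (?g k)\<^sup>2) = (\<Sum>i<n. \<Sum>j<n. (\<gamma> i j)\<^sup>2)"
      unfolding sum.cartesian_product by (intro sum.cong) auto
    then show "L2_set ?g ?I \<le> r"
      using assms unfolding L2_set_def by (intro real_le_lsqrt) auto
  qed (use assms in auto)
  finally show ?thesis .
qed

lemma sum_abs_le_sqrt:
  assumes "in_unit_ball n x"
  shows "(\<Sum>i<n. \<bar>x i\<bar>) \<le> sqrt (real n)"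
proof -
  have "(\<Sum>i<n. \<bar>x i\<bar> * \<bar>1::real\<bar>) \<le> 1 * sqrt (real n)"
    using assms by (intro sum_mult_le_l2) (auto simp: in_unit_ball_def)
  then show ?thesis by simp
qed

lemma in_unit_ball_abs_le:
  assumes "in_unit_ball n x" "i < n"
  shows "\<bar>x i\<bar> \<le> 1"
proof -
  have "(x i)\<^sup>2 \<le> (\<Sum>i<n. (x i)\<^sup>2)" using assms(2) by (intro member_le_sum) auto
  then have "(x i)\<^sup>2 \<le> 1\<^sup>2" using assms(1) by (simp add: in_unit_ball_def)
  then show ?thesis using abs_le_square_iff[of "x i" 1] by simp
qed

lemma smooth_bound_form_times_observable:
  assumes F: "observable n C F D" and B: "symm n B" and z: "Im z > 0"
    and ij: "i < n" "j < n" and y: "in_unit_ball n y"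
  shows "smooth_bound 3 (8 * form_const z 3 * C * \<bar>r\<bar>)
     (\<lambda>t. of_real r * (res_form n (shift_entry B i j t) z (unit_vec_fun j) y * F (shift_entry B i j t)))"
    "((\<lambda>t. of_real r * (res_form n (shift_entry B i j t) z (unit_vec_fun j) y * F (shift_entry B i j t)))
      has_vector_derivative of_real r *
        (res_form n (shift_entry B i j t) z (unit_vec_fun j) y * D (shift_entry B i j t) i j +
         form_deriv n (shift_entry B i j t) z (unit_vec_fun j) y i j * F (shift_entry B i j t))) (at t)"
proof -
  have "smooth_bound 3 (cmod (of_real r) * (2 ^ 3 * form_const z 3 * C))
     (\<lambda>t. of_real r * (res_form n (shift_entry B i j t) z (unit_vec_fun j) y * F (shift_entry B i j t)))"
    by (intro smooth_bound_cmult smooth_bound_mult res_form_smooth observableD[OF F] B z ij y) simp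
  then show "smooth_bound 3 (8 * form_const z 3 * C * \<bar>r\<bar>)
     (\<lambda>t. of_real r * (res_form n (shift_entry B i j t) z (unit_vec_fun j) y * F (shift_entry B i j t)))"
    by (simp add: mult_ac)
  show "((\<lambda>t. of_real r * (res_form n (shift_entry B i j t) z (unit_vec_fun j) y * F (shift_entry B i j t)))
      has_vector_derivative of_real r *
        (res_form n (shift_entry B i j t) z (unit_vec_fun j) y * D (shift_entry B i j t) i j +
         form_deriv n (shift_entry B i j t) z (unit_vec_fun j) y i j * F (shift_entry B i j t))) (at t)"
    unfolding form_deriv_def
    by (intro has_vector_derivative_mult_right has_vector_derivative_mult res_form_has_derivative
        observableD[OF F] B z ij y) simp
qed

text \<open>
  The explicit terms left over after integrating by parts in all entries. Here \<open>D\<close> and \<open>X\<close> are the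
  gradient and the value of an observable and \<open>\<sigma>\<close> the variances. Each of the double sums has
  \<open>n\<^sup>2\<close> bounded terms, but Cauchy--Schwarz against the square-summable factors brings it down to
  \<open>O(sqrt n)\<close>; after multiplication by \<open>a\<^sup>2 = 1/n\<close> this is \<open>O(a)\<close>.
\<close>

lemma main_term_bound:
  assumes B: "symm n B" and z: "Im z > 0" and x: "in_unit_ball n x" and y: "in_unit_ball n y"
    and n: "n > 0" and C: "cmod X \<le> C" "(\<Sum>i<n. \<Sum>j<n. (cmod (D i j))\<^sup>2) \<le> C\<^sup>2"
    and K: "1 \<le> K" and \<sigma>: "\<And>i j. i < n \<Longrightarrow> j < n \<Longrightarrow> 0 \<le> \<sigma> i j" "\<And>i j. i < n \<Longrightarrow> j < n \<Longrightarrow> \<sigma> i j \<le> K"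
      "\<And>i j. i < n \<Longrightarrow> j < n \<Longrightarrow> i \<noteq> j \<Longrightarrow> \<sigma> i j = 1"
  shows "cmod (\<Sum>i<n. \<Sum>j<n. of_real (\<sigma> i j) * (of_real (x i) *
      (res_form n B z (unit_vec_fun j) y * D i j + form_deriv n B z (unit_vec_fun j) y i j * X)) +
      of_real (x i) * (res_form n B z (unit_vec_fun j) (unit_vec_fun j) * res_form n B z (unit_vec_fun i) y * X))
    \<le> (K * C / Im z + C / (Im z)\<^sup>2 + (K + 1) * C / (Im z)\<^sup>2) * sqrt (real n)"
proof -
  let ?e = unit_vec_fun and ?c = "1 / Im z"
  let ?y = "\<lambda>j. cmod (res_form n B z (?e j) y)" and ?G = "\<lambda>i j. cmod (res_form n B z (?e j) (?e i))"
  have c: "0 < ?c" using z by simp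
  have C0: "0 \<le> C" using order_trans[OF norm_ge_zero C(1)] .
  have y1: "?y j \<le> ?c" for j using res_form_bound[OF B z] y by simp
  have G1: "?G i j \<le> ?c" for i j using res_form_bound[OF B z] by simp
  let ?b = "\<lambda>i j. K * (\<bar>x i\<bar> * ?y j * cmod (D i j)) + C * (\<bar>x i\<bar> * ?y j * ?G i j) +
     (if i = j then (K + 1) * C * ?c\<^sup>2 * \<bar>x i\<bar> else 0)"
  have ptw: "cmod (of_real (\<sigma> i j) * (of_real (x i) *
      (res_form n B z (?e j) y * D i j + form_deriv n B z (?e j) y i j * X)) +
      of_real (x i) * (res_form n B z (?e j) (?e j) * res_form n B z (?e i) y * X)) \<le> ?b i j"
    if ij: "i < n" "j < n" for i j
  proof (cases "i = j")
    case False
    \<comment> \<open>Of the two products in the derivative of the form, one cancels exactly against the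
       trace term; the other is a matrix element with both indices, which is square summable.\<close>
    then have e: "of_real (\<sigma> i j) * (of_real (x i) *
      (res_form n B z (?e j) y * D i j + form_deriv n B z (?e j) y i j * X)) +
      of_real (x i) * (res_form n B z (?e j) (?e j) * res_form n B z (?e i) y * X) =
      of_real (x i) * res_form n B z (?e j) y * D i j - X * (of_real (x i) * res_form n B z (?e j) y * res_form n B z (?e j) (?e i))"
      using \<sigma>(3)[OF ij] by (simp add: form_deriv_def entry_pairs_def algebra_simps)
    have "cmod (of_real (x i) * res_form n B z (?e j) y * D i j - X * (of_real (x i) * res_form n B z (?e j) y * res_form n B z (?e j) (?e i)))
      \<le> \<bar>x i\<bar> * ?y j * cmod (D i j) + cmod X * (\<bar>x i\<bar> * ?y j * ?G i j)"
      by (rule order_trans[OF norm_triangle_ineq4]) (simp add: norm_mult)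
    also have "\<dots> \<le> K * (\<bar>x i\<bar> * ?y j * cmod (D i j)) + C * (\<bar>x i\<bar> * ?y j * ?G i j)"
      using K mult_right_mono[of 1 K "\<bar>x i\<bar> * ?y j * cmod (D i j)"] C(1)
      by (intro add_mono mult_right_mono) auto
    finally show ?thesis using False unfolding e by simp
  next
    case True
    \<comment> \<open>On the diagonal the cancellation is incomplete because the variance may differ from 1, but there
       are only n such summands.\<close>
    then have e: "of_real (\<sigma> i j) * (of_real (x i) *
      (res_form n B z (?e j) y * D i j + form_deriv n B z (?e j) y i j * X)) +
      of_real (x i) * (res_form n B z (?e j) (?e j) * res_form n B z (?e i) y * X) =
      of_real (\<sigma> i j) * (of_real (x i) * res_form n B z (?e j) y * D i j) +
      (of_real (1 - \<sigma> i j)) * (X * (of_real (x i) * (res_form n B z (?e i) (?e i) * res_form n B z (?e i) y)))"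
      by (simp add: form_deriv_def entry_pairs_def algebra_simps)
    have "cmod (of_real (\<sigma> i j) * (of_real (x i) * res_form n B z (?e j) y * D i j) +
      (of_real (1 - \<sigma> i j)) * (X * (of_real (x i) * (res_form n B z (?e i) (?e i) * res_form n B z (?e i) y))))
      \<le> \<sigma> i j * (\<bar>x i\<bar> * ?y j * cmod (D i j)) + \<bar>1 - \<sigma> i j\<bar> * (cmod X * (\<bar>x i\<bar> * (?G i i * ?y i)))"
      using \<sigma>(1)[OF ij] by (intro order_trans[OF norm_triangle_ineq]) (simp add: norm_mult del: of_real_diff)
    also have "\<dots> \<le> K * (\<bar>x i\<bar> * ?y j * cmod (D i j)) + (K + 1) * (C * (\<bar>x i\<bar> * (?c * ?c)))"
      using K C(1) C0 \<sigma>(1,2)[OF ij] c by (intro add_mono mult_right_mono mult_mono G1 y1) auto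
    also have "\<dots> \<le> ?b i j"
      using True C0 by (simp add: power2_eq_square mult_ac)
    finally show ?thesis unfolding e .
  qed
  have xl: "(\<Sum>i<n. \<bar>x i\<bar>\<^sup>2) \<le> 1\<^sup>2" using x by (simp add: in_unit_ball_def)
  have yl: "(\<Sum>i<n. (?y i)\<^sup>2) \<le> ?c\<^sup>2" using res_form_l2[OF B z y] by (simp add: power_divide)
  have Gl: "(\<Sum>i<n. \<Sum>j<n. (?G i j)\<^sup>2) \<le> (sqrt n * ?c)\<^sup>2"
  proof -
    have "(\<Sum>i<n. \<Sum>j<n. (?G i j)\<^sup>2) \<le> (\<Sum>i<n. ?c\<^sup>2)"
      using res_form_l2[OF B z in_unit_ball_unit_vec_fun] by (intro sum_mono) (simp add: power_divide)
    then show ?thesis by (simp add: power_mult_distrib power_divide)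
  qed
  have sn: "1 \<le> sqrt (real n)" using n by simp
  have "cmod (\<Sum>i<n. \<Sum>j<n. of_real (\<sigma> i j) * (of_real (x i) *
      (res_form n B z (?e j) y * D i j + form_deriv n B z (?e j) y i j * X)) +
      of_real (x i) * (res_form n B z (?e j) (?e j) * res_form n B z (?e i) y * X)) \<le> (\<Sum>i<n. \<Sum>j<n. ?b i j)"
    by (intro sum_norm_le ptw) auto
  also have "\<dots> = K * (\<Sum>i<n. \<Sum>j<n. \<bar>x i\<bar> * ?y j * cmod (D i j)) + C * (\<Sum>i<n. \<Sum>j<n. \<bar>x i\<bar> * ?y j * ?G i j)
     + (K + 1) * C * ?c\<^sup>2 * (\<Sum>i<n. \<bar>x i\<bar>)"
    by (simp add: sum.distrib sum_distrib_left)
  also have "\<dots> \<le> K * (1 * ?c * C) + C * (1 * ?c * (sqrt n * ?c)) + (K + 1) * C * ?c\<^sup>2 * sqrt n"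
    using K C0 c C(2) xl yl Gl sum_abs_le_sqrt[OF x]
    by (intro add_mono mult_left_mono sum_triple_le_l2) auto
  also have "\<dots> \<le> K * (1 * ?c * C) * sqrt n + C * (1 * ?c * (sqrt n * ?c)) + (K + 1) * C * ?c\<^sup>2 * sqrt n"
    using K C0 c sn mult_left_mono[of 1 "sqrt n" "K * (1 * ?c * C)"] by simp
  also have "\<dots> = (K * C / Im z + C / (Im z)\<^sup>2 + (K + 1) * C / (Im z)\<^sup>2) * sqrt (real n)"
    by (simp add: power2_eq_square algebra_simps)
  finally show ?thesis .
qed

lemma integral_double_sum:
  fixes f :: "nat \<Rightarrow> nat \<Rightarrow> 'a \<Rightarrow> complex"
  assumes "\<And>i j. i < n \<Longrightarrow> j < n \<Longrightarrow> integrable M (f i j)"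
  shows "(LINT x|M. (\<Sum>i<n. \<Sum>j<n. f i j x)) = (\<Sum>i<n. \<Sum>j<n. LINT x|M. f i j x)"
proof -
  have "(LINT x|M. (\<Sum>i<n. \<Sum>j<n. f i j x)) = (\<Sum>i<n. LINT x|M. (\<Sum>j<n. f i j x))"
    using assms by (intro Bochner_Integration.integral_sum Bochner_Integration.integrable_sum) auto
  also have "\<dots> = (\<Sum>i<n. \<Sum>j<n. LINT x|M. f i j x)"
    using assms by (intro sum.cong refl Bochner_Integration.integral_sum) auto
  finally show ?thesis .
qed

context spiked_wigner
begin

text \<open>
  The central estimate: under the expectation and against any observable \<open>F\<close>, the noise \<open>A = a W\<close>
  acts on the resolvent like minus its normalized trace,
  \<open>E[x\<^sup>T A (B - z)\<^sup>-\<^sup>1 y F] = - E[s x\<^sup>T (B - z)\<^sup>-\<^sup>1 y F] + O(1 / sqrt n)\<close>.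
  Integrating by parts in \<open>W i j\<close>, the derivative of the resolvent produces the product of the
  diagonal element \<open>(j, j)\<close> with \<open>e_i\<^sup>T (B - z)\<^sup>-\<^sup>1 y\<close>, and summing over \<open>i\<close> and \<open>j\<close> gives trace times form.
  The vectors may depend on everything but the noise, and \<open>Fm\<close> says that \<open>F\<close> is built
  measurably from the matrix and the vector \<open>u\<close>.
\<close>

lemma expectation_quadratic_form:
  fixes x y :: "'a \<Rightarrow> nat \<Rightarrow> real" and F :: "'a \<Rightarrow> (nat \<Rightarrow> nat \<Rightarrow> real) \<Rightarrow> complex"
  assumes z: "Im z > 0"
    and x: "\<And>i j k. i < n \<Longrightarrow> j < n \<Longrightarrow> k < n \<Longrightarrow> (\<lambda>\<omega>. x \<omega> k) \<in> borel_measurable (R i j)"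
    and y: "\<And>i j k. i < n \<Longrightarrow> j < n \<Longrightarrow> k < n \<Longrightarrow> (\<lambda>\<omega>. y \<omega> k) \<in> borel_measurable (R i j)"
    and xb: "\<And>\<omega>. \<omega> \<in> space M \<Longrightarrow> in_unit_ball n (x \<omega>)"
    and yb: "\<And>\<omega>. \<omega> \<in> space M \<Longrightarrow> in_unit_ball n (y \<omega>)"
    and F: "\<And>\<omega>. \<omega> \<in> space M \<Longrightarrow> observable n C (F \<omega>) (D \<omega>)"
    and Fm: "\<And>N A. (\<And>k l. k < n \<Longrightarrow> l < n \<Longrightarrow> (\<lambda>\<omega>. A \<omega> k l) \<in> borel_measurable N) \<Longrightarrow>
       (\<And>k. k < n \<Longrightarrow> (\<lambda>\<omega>. u \<omega> k) \<in> borel_measurable N) \<Longrightarrow> (\<lambda>\<omega>. F \<omega> (A \<omega>)) \<in> borel_measurable N"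
  shows "cmod ((LINT \<omega>|M. (\<Sum>i<n. \<Sum>j<n. of_real (x \<omega> i) *
          (of_real (a * W i j \<omega>) * res_form n (B \<omega>) z (unit_vec_fun j) (y \<omega>))) * F \<omega> (B \<omega>)) +
      (LINT \<omega>|M. res_trace n (B \<omega>) z * res_form n (B \<omega>) z (x \<omega>) (y \<omega>) * F \<omega> (B \<omega>)))
    \<le> (16 * form_const z 3 * C * K + (K * C / Im z + C / (Im z)\<^sup>2 + (K + 1) * C / (Im z)\<^sup>2)) * a"
proof -
  let ?e = unit_vec_fun
  let ?S = "\<lambda>i j \<omega> t. shift_entry (B_without i j \<omega>) i j t"
  define f where "f i j \<omega> t = of_real (x \<omega> i) * (res_form n (?S i j \<omega> t) z (?e j) (y \<omega>) * F \<omega> (?S i j \<omega> t))" for i j \<omega> t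
  define g where "g i j \<omega> = of_real (x \<omega> i) * (res_form n (B \<omega>) z (?e j) (y \<omega>) * D \<omega> (B \<omega>) i j +
         form_deriv n (B \<omega>) z (?e j) (y \<omega>) i j * F \<omega> (B \<omega>))" for i j \<omega>
  define h where "h i j \<omega> = of_real (x \<omega> i) * (res_form n (B \<omega>) z (?e j) (?e j) * res_form n (B \<omega>) z (?e i) (y \<omega>) * F \<omega> (B \<omega>))" for i j \<omega>
  define \<sigma> where "\<sigma> i j = expectation (\<lambda>\<omega>. (W i j \<omega>)\<^sup>2)" for i j
  let ?c = "1 / Im z"
  have c: "0 < ?c" using z by simp
  obtain \<omega>0 where "\<omega>0 \<in> space M" using not_empty by auto
  have C0: "0 \<le> C" using order_trans[OF norm_ge_zero observableD(1)[OF F[OF \<open>\<omega>0 \<in> space M\<close>] symm_B[OF \<open>\<omega>0 \<in> space M\<close>]]] .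
  have c3: "0 \<le> form_const z 3" using form_const_ge[OF z, of 3] c by linarith
  have \<sigma>: "0 \<le> \<sigma> i j" "\<sigma> i j \<le> K" "i \<noteq> j \<Longrightarrow> \<sigma> i j = 1" if "i < n" "j < n" for i j
  proof -
    show "0 \<le> \<sigma> i j" by (simp add: \<sigma>_def)
    have "(\<sigma> i j)\<^sup>2 \<le> K" using W_22[OF that] by (simp add: \<sigma>_def)
    also have "K \<le> K\<^sup>2" using K self_le_power[of K 2] by simp
    finally show "\<sigma> i j \<le> K" by (rule power2_le_imp_le) (use K in simp)
    show "i \<noteq> j \<Longrightarrow> \<sigma> i j = 1" using W_2[OF that] by (simp add: \<sigma>_def)
  qed
  have xM: "(\<lambda>\<omega>. x \<omega> k) \<in> borel_measurable M" and yM: "(\<lambda>\<omega>. y \<omega> k) \<in> borel_measurable M" if "k < n" for k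
    using rest_sub[OF n n x[OF n n that]] rest_sub[OF n n y[OF n n that]] by auto
  have SR: "(\<lambda>\<omega>. ?S i j \<omega> t k l) \<in> borel_measurable (R i j)" if "i < n" "j < n" "k < n" "l < n" for i j k l t
    unfolding shift_entry_def by (intro borel_measurable_add borel_measurable_const B_without_measurable that)
  have SM: "(\<lambda>\<omega>. ?S i j \<omega> (a * W i j \<omega> + t) k l) \<in> borel_measurable M" if "i < n" "j < n" "k < n" "l < n" for i j k l t
    using rest_sub[OF that(1,2) B_without_measurable[OF that]] W_measurable[OF that(1,2)]
    unfolding shift_entry_def by (cases "(k, l) \<in> entry_pairs i j") auto
  have BM: "(\<lambda>\<omega>. B \<omega> k l) \<in> borel_measurable M" if "k < n" "l < n" for k l
    using B_measurable[OF that] .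
  have FM: "(\<lambda>\<omega>. F \<omega> (B \<omega>)) \<in> borel_measurable M" by (intro Fm BM u_measurable)
  have formM: "(\<lambda>\<omega>. res_form n (B \<omega>) z (?e i) (y \<omega>)) \<in> borel_measurable M" for i
    by (intro res_form_measurable BM yM) auto
  have formuM: "(\<lambda>\<omega>. res_form n (B \<omega>) z (?e i) (?e j)) \<in> borel_measurable M" for i j
    by (intro res_form_measurable BM) auto
  \<comment> \<open>D is an arbitrary function; it is measurable as a limit of difference quotients of F.\<close>
  have DM: "(\<lambda>\<omega>. D \<omega> (B \<omega>) i j) \<in> borel_measurable M" if ij: "i < n" "j < n" for i j
  proof (rule measurable_vector_derivative[where f = "\<lambda>\<omega> t. F \<omega> (?S i j \<omega> t)" and t = "\<lambda>\<omega>. a * W i j \<omega>"])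
    show "((\<lambda>t. F \<omega> (?S i j \<omega> t)) has_vector_derivative D \<omega> (B \<omega>) i j) (at (a * W i j \<omega>))"
      if "\<omega> \<in> space M" for \<omega>
      using observableD(4)[OF F[OF that] symm_B_without[OF that] ij, of i j "a * W i j \<omega>"]
      by (simp add: B_eq_shift[OF ij that])
    show "(\<lambda>\<omega>. F \<omega> (?S i j \<omega> (a * W i j \<omega> + h))) \<in> borel_measurable M" for h
      by (intro Fm SM u_measurable ij)
  qed
  have gM: "g i j \<in> borel_measurable M" if ij: "i < n" "j < n" for i j
    unfolding g_def form_deriv_def case_prod_unfold
    using xM[OF ij(1)] formM formuM FM DM[OF ij] by measurable
  have hM: "h i j \<in> borel_measurable M" if ij: "i < n" for i j
    unfolding h_def using xM[OF ij(1)] formM formuM FM by measurable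
  have feq: "f i j \<omega> (a * W i j \<omega>) = of_real (x \<omega> i) * (res_form n (B \<omega>) z (?e j) (y \<omega>) * F \<omega> (B \<omega>))"
    if "i < n" "j < n" "\<omega> \<in> space M" for i j \<omega>
    by (simp add: f_def B_eq_shift[OF that])
  have sm: "smooth_bound 3 (8 * form_const z 3 * C * \<bar>x \<omega> i\<bar>) (f i j \<omega>)"
    "(f i j \<omega> has_vector_derivative g i j \<omega>) (at (a * W i j \<omega>))"
    if ij: "i < n" "j < n" and \<omega>: "\<omega> \<in> space M" for i j \<omega>
  proof -
    note s = smooth_bound_form_times_observable[OF F[OF \<omega>] symm_B_without[OF \<omega>, of i j] z ij yb[OF \<omega>]]
    show "smooth_bound 3 (8 * form_const z 3 * C * \<bar>x \<omega> i\<bar>) (f i j \<omega>)"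
      unfolding f_def by (rule s(1))
    show "(f i j \<omega> has_vector_derivative g i j \<omega>) (at (a * W i j \<omega>))"
      using s(2)[where r = "x \<omega> i" and t = "a * W i j \<omega>"]
      unfolding f_def g_def by (simp only: B_eq_shift[OF ij \<omega>])
  qed
  have fR: "(\<lambda>\<omega>. f i j \<omega> t) \<in> borel_measurable (R i j)" if ij: "i < n" "j < n" for i j t
  proof -
    have "(\<lambda>\<omega>. res_form n (?S i j \<omega> t) z (?e j) (y \<omega>)) \<in> borel_measurable (R i j)"
      by (intro res_form_measurable SR y ij) auto
    moreover have "(\<lambda>\<omega>. F \<omega> (?S i j \<omega> t)) \<in> borel_measurable (R i j)"
      by (intro Fm SR u_rest ij)
    ultimately show ?thesis unfolding f_def using x[OF ij ij(1)] by measurable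
  qed
  have fM: "(\<lambda>\<omega>. f i j \<omega> (a * W i j \<omega>)) \<in> borel_measurable M" if ij: "i < n" "j < n" for i j
  proof -
    have "(\<lambda>\<omega>. of_real (x \<omega> i) * (res_form n (B \<omega>) z (?e j) (y \<omega>) * F \<omega> (B \<omega>))) \<in> borel_measurable M"
      using xM[OF ij(1)] formM FM by measurable
    then show ?thesis by (subst measurable_cong[OF feq]) (use ij in auto)
  qed
  have x1: "\<bar>x \<omega> i\<bar> \<le> 1" if "i < n" "\<omega> \<in> space M" for i \<omega>
    using in_unit_ball_abs_le[OF xb[OF that(2)] that(1)] .
  let ?E = "\<lambda>i j. (LINT \<omega>|M. of_real (W i j \<omega>) * f i j \<omega> (a * W i j \<omega>))"
  have bp: "cmod (?E i j - of_real (a * \<sigma> i j) * (LINT \<omega>|M. g i j \<omega>)) \<le>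
     2 * a ^ 3 * (8 * form_const z 3 * C) * K * expectation (\<lambda>\<omega>. \<bar>x \<omega> i\<bar>)" if ij: "i < n" "j < n" for i j
    unfolding \<sigma>_def
  proof (rule expectation_by_parts[OF indep[OF ij] W_integrable[OF ij] W_1[OF ij] W_3[OF ij] W_4[OF ij] W_22[OF ij]])
    show "(\<lambda>\<omega>. \<bar>x \<omega> i\<bar>) \<in> borel_measurable (R i j)" using x[OF ij ij(1)] by measurable
  qed (use a_pos c3 C0 x1 sm ij fR fM gM in auto)
  have iE: "integrable M (\<lambda>\<omega>. of_real (W i j \<omega>) * f i j \<omega> (a * W i j \<omega>))" if ij: "i < n" "j < n" for i j
  proof (rule Bochner_Integration.integrable_bound)
    show "integrable M (\<lambda>\<omega>. (8 * form_const z 3 * C) * W i j \<omega>)"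
      using W_integrable[OF ij, of 1] by simp
    show "(\<lambda>\<omega>. of_real (W i j \<omega>) * f i j \<omega> (a * W i j \<omega>)) \<in> borel_measurable M"
      using fM[OF ij] W_measurable[OF ij] by measurable
    show "AE \<omega> in M. norm (of_real (W i j \<omega>) * f i j \<omega> (a * W i j \<omega>)) \<le> norm ((8 * form_const z 3 * C) * W i j \<omega>)"
    proof (intro AE_I2)
      fix \<omega> assume \<omega>: "\<omega> \<in> space M"
      have "cmod (f i j \<omega> (a * W i j \<omega>)) \<le> 8 * form_const z 3 * C * \<bar>x \<omega> i\<bar>"
        using smooth_bound_norm[OF sm(1)[OF ij \<omega>]] .
      also have "\<dots> \<le> 8 * form_const z 3 * C"
        using x1[OF ij(1) \<omega>] c3 C0 by (intro mult_left_le) auto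
      finally show "norm (of_real (W i j \<omega>) * f i j \<omega> (a * W i j \<omega>)) \<le> norm ((8 * form_const z 3 * C) * W i j \<omega>)"
        using c3 C0 by (simp add: norm_mult abs_mult mult.commute mult_left_mono)
    qed
  qed
  have bnd: "cmod (res_form n (B \<omega>) z (?e i) (y \<omega>)) \<le> ?c" "cmod (res_form n (B \<omega>) z (?e i) (?e j)) \<le> ?c"
    "cmod (F \<omega> (B \<omega>)) \<le> C" if "\<omega> \<in> space M" for i j \<omega>
    using that by (auto intro!: res_form_bound symm_B z yb observableD(1)[OF F] simp del: divide_inverse)
  have Dsq: "(\<Sum>i<n. \<Sum>j<n. (cmod (D \<omega> (B \<omega>) i j))\<^sup>2) \<le> C\<^sup>2" if "\<omega> \<in> space M" for \<omega>
    using observableD(2)[OF F[OF that] symm_B[OF that]] .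
  have Db: "cmod (D \<omega> (B \<omega>) i j) \<le> C" if ij: "i < n" "j < n" and \<omega>: "\<omega> \<in> space M" for i j \<omega>
  proof -
    have "(cmod (D \<omega> (B \<omega>) i j))\<^sup>2 \<le> (\<Sum>j<n. (cmod (D \<omega> (B \<omega>) i j))\<^sup>2)"
      using ij by (intro member_le_sum[of j "{..<n}" "\<lambda>j. (cmod (D \<omega> (B \<omega>) i j))\<^sup>2"]) auto
    also have "\<dots> \<le> (\<Sum>i<n. \<Sum>j<n. (cmod (D \<omega> (B \<omega>) i j))\<^sup>2)"
      using ij by (intro member_le_sum[of i "{..<n}" "\<lambda>i. \<Sum>j<n. (cmod (D \<omega> (B \<omega>) i j))\<^sup>2"]) (auto intro: sum_nonneg)
    also have "\<dots> \<le> C\<^sup>2" by (rule Dsq[OF \<omega>])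
    finally show ?thesis using C0 by (rule power2_le_imp_le)
  qed
  have ig: "integrable M (g i j)" if ij: "i < n" "j < n" for i j
  proof (rule integrable_bounded[where C = "1 * (?c * C + (?c * ?c + ?c * ?c) * C)"])
    fix \<omega> assume \<omega>: "\<omega> \<in> space M"
    have "cmod (form_deriv n (B \<omega>) z (?e j) (y \<omega>) i j) \<le> ?c * ?c + ?c * ?c"
      using c by (intro order_trans[OF form_deriv_norm] add_mono mult_mono bnd \<omega>) auto
    then show "cmod (g i j \<omega>) \<le> 1 * (?c * C + (?c * ?c + ?c * ?c) * C)"
      unfolding g_def norm_mult[of "of_real (x \<omega> i)"] norm_of_real
      using c C0 by (intro mult_mono x1 ij \<omega> order_trans[OF norm_triangle_ineq])
         (auto simp: norm_mult simp del: times_divide_eq_left times_divide_eq_right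
           intro!: add_mono mult_mono bnd Db ij \<omega> add_nonneg_nonneg mult_nonneg_nonneg)
  qed (rule gM[OF ij])
  have ih: "integrable M (h i j)" if ij: "i < n" for i j
  proof (rule integrable_bounded[where C = "1 * (?c * ?c * C)"])
    fix \<omega> assume \<omega>: "\<omega> \<in> space M"
    show "cmod (h i j \<omega>) \<le> 1 * (?c * ?c * C)"
      unfolding h_def norm_mult norm_of_real using c C0
      by (intro mult_mono x1 ij \<omega> bnd) (auto intro!: mult_nonneg_nonneg)
  qed (rule hM[OF ij])
  have "(LINT \<omega>|M. (\<Sum>i<n. \<Sum>j<n. of_real (x \<omega> i) *
          (of_real (a * W i j \<omega>) * res_form n (B \<omega>) z (?e j) (y \<omega>))) * F \<omega> (B \<omega>)) =
     (LINT \<omega>|M. (\<Sum>i<n. \<Sum>j<n. of_real a * (of_real (W i j \<omega>) * f i j \<omega> (a * W i j \<omega>))))"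
    by (intro Bochner_Integration.integral_cong refl) (simp add: feq sum_distrib_left mult_ac)
  also have "\<dots> = (\<Sum>i<n. \<Sum>j<n. of_real a * ?E i j)"
    by (subst integral_double_sum) (auto intro!: integrable_mult_right iE)
  finally have L: "(LINT \<omega>|M. (\<Sum>i<n. \<Sum>j<n. of_real (x \<omega> i) *
          (of_real (a * W i j \<omega>) * res_form n (B \<omega>) z (?e j) (y \<omega>))) * F \<omega> (B \<omega>)) =
     (\<Sum>i<n. \<Sum>j<n. of_real a * ?E i j)" .
  have S': "res_trace n (B \<omega>) z * res_form n (B \<omega>) z (x \<omega>) (y \<omega>) * F \<omega> (B \<omega>) =
     (\<Sum>i<n. \<Sum>j<n. of_real (a\<^sup>2) * h i j \<omega>)" for \<omega>
  proof -
    have an: "1 / of_nat n = complex_of_real (a\<^sup>2)" using n by (simp add: a_def power_divide)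
    have "res_trace n (B \<omega>) z * res_form n (B \<omega>) z (x \<omega>) (y \<omega>) * F \<omega> (B \<omega>) =
      of_real (a\<^sup>2) * ((\<Sum>i<n. of_real (x \<omega> i) * res_form n (B \<omega>) z (?e i) (y \<omega>)) *
        (\<Sum>p<n. res_form n (B \<omega>) z (?e p) (?e p)) * F \<omega> (B \<omega>))"
      unfolding res_form_expand_left[of n "B \<omega>" z "x \<omega>"] res_trace_def an[symmetric] by simp
    also have "\<dots> = (\<Sum>i<n. \<Sum>j<n. of_real (a\<^sup>2) * h i j \<omega>)"
      unfolding sum_product by (simp add: h_def sum_distrib_left mult_ac)
    finally show ?thesis .
  qed
  have S: "(LINT \<omega>|M. res_trace n (B \<omega>) z * res_form n (B \<omega>) z (x \<omega>) (y \<omega>) * F \<omega> (B \<omega>)) =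
     (\<Sum>i<n. \<Sum>j<n. of_real (a\<^sup>2) * (LINT \<omega>|M. h i j \<omega>))"
    unfolding S' by (subst integral_double_sum) (auto intro!: integrable_mult_right ih)
  let ?M = "\<lambda>\<omega>. \<Sum>i<n. \<Sum>j<n. of_real (\<sigma> i j) * g i j \<omega> + h i j \<omega>"
  have iM: "integrable M ?M" using ig ih by (intro Bochner_Integration.integrable_sum Bochner_Integration.integrable_add integrable_mult_right) auto
  have EM: "(LINT \<omega>|M. ?M \<omega>) = (\<Sum>i<n. \<Sum>j<n. of_real (\<sigma> i j) * (LINT \<omega>|M. g i j \<omega>) + (LINT \<omega>|M. h i j \<omega>))"
    using ig ih by (subst integral_double_sum) (auto intro!: sum.cong)
  \<comment> \<open>The first sum collects the Taylor remainders, the second the explicit terms.\<close>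
  have eq: "(\<Sum>i<n. \<Sum>j<n. of_real a * ?E i j) + (\<Sum>i<n. \<Sum>j<n. of_real (a\<^sup>2) * (LINT \<omega>|M. h i j \<omega>)) =
     of_real a * (\<Sum>i<n. \<Sum>j<n. ?E i j - of_real (a * \<sigma> i j) * (LINT \<omega>|M. g i j \<omega>)) + of_real (a\<^sup>2) * (LINT \<omega>|M. ?M \<omega>)"
    unfolding EM by (simp add: sum.distrib sum_subtractf sum_distrib_left algebra_simps power2_eq_square)
  let ?Q = "K * C / Im z + C / (Im z)\<^sup>2 + (K + 1) * C / (Im z)\<^sup>2"
  have "cmod (LINT \<omega>|M. ?M \<omega>) \<le> (LINT \<omega>|M. ?Q * sqrt (real n))"
  proof (rule norm_integral_le[OF iM])
    fix \<omega> assume \<omega>: "\<omega> \<in> space M"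
    show "cmod (?M \<omega>) \<le> ?Q * sqrt (real n)"
      unfolding g_def h_def
      by (rule main_term_bound[OF symm_B[OF \<omega>] z xb[OF \<omega>] yb[OF \<omega>] n bnd(3)[OF \<omega>] Dsq[OF \<omega>] K \<sigma>])
  qed simp
  then have b2: "cmod (LINT \<omega>|M. ?M \<omega>) \<le> ?Q * sqrt (real n)" by (simp add: prob_space)
  have ix: "integrable M (\<lambda>\<omega>. \<bar>x \<omega> i\<bar>)" if "i < n" for i
    by (rule integrable_const_bound[where B = 1]) (use x1 that xM in auto)
  have "(\<Sum>i<n. expectation (\<lambda>\<omega>. \<bar>x \<omega> i\<bar>)) = expectation (\<lambda>\<omega>. \<Sum>i<n. \<bar>x \<omega> i\<bar>)"
    using ix by (intro Bochner_Integration.integral_sum[symmetric]) auto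
  also have "\<dots> \<le> expectation (\<lambda>\<omega>. sqrt (real n))"
    using ix by (intro integral_mono sum_abs_le_sqrt xb Bochner_Integration.integrable_sum) auto
  finally have Ex: "(\<Sum>i<n. expectation (\<lambda>\<omega>. \<bar>x \<omega> i\<bar>)) \<le> sqrt (real n)" by (simp add: prob_space)
  have "cmod (\<Sum>i<n. \<Sum>j<n. ?E i j - of_real (a * \<sigma> i j) * (LINT \<omega>|M. g i j \<omega>)) \<le>
     (\<Sum>i<n. \<Sum>j<n. 2 * a ^ 3 * (8 * form_const z 3 * C) * K * expectation (\<lambda>\<omega>. \<bar>x \<omega> i\<bar>))"
    by (intro sum_norm_le bp) auto
  also have "\<dots> = 2 * a ^ 3 * (8 * form_const z 3 * C) * K * real n * (\<Sum>i<n. expectation (\<lambda>\<omega>. \<bar>x \<omega> i\<bar>))"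
    by (simp add: sum_distrib_left mult_ac)
  also have "\<dots> \<le> 2 * a ^ 3 * (8 * form_const z 3 * C) * K * real n * sqrt (real n)"
    using Ex a_pos c3 C0 K by (intro mult_left_mono) auto
  finally have b1: "cmod (\<Sum>i<n. \<Sum>j<n. ?E i j - of_real (a * \<sigma> i j) * (LINT \<omega>|M. g i j \<omega>)) \<le>
     2 * a ^ 3 * (8 * form_const z 3 * C) * K * real n * sqrt (real n)" .
  have "cmod (of_real a * (\<Sum>i<n. \<Sum>j<n. ?E i j - of_real (a * \<sigma> i j) * (LINT \<omega>|M. g i j \<omega>)) + of_real (a\<^sup>2) * (LINT \<omega>|M. ?M \<omega>))
     \<le> a * (2 * a ^ 3 * (8 * form_const z 3 * C) * K * real n * sqrt (real n)) + a\<^sup>2 * (?Q * sqrt (real n))"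
    using b1 b2 a_pos
    by (intro order_trans[OF norm_triangle_ineq] add_mono) (auto simp: norm_mult norm_power intro!: mult_left_mono)
  also have "\<dots> = 16 * form_const z 3 * C * K * (a * a ^ 3 * (real n * sqrt (real n))) + ?Q * (a\<^sup>2 * sqrt (real n))"
    by (simp add: algebra_simps)
  also have "\<dots> = (16 * form_const z 3 * C * K + ?Q) * a"
    unfolding a4 a_sqrt by (simp only: distrib_right)
  finally show ?thesis unfolding L S eq .
qed

end

lemma borel_measurable_cnj_compose [measurable (raw)]:
  "f \<in> borel_measurable M \<Longrightarrow> (\<lambda>x. cnj (f x)) \<in> borel_measurable M"
  by (rule measurable_compose[OF _ borel_measurable_continuous_onI]) (auto intro: continuous_intros)

lemma integral_sum_pairs:
  fixes A G :: "nat \<Rightarrow> 'a \<Rightarrow> complex"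
  assumes "\<And>p. p < n \<Longrightarrow> integrable M (A p)" "\<And>p. p < n \<Longrightarrow> integrable M (G p)" "integrable M g"
  shows "(LINT x|M. ((\<Sum>p<n. A p x + G p x) + t * g x) / c) =
    ((\<Sum>p<n. (LINT x|M. A p x) + (LINT x|M. G p x)) + t * (LINT x|M. g x)) / c"
proof -
  have "integrable M (\<lambda>x. \<Sum>p<n. A p x + G p x)"
    using assms by (intro Bochner_Integration.integrable_sum Bochner_Integration.integrable_add) auto
  moreover have "(LINT x|M. (\<Sum>p<n. A p x + G p x)) = (\<Sum>p<n. (LINT x|M. A p x) + (LINT x|M. G p x))"
    using assms by (subst Bochner_Integration.integral_sum) auto
  ultimately show ?thesis using assms(3) by simp
qed

context spiked_wigner
begin

text \<open>
  This is \<open>x\<^sup>T (B - z) (B - z)\<^sup>-\<^sup>1 y = x\<^sup>T y\<close>, solved for the contribution of the noise.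
\<close>

lemma quadratic_form_eq:
  assumes "\<omega> \<in> space M" "Im z > 0"
  shows "(\<Sum>i<n. \<Sum>j<n. of_real (x i) * (of_real (a * W i j \<omega>) * res_form n (B \<omega>) z (unit_vec_fun j) y)) =
    of_real (\<Sum>i<n. x i * y i) + z * res_form n (B \<omega>) z x y -
    of_real (\<theta> * (\<Sum>i<n. x i * u \<omega> i)) * res_form n (B \<omega>) z (u \<omega>) y"
proof -
  let ?y = "\<lambda>j. res_form n (B \<omega>) z (unit_vec_fun j) y" and ?g = "res_form n (B \<omega>) z (u \<omega>) y"
  have row: "(\<Sum>j<n. of_real (a * W i j \<omega>) * ?y j) = of_real (y i) + z * ?y i - of_real (\<theta> * u \<omega> i) * ?g"
    if "i < n" for i
  proof -
    have "(\<Sum>j<n. of_real (a * W i j \<omega>) * ?y j) =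
       (\<Sum>j<n. of_real (B \<omega> i j) * ?y j - of_real (\<theta> * u \<omega> i) * (of_real (u \<omega> j) * ?y j))"
      by (intro sum.cong) (auto simp: B_def algebra_simps)
    also have "\<dots> = (\<Sum>j<n. of_real (B \<omega> i j) * ?y j) - of_real (\<theta> * u \<omega> i) * ?g"
      unfolding res_form_expand_left[of n "B \<omega>" z "u \<omega>" y] sum_distrib_left sum_subtractf ..
    finally show ?thesis using res_form_solves[OF symm_B[OF assms(1)] assms(2) that, of y]
      by (simp add: diff_eq_eq)
  qed
  have "(\<Sum>i<n. \<Sum>j<n. of_real (x i) * (of_real (a * W i j \<omega>) * ?y j)) =
     (\<Sum>i<n. of_real (x i) * (of_real (y i) + z * ?y i - of_real (\<theta> * u \<omega> i) * ?g))"
    by (intro sum.cong refl) (simp add: row sum_distrib_left[symmetric] del: of_real_mult)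
  also have "\<dots> = of_real (\<Sum>i<n. x i * y i) + z * (\<Sum>i<n. of_real (x i) * ?y i) -
     of_real (\<theta> * (\<Sum>i<n. x i * u \<omega> i)) * ?g"
    by (simp add: algebra_simps sum.distrib sum_subtractf sum_distrib_left)
  also have "(\<Sum>i<n. of_real (x i) * ?y i) = res_form n (B \<omega>) z x y"
    by (rule res_form_expand_left[symmetric])
  finally show ?thesis .
qed

lemma u_unit: "\<omega> \<in> space M \<Longrightarrow> in_unit_ball n (u \<omega>)"
  using u_norm by (simp add: in_unit_ball_def)

lemma res_trace_measurable:
  assumes "\<And>k l. k < n \<Longrightarrow> l < n \<Longrightarrow> (\<lambda>\<omega>. A \<omega> k l) \<in> borel_measurable N"
  shows "(\<lambda>\<omega>. res_trace n (A \<omega>) z) \<in> borel_measurable N"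
  unfolding res_trace_def
  by (intro borel_measurable_divide borel_measurable_sum res_form_measurable assms) auto

lemma res_trace_bound: "\<omega> \<in> space M \<Longrightarrow> Im z > 0 \<Longrightarrow> cmod (res_trace n (B \<omega>) z) \<le> 1 / Im z"
proof -
  assume *: "\<omega> \<in> space M" "Im z > 0"
  have "cmod (\<Sum>p<n. res_form n (B \<omega>) z (unit_vec_fun p) (unit_vec_fun p)) \<le> real (card {..<n}) * (1 / Im z)"
    using * by (intro sum_norm_bound res_form_bound symm_B) auto
  then show ?thesis using n by (simp add: res_trace_def norm_divide field_simps)
qed

definition err_const :: "complex \<Rightarrow> real \<Rightarrow> real" where
  "err_const z C = 16 * form_const z 3 * C * K + (K * C / Im z + C / (Im z)\<^sup>2 + (K + 1) * C / (Im z)\<^sup>2)"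

text \<open>
  The defects in the two self-consistent equations
  \<open>1 + z s + s\<^sup>2 = 0\<close> and \<open>1 + (z - \<theta>) g + s g = 0\<close> for the normalized trace \<open>s\<close> of the resolvent and
  its form \<open>g\<close> at the spike.
\<close>

definition trace_residual :: "complex \<Rightarrow> 'a \<Rightarrow> complex" where
  "trace_residual z \<omega> = 1 + z * res_trace n (B \<omega>) z + res_trace n (B \<omega>) z * res_trace n (B \<omega>) z"

definition form_residual :: "complex \<Rightarrow> 'a \<Rightarrow> complex" where
  "form_residual z \<omega> = 1 + (z - of_real \<theta>) * res_form n (B \<omega>) z (u \<omega>) (u \<omega>)
     + res_trace n (B \<omega>) z * res_form n (B \<omega>) z (u \<omega>) (u \<omega>)"

text \<open>
  The second moment of the residual is the expectation of the residual times its own conjugate.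
  The conjugate is itself an observable, so \<open>expectation_quadratic_form\<close> applies to the product and
  yields a bound on the second moment at once, in place of a bound on the mean followed by a
  concentration inequality. The term in \<open>\<theta>\<close> comes from the rank-one spike, whose effect on the
  normalized trace is \<open>O(1/n)\<close>.
\<close>

lemma trace_residual_bound:
  assumes z: "Im z > 0"
    and F: "\<And>\<omega>. \<omega> \<in> space M \<Longrightarrow> observable n C
      (\<lambda>B. cnj (1 + z * res_trace n B z + res_trace n B z * res_trace n B z)) (D \<omega>)"
  shows "expectation (\<lambda>\<omega>. (cmod (trace_residual z \<omega>))\<^sup>2) \<le> (err_const z C + \<bar>\<theta>\<bar> * C / Im z) * a"
proof -
  let ?e = unit_vec_fun
  let ?F = "\<lambda>\<omega> B. cnj (1 + z * res_trace n B z + res_trace n B z * res_trace n B z)"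
  let ?s = "\<lambda>\<omega>. res_trace n (B \<omega>) z" and ?X = "\<lambda>\<omega>. cnj (trace_residual z \<omega>)"
  let ?G = "\<lambda>p \<omega>. res_form n (B \<omega>) z (?e p) (?e p)"
  let ?H = "\<lambda>p \<omega>. of_real (\<theta> * u \<omega> p) * res_form n (B \<omega>) z (u \<omega>) (?e p)"
  have XF: "?F \<omega> (B \<omega>) = ?X \<omega>" for \<omega> by (simp add: trace_residual_def)
  obtain \<omega>0 where \<omega>0: "\<omega>0 \<in> space M" using not_empty by auto
  have Xb: "cmod (?X \<omega>) \<le> C" if "\<omega> \<in> space M" for \<omega>
    using observableD(1)[OF F[OF that] symm_B[OF that]] unfolding XF .
  have C0: "0 \<le> C" using order_trans[OF norm_ge_zero Xb[OF \<omega>0]] .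
  have sM: "?s \<in> borel_measurable M" by (intro res_trace_measurable B_measurable)
  have XM: "?X \<in> borel_measurable M"
    unfolding trace_residual_def using sM by measurable
  have GM: "?G p \<in> borel_measurable M" for p by (intro res_form_measurable B_measurable) auto
  have HM: "?H p \<in> borel_measurable M" if "p < n" for p
    using u_measurable[OF that] res_form_measurable[of "\<lambda>\<omega>. B \<omega>" M u "\<lambda>_. ?e p" z] B_measurable u_measurable
    by measurable
  \<comment> \<open>By the resolvent equation, A p is the quadratic form of the noise at the p-th unit vector.\<close>
  let ?A = "\<lambda>p \<omega>. 1 + z * ?G p \<omega> - ?H p \<omega>"
  have Gb: "cmod (?G p \<omega>) \<le> 1 / Im z" "cmod (res_form n (B \<omega>) z (u \<omega>) (?e p)) \<le> 1 / Im z"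
     "cmod (res_form n (B \<omega>) z (u \<omega>) (u \<omega>)) \<le> 1 / Im z" if "\<omega> \<in> space M" for \<omega> p
    using that z by (auto intro!: res_form_bound symm_B u_unit simp del: divide_inverse)
  have ub: "\<bar>u \<omega> p\<bar> \<le> 1" if "\<omega> \<in> space M" "p < n" for \<omega> p
    using in_unit_ball_abs_le[OF u_unit] that by blast
  have iA: "integrable M (\<lambda>\<omega>. ?A p \<omega> * ?X \<omega>)" if p: "p < n" for p
  proof (rule integrable_bounded[where C = "(1 + cmod z * (1 / Im z) + \<bar>\<theta>\<bar> * 1 * (1 / Im z)) * C"])
    show "(\<lambda>\<omega>. ?A p \<omega> * ?X \<omega>) \<in> borel_measurable M" using GM HM[OF p] XM by measurable
    fix \<omega> assume \<omega>: "\<omega> \<in> space M"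
    have "cmod (?A p \<omega>) \<le> 1 + cmod z * (1 / Im z) + \<bar>\<theta>\<bar> * 1 * (1 / Im z)"
      by (intro order_trans[OF norm_triangle_ineq4] add_mono order_trans[OF norm_triangle_ineq])
         (auto simp: norm_mult abs_mult simp del: times_divide_eq_right mult_1_right
            intro!: mult_mono Gb \<omega> ub p mult_left_mono)
    then show "cmod (?A p \<omega> * ?X \<omega>) \<le> (1 + cmod z * (1 / Im z) + \<bar>\<theta>\<bar> * 1 * (1 / Im z)) * C"
      unfolding norm_mult[of "?A p \<omega>"] using Xb[OF \<omega>] z by (intro mult_mono) auto
  qed
  have iG: "integrable M (\<lambda>\<omega>. ?s \<omega> * ?G p \<omega> * ?X \<omega>)" for p
  proof (rule integrable_bounded[where C = "(1 / Im z) * (1 / Im z) * C"])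
    show "(\<lambda>\<omega>. ?s \<omega> * ?G p \<omega> * ?X \<omega>) \<in> borel_measurable M" using GM sM XM by measurable
    fix \<omega> assume \<omega>: "\<omega> \<in> space M"
    show "cmod (?s \<omega> * ?G p \<omega> * ?X \<omega>) \<le> (1 / Im z) * (1 / Im z) * C"
      unfolding norm_mult using Xb[OF \<omega>] z by (intro mult_mono Gb res_trace_bound \<omega>) auto
  qed
  have p: "cmod ((LINT \<omega>|M. ?A p \<omega> * ?X \<omega>) + (LINT \<omega>|M. ?s \<omega> * ?G p \<omega> * ?X \<omega>)) \<le> err_const z C * a"
    if p: "p < n" for p
  proof -
    have A: "?A p \<omega> = (\<Sum>i<n. \<Sum>j<n. of_real (?e p i) * (of_real (a * W i j \<omega>) * res_form n (B \<omega>) z (?e j) (?e p)))"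
      if "\<omega> \<in> space M" for \<omega>
    proof -
      have "(\<Sum>i<n. ?e p i * ?e p i) = (\<Sum>i<n. if i = p then 1 else 0)"
        "(\<Sum>i<n. ?e p i * u \<omega> i) = (\<Sum>i<n. if i = p then u \<omega> p else 0)"
        by (intro sum.cong refl, simp add: unit_vec_fun_def)+
      then show ?thesis using p unfolding quadratic_form_eq[OF that z] by simp
    qed
    have "(LINT \<omega>|M. ?A p \<omega> * ?X \<omega>) = (LINT \<omega>|M. (\<Sum>i<n. \<Sum>j<n. of_real (?e p i) *
        (of_real (a * W i j \<omega>) * res_form n (B \<omega>) z (?e j) (?e p))) * ?X \<omega>)"
      by (intro Bochner_Integration.integral_cong refl) (simp only: A)
    moreover have "cmod ((LINT \<omega>|M. (\<Sum>i<n. \<Sum>j<n. of_real (?e p i) *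
        (of_real (a * W i j \<omega>) * res_form n (B \<omega>) z (?e j) (?e p))) * ?F \<omega> (B \<omega>)) +
        (LINT \<omega>|M. ?s \<omega> * ?G p \<omega> * ?F \<omega> (B \<omega>))) \<le> err_const z C * a"
      unfolding err_const_def
    proof (rule expectation_quadratic_form[OF z _ _ _ _ F])
      fix N :: "'a measure" and A :: "'a \<Rightarrow> nat \<Rightarrow> nat \<Rightarrow> real"
      assume "\<And>k l. k < n \<Longrightarrow> l < n \<Longrightarrow> (\<lambda>\<omega>. A \<omega> k l) \<in> borel_measurable N"
      then have "(\<lambda>\<omega>. res_trace n (A \<omega>) z) \<in> borel_measurable N" by (rule res_trace_measurable)
      then show "(\<lambda>\<omega>. ?F \<omega> (A \<omega>)) \<in> borel_measurable N" by measurable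
    qed auto
    ultimately show ?thesis unfolding XF by simp
  qed
  let ?g = "\<lambda>\<omega>. res_form n (B \<omega>) z (u \<omega>) (u \<omega>)"
  have gM: "?g \<in> borel_measurable M" by (intro res_form_measurable B_measurable u_measurable)
  have ig: "integrable M (\<lambda>\<omega>. ?g \<omega> * ?X \<omega>)"
  proof (rule integrable_bounded[where C = "1 / Im z * C"])
    show "(\<lambda>\<omega>. ?g \<omega> * ?X \<omega>) \<in> borel_measurable M" using gM XM by measurable
    fix \<omega> assume \<omega>: "\<omega> \<in> space M"
    show "cmod (?g \<omega> * ?X \<omega>) \<le> 1 / Im z * C"
      unfolding norm_mult using Xb[OF \<omega>] z by (intro mult_mono Gb \<omega>) auto
  qed
  \<comment> \<open>Averaging over p turns the rank-one terms H into a single form divided by n.\<close>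
  have dec: "trace_residual z \<omega> * ?X \<omega> =
     ((\<Sum>p<n. ?A p \<omega> * ?X \<omega> + ?s \<omega> * ?G p \<omega> * ?X \<omega>) + of_real \<theta> * (?g \<omega> * ?X \<omega>)) / of_nat n"
    if \<omega>: "\<omega> \<in> space M" for \<omega>
  proof -
    have "res_form n (B \<omega>) z (u \<omega>) (?e p) = res_form n (B \<omega>) z (?e p) (u \<omega>)" for p
      by (rule res_form_symmetric[OF symm_B[OF \<omega>] z])
    then have "(\<Sum>p<n. ?H p \<omega>) = of_real \<theta> * ?g \<omega>"
      unfolding res_form_expand_left[of n "B \<omega>" z "u \<omega>" "u \<omega>"]
      by (simp add: sum_distrib_left mult.assoc)
    moreover have "(\<Sum>p<n. ?A p \<omega> + ?s \<omega> * ?G p \<omega>) + (\<Sum>p<n. ?H p \<omega>) = (\<Sum>p<n. 1 + (z + ?s \<omega>) * ?G p \<omega>)"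
      unfolding sum.distrib[symmetric] by (intro sum.cong refl) (simp add: algebra_simps)
    moreover have "(\<Sum>p<n. 1 + (z + ?s \<omega>) * ?G p \<omega>) = of_nat n + (z + ?s \<omega>) * (\<Sum>p<n. ?G p \<omega>)"
      unfolding sum.distrib sum_distrib_left by simp
    moreover have "(\<Sum>p<n. ?G p \<omega>) = of_nat n * ?s \<omega>"
      using n by (simp add: res_trace_def)
    ultimately have "trace_residual z \<omega> = ((\<Sum>p<n. ?A p \<omega> + ?s \<omega> * ?G p \<omega>) + of_real \<theta> * ?g \<omega>) / of_nat n"
      using n by (simp add: trace_residual_def field_simps)
    note T = this
    have mul: "T * X = ((\<Sum>p<n. A p * X + G p * X) + t * (g * X)) / of_nat n"
      if "T = ((\<Sum>p<n. A p + G p) + t * g) / of_nat n" for T X t g :: complex and A G :: "nat \<Rightarrow> complex"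
      using that by (simp add: sum_distrib_right distrib_right)
    show ?thesis by (rule mul[OF T])
  qed
  have "of_real (expectation (\<lambda>\<omega>. (cmod (trace_residual z \<omega>))\<^sup>2)) = (LINT \<omega>|M. trace_residual z \<omega> * ?X \<omega>)"
    by (simp add: complex_norm_square del: of_real_power flip: integral_complex_of_real)
  also have "\<dots> = (LINT \<omega>|M. ((\<Sum>p<n. ?A p \<omega> * ?X \<omega> + ?s \<omega> * ?G p \<omega> * ?X \<omega>) +
      of_real \<theta> * (?g \<omega> * ?X \<omega>)) / of_nat n)"
    by (rule Bochner_Integration.integral_cong[OF refl dec])
  also have "\<dots> = ((\<Sum>p<n. (LINT \<omega>|M. ?A p \<omega> * ?X \<omega>) + (LINT \<omega>|M. ?s \<omega> * ?G p \<omega> * ?X \<omega>)) +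
      of_real \<theta> * (LINT \<omega>|M. ?g \<omega> * ?X \<omega>)) / of_nat n"
    by (rule integral_sum_pairs[OF iA iG ig])
  finally have eq: "of_real (expectation (\<lambda>\<omega>. (cmod (trace_residual z \<omega>))\<^sup>2)) =
     ((\<Sum>p<n. (LINT \<omega>|M. ?A p \<omega> * ?X \<omega>) + (LINT \<omega>|M. ?s \<omega> * ?G p \<omega> * ?X \<omega>)) +
      of_real \<theta> * (LINT \<omega>|M. ?g \<omega> * ?X \<omega>)) / of_nat n" .
  have gX: "cmod (LINT \<omega>|M. ?g \<omega> * ?X \<omega>) \<le> 1 / Im z * C"
  proof -
    have "cmod (LINT \<omega>|M. ?g \<omega> * ?X \<omega>) \<le> (LINT \<omega>|M. 1 / Im z * C)"
    proof (rule norm_integral_le[OF ig])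
      fix \<omega> assume \<omega>: "\<omega> \<in> space M"
      show "cmod (?g \<omega> * ?X \<omega>) \<le> 1 / Im z * C"
        unfolding norm_mult using Xb[OF \<omega>] z by (intro mult_mono Gb \<omega>) auto
    qed simp
    then show ?thesis by (simp add: prob_space)
  qed
  have "cmod ((\<Sum>p<n. (LINT \<omega>|M. ?A p \<omega> * ?X \<omega>) + (LINT \<omega>|M. ?s \<omega> * ?G p \<omega> * ?X \<omega>)) +
      of_real \<theta> * (LINT \<omega>|M. ?g \<omega> * ?X \<omega>)) \<le> real n * (err_const z C * a) + \<bar>\<theta>\<bar> * (1 / Im z * C)"
  proof (intro order_trans[OF norm_triangle_ineq] add_mono)
    show "cmod (\<Sum>p<n. (LINT \<omega>|M. ?A p \<omega> * ?X \<omega>) + (LINT \<omega>|M. ?s \<omega> * ?G p \<omega> * ?X \<omega>)) \<le> real n * (err_const z C * a)"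
      using sum_norm_bound[of "{..<n}" "\<lambda>p. (LINT \<omega>|M. ?A p \<omega> * ?X \<omega>) + (LINT \<omega>|M. ?s \<omega> * ?G p \<omega> * ?X \<omega>)"
         "err_const z C * a"] p by simp
    show "cmod (of_real \<theta> * (LINT \<omega>|M. ?g \<omega> * ?X \<omega>)) \<le> \<bar>\<theta>\<bar> * (1 / Im z * C)"
      unfolding norm_mult norm_of_real by (intro mult_left_mono gX) auto
  qed
  then have "cmod (of_real (expectation (\<lambda>\<omega>. (cmod (trace_residual z \<omega>))\<^sup>2))) \<le>
     (real n * (err_const z C * a) + \<bar>\<theta>\<bar> * (1 / Im z * C)) / real n"
    unfolding eq norm_divide norm_of_nat by (intro divide_right_mono) auto
  also have "\<dots> = err_const z C * a + (\<bar>\<theta>\<bar> * C / Im z) * a\<^sup>2"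
    using n by (simp add: a_def power_divide add_divide_distrib)
  also have "\<dots> \<le> err_const z C * a + (\<bar>\<theta>\<bar> * C / Im z) * a"
    using a_pos a_le_1 C0 z by (intro add_left_mono mult_left_mono) (auto simp: power2_eq_square mult_left_le)
  finally show ?thesis by (simp add: distrib_right)
qed

text \<open>
  The same argument with both vectors equal to the spike.
\<close>

lemma form_residual_bound:
  assumes z: "Im z > 0"
    and F: "\<And>\<omega>. \<omega> \<in> space M \<Longrightarrow> observable n C
      (\<lambda>B. cnj (1 + (z - of_real \<theta>) * res_form n B z (u \<omega>) (u \<omega>) + res_trace n B z * res_form n B z (u \<omega>) (u \<omega>))) (D \<omega>)"
  shows "expectation (\<lambda>\<omega>. (cmod (form_residual z \<omega>))\<^sup>2) \<le> err_const z C * a"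
proof -
  let ?F = "\<lambda>\<omega> B. cnj (1 + (z - of_real \<theta>) * res_form n B z (u \<omega>) (u \<omega>) + res_trace n B z * res_form n B z (u \<omega>) (u \<omega>))"
  let ?s = "\<lambda>\<omega>. res_trace n (B \<omega>) z" and ?X = "\<lambda>\<omega>. cnj (form_residual z \<omega>)"
  let ?g = "\<lambda>\<omega>. res_form n (B \<omega>) z (u \<omega>) (u \<omega>)"
  have XF: "?F \<omega> (B \<omega>) = ?X \<omega>" for \<omega> by (simp add: form_residual_def)
  obtain \<omega>0 where \<omega>0: "\<omega>0 \<in> space M" using not_empty by auto
  have Xb: "cmod (?X \<omega>) \<le> C" if "\<omega> \<in> space M" for \<omega>
    using observableD(1)[OF F[OF that] symm_B[OF that]] unfolding XF .
  have C0: "0 \<le> C" using order_trans[OF norm_ge_zero Xb[OF \<omega>0]] .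
  have gM: "?g \<in> borel_measurable M" by (intro res_form_measurable B_measurable u_measurable)
  have sM: "?s \<in> borel_measurable M" by (intro res_trace_measurable B_measurable)
  have XM: "?X \<in> borel_measurable M" unfolding form_residual_def using sM gM by measurable
  have gb: "cmod (?g \<omega>) \<le> 1 / Im z" if "\<omega> \<in> space M" for \<omega>
    using that z by (auto intro!: res_form_bound symm_B u_unit simp del: divide_inverse)
  let ?A = "\<lambda>\<omega>. 1 + (z - of_real \<theta>) * ?g \<omega>"
  have iA: "integrable M (\<lambda>\<omega>. ?A \<omega> * ?X \<omega>)"
  proof (rule integrable_bounded[where C = "(1 + cmod (z - of_real \<theta>) * (1 / Im z)) * C"])
    show "(\<lambda>\<omega>. ?A \<omega> * ?X \<omega>) \<in> borel_measurable M" using gM XM by measurable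
    fix \<omega> assume \<omega>: "\<omega> \<in> space M"
    have "cmod (?A \<omega>) \<le> cmod 1 + cmod (z - of_real \<theta>) * cmod (?g \<omega>)"
      by (rule order_trans[OF norm_triangle_ineq]) (simp add: norm_mult)
    also have "\<dots> \<le> 1 + cmod (z - of_real \<theta>) * (1 / Im z)"
      using mult_left_mono[OF gb[OF \<omega>] norm_ge_zero[of "z - of_real \<theta>"]] by simp
    finally show "cmod (?A \<omega> * ?X \<omega>) \<le> (1 + cmod (z - of_real \<theta>) * (1 / Im z)) * C"
      unfolding norm_mult[of "?A \<omega>"] using Xb[OF \<omega>] z by (intro mult_mono) auto
  qed
  have iG: "integrable M (\<lambda>\<omega>. ?s \<omega> * ?g \<omega> * ?X \<omega>)"
  proof (rule integrable_bounded[where C = "(1 / Im z) * (1 / Im z) * C"])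
    show "(\<lambda>\<omega>. ?s \<omega> * ?g \<omega> * ?X \<omega>) \<in> borel_measurable M" using gM sM XM by measurable
    fix \<omega> assume \<omega>: "\<omega> \<in> space M"
    show "cmod (?s \<omega> * ?g \<omega> * ?X \<omega>) \<le> (1 / Im z) * (1 / Im z) * C"
      unfolding norm_mult using Xb[OF \<omega>] z by (intro mult_mono gb res_trace_bound \<omega>) auto
  qed
  have A: "?A \<omega> = (\<Sum>i<n. \<Sum>j<n. of_real (u \<omega> i) * (of_real (a * W i j \<omega>) * res_form n (B \<omega>) z (unit_vec_fun j) (u \<omega>)))"
    if "\<omega> \<in> space M" for \<omega>
    unfolding quadratic_form_eq[OF that z] using u_norm[OF that] by (simp add: power2_eq_square algebra_simps)
  have "(LINT \<omega>|M. ?A \<omega> * ?X \<omega>) = (LINT \<omega>|M. (\<Sum>i<n. \<Sum>j<n. of_real (u \<omega> i) *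
      (of_real (a * W i j \<omega>) * res_form n (B \<omega>) z (unit_vec_fun j) (u \<omega>))) * ?X \<omega>)"
    by (intro Bochner_Integration.integral_cong refl) (simp only: A)
  moreover have "cmod ((LINT \<omega>|M. (\<Sum>i<n. \<Sum>j<n. of_real (u \<omega> i) *
      (of_real (a * W i j \<omega>) * res_form n (B \<omega>) z (unit_vec_fun j) (u \<omega>))) * ?F \<omega> (B \<omega>)) +
      (LINT \<omega>|M. ?s \<omega> * ?g \<omega> * ?F \<omega> (B \<omega>))) \<le> err_const z C * a"
    unfolding err_const_def
  proof (rule expectation_quadratic_form[OF z _ _ _ _ F])
    fix N :: "'a measure" and A :: "'a \<Rightarrow> nat \<Rightarrow> nat \<Rightarrow> real"
    assume *: "\<And>k l. k < n \<Longrightarrow> l < n \<Longrightarrow> (\<lambda>\<omega>. A \<omega> k l) \<in> borel_measurable N"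
      "\<And>k. k < n \<Longrightarrow> (\<lambda>\<omega>. u \<omega> k) \<in> borel_measurable N"
    have "(\<lambda>\<omega>. res_trace n (A \<omega>) z) \<in> borel_measurable N" by (rule res_trace_measurable[OF *(1)])
    moreover have "(\<lambda>\<omega>. res_form n (A \<omega>) z (u \<omega>) (u \<omega>)) \<in> borel_measurable N"
      by (rule res_form_measurable[OF *(1) *(2) *(2)])
    ultimately show "(\<lambda>\<omega>. ?F \<omega> (A \<omega>)) \<in> borel_measurable N" by measurable
  qed (auto intro: u_rest u_unit)
  ultimately have p: "cmod ((LINT \<omega>|M. ?A \<omega> * ?X \<omega>) + (LINT \<omega>|M. ?s \<omega> * ?g \<omega> * ?X \<omega>)) \<le> err_const z C * a"
    unfolding XF by simp
  have "of_real (expectation (\<lambda>\<omega>. (cmod (form_residual z \<omega>))\<^sup>2)) = (LINT \<omega>|M. form_residual z \<omega> * ?X \<omega>)"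
    by (simp add: complex_norm_square del: of_real_power flip: integral_complex_of_real)
  also have "\<dots> = (LINT \<omega>|M. ?A \<omega> * ?X \<omega> + ?s \<omega> * ?g \<omega> * ?X \<omega>)"
    by (simp add: form_residual_def distrib_right)
  also have "\<dots> = (LINT \<omega>|M. ?A \<omega> * ?X \<omega>) + (LINT \<omega>|M. ?s \<omega> * ?g \<omega> * ?X \<omega>)"
    by (rule Bochner_Integration.integral_add[OF iA iG])
  finally have "cmod (of_real (expectation (\<lambda>\<omega>. (cmod (form_residual z \<omega>))\<^sup>2))) \<le> err_const z C * a"
    using p by simp
  then show ?thesis by simp
qed

end

text \<open>
  The constant does not depend on the size, because both conjugated residuals are built from
  uniform observables.
\<close>

lemma residuals_small:
  assumes z: "Im z > 0"
  shows "\<exists>C. \<forall>(M :: 'a measure) n W u R. spiked_wigner M n W u R K \<longrightarrow>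
    (LINT \<omega>|M. (cmod (spiked_wigner.trace_residual n W u \<theta> z \<omega>))\<^sup>2) \<le> C / sqrt (real n) \<and>
    (LINT \<omega>|M. (cmod (spiked_wigner.form_residual n W u \<theta> z \<omega>))\<^sup>2) \<le> C / sqrt (real n)"
proof -
  have t: "uniform_observable (\<lambda>n u B. cnj (1 + z * res_trace n B z + res_trace n B z * res_trace n B z))"
    by (intro uniform_observable_cnj uniform_observable_add uniform_observable_mult
        uniform_observable_const uniform_observable_trace z)
  have f: "uniform_observable (\<lambda>n u B. cnj (1 + (z - of_real \<theta>) * res_form n B z u u + res_trace n B z * res_form n B z u u))"
    by (intro uniform_observable_cnj uniform_observable_add uniform_observable_mult
        uniform_observable_const uniform_observable_trace uniform_observable_form z)
  let ?F = "\<lambda>n (u :: nat \<Rightarrow> real) B. cnj (1 + z * res_trace n B z + res_trace n B z * res_trace n B z)"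
  let ?G = "\<lambda>n u B. cnj (1 + (z - of_real \<theta>) * res_form n B z u u + res_trace n B z * res_form n B z u u)"
  from t[unfolded uniform_observable_def] obtain C1 where
    C1: "\<forall>n>0. \<forall>u. in_unit_ball n u \<longrightarrow> (\<exists>D. observable n C1 (?F n u) D)" by (elim exE)
  from f[unfolded uniform_observable_def] obtain C2 where
    C2: "\<forall>n>0. \<forall>u. in_unit_ball n u \<longrightarrow> (\<exists>D. observable n C2 (?G n u) D)" by (elim exE)
  let ?c = "\<lambda>C. 16 * form_const z 3 * C * K + (K * C / Im z + C / (Im z)\<^sup>2 + (K + 1) * C / (Im z)\<^sup>2)"
  let ?C = "max (?c C1 + \<bar>\<theta>\<bar> * C1 / Im z) (?c C2)"
  have "(LINT \<omega>|M. (cmod (spiked_wigner.trace_residual n W u \<theta> z \<omega>))\<^sup>2) \<le> ?C / sqrt (real n) \<and>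
    (LINT \<omega>|M. (cmod (spiked_wigner.form_residual n W u \<theta> z \<omega>))\<^sup>2) \<le> ?C / sqrt (real n)"
    if "spiked_wigner M n W u R K" for M :: "'a measure" and n W u R
  proof -
    interpret spiked_wigner M n W u R K \<theta> by (rule that)
    have "\<forall>\<omega>\<in>space M. \<exists>D. observable n C1 (?F n (u \<omega>)) D"
      using C1[rule_format, OF n u_unit] by (intro ballI)
    from bchoice[OF this] obtain D1 where D1: "\<forall>\<omega>\<in>space M. observable n C1 (?F n (u \<omega>)) (D1 \<omega>)" by (elim exE)
    have "\<forall>\<omega>\<in>space M. \<exists>D. observable n C2 (?G n (u \<omega>)) D"
      using C2[rule_format, OF n u_unit] by (intro ballI)
    from bchoice[OF this] obtain D2 where D2: "\<forall>\<omega>\<in>space M. observable n C2 (?G n (u \<omega>)) (D2 \<omega>)" by (elim exE)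
    have "(LINT \<omega>|M. (cmod (trace_residual z \<omega>))\<^sup>2) \<le> ?C * a"
      by (rule order_trans[OF trace_residual_bound[OF z bspec[OF D1]]])
         (use a_pos in \<open>auto simp: err_const_def intro!: mult_right_mono\<close>)
    moreover have "(LINT \<omega>|M. (cmod (form_residual z \<omega>))\<^sup>2) \<le> ?C * a"
      by (rule order_trans[OF form_residual_bound[OF z bspec[OF D2]]])
         (use a_pos in \<open>auto simp: err_const_def intro!: mult_right_mono\<close>)
    ultimately show ?thesis by (simp add: a_def)
  qed
  then show ?thesis by blast
qed

section \<open>Independence of one entry from everything else\<close>

definition preimages :: "'a measure \<Rightarrow> 'b measure \<Rightarrow> ('a \<Rightarrow> 'b) \<Rightarrow> 'a set set" where
  "preimages P N X = {X -` A \<inter> space P | A. A \<in> sets N}"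

lemma preimagesI: "A \<in> sets N \<Longrightarrow> S = X -` A \<inter> space P \<Longrightarrow> S \<in> preimages P N X"
  unfolding preimages_def by blast

lemma Int_stable_preimages: "Int_stable (preimages P N X)"
proof (rule Int_stableI)
  fix a b assume "a \<in> preimages P N X" "b \<in> preimages P N X"
  then obtain A B where "A \<in> sets N" "a = X -` A \<inter> space P" "B \<in> sets N" "b = X -` B \<inter> space P"
    by (auto simp: preimages_def)
  then have "a \<inter> b = X -` (A \<inter> B) \<inter> space P" "A \<inter> B \<in> sets N" by auto
  then show "a \<inter> b \<in> preimages P N X" unfolding preimages_def by blast
qed

lemma coordinate_event:
  assumes "i \<in> I" "A \<in> sets borel"
  shows "{x \<in> space (Pi\<^sub>M I (\<lambda>_. borel)). x i \<in> A} \<in> sets (Pi\<^sub>M I (\<lambda>_. borel))"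
proof -
  have "(\<lambda>x. x i) -` A \<inter> space (Pi\<^sub>M I (\<lambda>_. borel)) \<in> sets (Pi\<^sub>M I (\<lambda>_. borel))"
    by (rule measurable_sets[OF measurable_component_singleton[OF assms(1)] assms(2)])
  moreover have "(\<lambda>x. x i) -` A \<inter> space (Pi\<^sub>M I (\<lambda>_. borel)) = {x \<in> space (Pi\<^sub>M I (\<lambda>_. borel)). x i \<in> A}"
    by auto
  ultimately show ?thesis by simp
qed

text \<open>
  The independent ingredients of the model: the vector (\<open>None\<close>) and the entries on and above the
  diagonal (\<open>Some p\<close>), each represented by the events that it generates.
\<close>

definition source :: "'a measure \<Rightarrow> nat \<Rightarrow> (nat \<Rightarrow> nat \<Rightarrow> 'a \<Rightarrow> real) \<Rightarrow> (nat \<Rightarrow> 'a \<Rightarrow> real) \<Rightarrow>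
    (nat \<times> nat) option \<Rightarrow> 'a set set" where
  "source P n W u q = (case q of
     None \<Rightarrow> preimages P (Pi\<^sub>M {..<n} (\<lambda>_. borel)) (\<lambda>\<omega>. \<lambda>i\<in>{..<n}. u i \<omega>)
   | Some p \<Rightarrow> preimages P borel (W (fst p) (snd p)))"

definition sources :: "nat \<Rightarrow> (nat \<times> nat) option set" where
  "sources n = insert None (Some ` upper_pairs n)"

text \<open>
  Independence of the entries among themselves combines with independence of the whole matrix
  from the vector: an intersection of entry events is one event of the matrix.
\<close>

lemma (in prob_space) indep_sources:
  assumes W: "indep_vars (\<lambda>_. borel) (\<lambda>(i, j). W i j) (upper_pairs n)"
    and ind: "indep_mat_vec M n W u"
  shows "indep_sets (source M n W u) (sources n)"
proof (rule indep_setsI)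
  let ?mat = "\<lambda>\<omega>. \<lambda>(i, j)\<in>{..<n} \<times> {..<n}. W i j \<omega>"
  let ?P = "Pi\<^sub>M ({..<n} \<times> {..<n}) (\<lambda>_. borel) :: (nat \<times> nat \<Rightarrow> real) measure"
  \<comment> \<open>Split a finite subfamily into its matrix part K and, possibly, the vector.\<close>
  have iW: "indep_sets (\<lambda>p. source M n W u (Some p)) (upper_pairs n)"
    using W unfolding indep_vars_def2 by (simp add: source_def preimages_def case_prod_unfold)
  have iS: "indep_set (preimages M ?P ?mat) (source M n W u None)"
    using ind by (simp add: indep_mat_vec_def preimages_def source_def)
  show "source M n W u i \<subseteq> events" if "i \<in> sources n" for i
  proof (cases i)
    case None
    then show ?thesis using iS unfolding indep_set_def indep_sets_def by (auto split: bool.splits)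
  next
    case (Some p)
    then have "p \<in> upper_pairs n" using that by (auto simp: sources_def)
    then show ?thesis using iW Some unfolding indep_sets_def by blast
  qed
  fix A J assume J: "J \<noteq> {}" "J \<subseteq> sources n" "finite J" and A: "\<forall>j\<in>J. A j \<in> source M n W u j"
  define K where "K = {p. Some p \<in> J}"
  have K: "K \<subseteq> upper_pairs n" "finite K" using J
    by (auto simp: K_def sources_def intro!: finite_vimageI[of J Some, unfolded vimage_def])
  have WK: "prob (\<Inter>p\<in>K. A (Some p)) = (\<Prod>p\<in>K. prob (A (Some p)))" if "K \<noteq> {}"
    using iW K that A unfolding indep_sets_def by (auto simp: K_def Pi_iff)
  show "prob (\<Inter>j\<in>J. A j) = (\<Prod>j\<in>J. prob (A j))"
  proof (cases "None \<in> J")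
    case False
    then have JK: "J = Some ` K" by (auto simp: K_def) (metis imageI mem_Collect_eq not_None_eq)
    then have "K \<noteq> {}" using J by auto
    then show ?thesis using WK unfolding JK by (simp add: prod.reindex)
  next
    case True
    then have JK: "J = insert None (Some ` K)" by (auto simp: K_def) (metis imageI mem_Collect_eq not_None_eq)
    show ?thesis
    proof (cases "K = {}")
      case False
      have "\<forall>p\<in>K. \<exists>C. C \<in> sets borel \<and> A (Some p) = W (fst p) (snd p) -` C \<inter> space M"
      proof
        fix p assume "p \<in> K"
        then have "A (Some p) \<in> source M n W u (Some p)" using A by (simp add: K_def)
        then show "\<exists>C. C \<in> sets borel \<and> A (Some p) = W (fst p) (snd p) -` C \<inter> space M"
          by (auto simp: source_def preimages_def)
      qed
      from bchoice[OF this] obtain C where C: "\<And>p. p \<in> K \<Longrightarrow> C p \<in> sets borel"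
        "\<And>p. p \<in> K \<Longrightarrow> A (Some p) = W (fst p) (snd p) -` C p \<inter> space M" by blast
      have Kn: "p \<in> {..<n} \<times> {..<n}" if "p \<in> K" for p
        using that K by (auto simp: upper_pairs_def)
      have "{x \<in> space ?P. x p \<in> C p} \<in> sets ?P" if "p \<in> K" for p
        by (rule coordinate_event[OF Kn[OF that] C(1)[OF that]])
      then have "{x \<in> space ?P. \<forall>p\<in>K. x p \<in> C p} \<in> sets ?P"
        using K(2) False by (intro sets.sets_Collect_finite_All') auto
      moreover have "(\<Inter>p\<in>K. A (Some p)) = ?mat -` {x \<in> space ?P. \<forall>p\<in>K. x p \<in> C p} \<inter> space M"
      proof -
        have m: "?mat \<omega> \<in> space ?P" for \<omega> by (simp add: space_PiM)
        have "?mat \<omega> p = W (fst p) (snd p) \<omega>" if "p \<in> K" for p \<omega>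
          using Kn[OF that] by (simp add: split_beta)
        then have "?mat -` {x \<in> space ?P. \<forall>p\<in>K. x p \<in> C p} \<inter> space M =
            {\<omega> \<in> space M. \<forall>p\<in>K. W (fst p) (snd p) \<omega> \<in> C p}"
          using m by auto
        also have "\<dots> = (\<Inter>p\<in>K. W (fst p) (snd p) -` C p \<inter> space M)" using False by blast
        also have "\<dots> = (\<Inter>p\<in>K. A (Some p))" by (intro INF_cong refl) (simp add: C(2))
        finally show ?thesis ..
      qed
      ultimately have "(\<Inter>p\<in>K. A (Some p)) \<in> preimages M ?P ?mat" unfolding preimages_def by blast
      then have "prob ((\<Inter>p\<in>K. A (Some p)) \<inter> A None) = prob (\<Inter>p\<in>K. A (Some p)) * prob (A None)"
        using indep_setD[OF iS] A True by blast
      moreover have "(\<Inter>j\<in>J. A j) = (\<Inter>p\<in>K. A (Some p)) \<inter> A None" unfolding JK by auto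
      ultimately show ?thesis using WK[OF False] K(2) unfolding JK by (simp add: prod.reindex mult.commute)
    qed (simp add: JK)
  qed
qed

text \<open>
  The sigma-algebra generated by all ingredients but the entry at \<open>(i, j)\<close>, which by symmetry is
  also the entry at \<open>(j, i)\<close>.
\<close>

definition rest_algebra :: "'a measure \<Rightarrow> nat \<Rightarrow> (nat \<Rightarrow> nat \<Rightarrow> 'a \<Rightarrow> real) \<Rightarrow> (nat \<Rightarrow> 'a \<Rightarrow> real) \<Rightarrow>
    nat \<Rightarrow> nat \<Rightarrow> 'a measure" where
  "rest_algebra P n W u i j = sigma (space P)
     (\<Union>q\<in>sources n - {Some (min i j, max i j)}. source P n W u q)"

lemma source_subset: "source P n W u q \<subseteq> Pow (space P)"
  by (auto simp: source_def preimages_def split: option.splits)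

lemma space_rest_algebra: "space (rest_algebra P n W u i j) = space P"
  unfolding rest_algebra_def by (rule space_measure_of) (use source_subset in fast)

lemma sets_rest_algebra:
  "sets (rest_algebra P n W u i j) =
     sigma_sets (space P) (\<Union>q\<in>sources n - {Some (min i j, max i j)}. source P n W u q)"
  unfolding rest_algebra_def by (rule sets_measure_of) (use source_subset in fast)

lemma W_rest_measurable:
  assumes sym: "\<And>k l \<omega>. k < n \<Longrightarrow> l < n \<Longrightarrow> \<omega> \<in> space P \<Longrightarrow> W k l \<omega> = W l k \<omega>"
    and kl: "k < n" "l < n" "(k, l) \<notin> entry_pairs i j"
  shows "W k l \<in> borel_measurable (rest_algebra P n W u i j)"
proof -
  let ?k = "min k l" and ?l = "max k l"
  have q: "Some (?k, ?l) \<in> sources n - {Some (min i j, max i j)}"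
    using kl by (auto simp: sources_def upper_pairs_def entry_pairs_def min_def max_def split: if_splits)
  have "W ?k ?l \<in> borel_measurable (rest_algebra P n W u i j)"
  proof (rule measurableI)
    fix A :: "real set" assume "A \<in> sets borel"
    then have "W ?k ?l -` A \<inter> space P \<in> source P n W u (Some (?k, ?l))"
      by (auto simp: source_def preimages_def)
    then show "W ?k ?l -` A \<inter> space (rest_algebra P n W u i j) \<in> sets (rest_algebra P n W u i j)"
      unfolding space_rest_algebra sets_rest_algebra using q by (intro sigma_sets.Basic) blast
  qed simp
  moreover have "W k l \<omega> = W ?k ?l \<omega>" if "\<omega> \<in> space P" for \<omega>
    using sym[OF kl(1,2) that] by (simp add: min_def max_def)
  ultimately show ?thesis by (subst measurable_cong[of _ _ "W ?k ?l"]) (auto simp: space_rest_algebra)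
qed

lemma u_rest_measurable:
  assumes "k < n"
  shows "u k \<in> borel_measurable (rest_algebra P n W u i j)"
proof (rule measurableI)
  let ?P = "Pi\<^sub>M {..<n} (\<lambda>_. borel) :: (nat \<Rightarrow> real) measure"
  fix A :: "real set" assume A: "A \<in> sets borel"
  have "{x \<in> space ?P. x k \<in> A} \<in> sets ?P" using assms by (intro coordinate_event A) simp
  moreover have "u k -` A \<inter> space P = (\<lambda>\<omega>. \<lambda>i\<in>{..<n}. u i \<omega>) -` {x \<in> space ?P. x k \<in> A} \<inter> space P"
    using assms by (auto simp: space_PiM)
  ultimately have "u k -` A \<inter> space P \<in> source P n W u None"
    unfolding source_def option.case by (rule preimagesI)
  then show "u k -` A \<inter> space (rest_algebra P n W u i j) \<in> sets (rest_algebra P n W u i j)"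
    unfolding space_rest_algebra sets_rest_algebra by (intro sigma_sets.Basic) (auto simp: sources_def)
qed simp

lemma (in prob_space) indep_of_rest_algebra:
  assumes W: "indep_vars (\<lambda>_. borel) (\<lambda>(i, j). W i j) (upper_pairs n)"
    and ind: "indep_mat_vec M n W u"
    and sym: "\<And>k l \<omega>. k < n \<Longrightarrow> l < n \<Longrightarrow> \<omega> \<in> space M \<Longrightarrow> W k l \<omega> = W l k \<omega>"
    and ij: "i < n" "j < n"
  shows "indep_of M (W i j) (rest_algebra M n W u i j)"
proof -
  let ?p = "(min i j, max i j)"
  let ?R = "rest_algebra M n W u i j"
  let ?I = "\<lambda>b. if b then {Some ?p} else sources n - {Some ?p}"
  let ?w = "W (min i j) (max i j)"
  have p: "?p \<in> upper_pairs n" using ij by (auto simp: upper_pairs_def)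
  have wM: "?w \<in> borel_measurable M" using W p unfolding indep_vars_def2 by auto
  have "Some ?p \<in> sources n" using p by (simp add: sources_def)
  then have "(\<Union>b\<in>UNIV. ?I b) = sources n" by (auto simp: UNIV_bool)
  then have "indep_sets (source M n W u) (\<Union>b\<in>UNIV. ?I b)"
    using indep_sources[OF W ind] by simp
  then have c: "indep_sets (\<lambda>b. sigma_sets (space M) (\<Union>q\<in>?I b. source M n W u q)) UNIV"
    by (rule indep_sets_collect_sigma)
       (auto simp: source_def Int_stable_preimages disjoint_family_on_def split: option.splits if_splits)
  have "\<forall>b\<in>UNIV. sigma_sets (space M) (\<Union>q\<in>?I b. source M n W u q) \<subseteq> events"
    using c unfolding indep_sets_def by (rule conjunct1)
  from bspec[OF this, of False] have sub: "sets ?R \<subseteq> events"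
    unfolding sets_rest_algebra by simp
  have wW: "?w \<omega> = W i j \<omega>" if "\<omega> \<in> space M" for \<omega>
    using sym[OF ij that] by (simp add: min_def max_def)
  have "indep_var borel (\<lambda>x. complex_of_real (W i j x)) borel F" if F: "F \<in> borel_measurable ?R" for F :: "'a \<Rightarrow> complex"
  proof -
    have FM: "F \<in> borel_measurable M"
      using F measurable_mono[of borel borel ?R M] sub by (auto simp: space_rest_algebra)
    have WM: "W i j \<in> borel_measurable M"
      using wM by (subst measurable_cong[of _ _ ?w]) (auto simp: wW)
    let ?A = "sigma_sets (space M) {(\<lambda>x. complex_of_real (W i j x)) -` A \<inter> space M |A. A \<in> sets borel}"
    let ?B = "sigma_sets (space M) {F -` A \<inter> space M |A. A \<in> sets borel}"
    have "indep_sets (case_bool ?A ?B) UNIV"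
    proof (rule indep_sets_mono_sets[OF c])
      fix b :: bool
      show "case_bool ?A ?B b \<subseteq> sigma_sets (space M) (\<Union>q\<in>?I b. source M n W u q)"
      proof (cases b)
        case True
        have "{(\<lambda>x. complex_of_real (W i j x)) -` A \<inter> space M |A. A \<in> sets borel} \<subseteq> source M n W u (Some ?p)"
        proof safe
          fix A :: "complex set" assume A: "A \<in> sets borel"
          have "complex_of_real -` A \<inter> space borel \<in> sets borel"
            using A by (intro measurable_sets[OF borel_measurable_of_real]) auto
          then have "complex_of_real -` A \<in> sets borel" by simp
          moreover have "(\<lambda>x. complex_of_real (W i j x)) -` A \<inter> space M = ?w -` (complex_of_real -` A) \<inter> space M"
            using wW by auto
          ultimately show "(\<lambda>x. complex_of_real (W i j x)) -` A \<inter> space M \<in> source M n W u (Some ?p)"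
            unfolding source_def option.case fst_conv snd_conv by (intro preimagesI)
        qed
        then show ?thesis using True by (auto intro!: sigma_sets_mono')
      next
        case False
        have "{F -` A \<inter> space M |A. A \<in> sets borel} \<subseteq> sets ?R"
          using measurable_sets[OF F] by (auto simp: space_rest_algebra)
        then have "?B \<subseteq> sets ?R"
          using sets.sigma_sets_subset[of _ ?R] by (simp add: space_rest_algebra)
        then show ?thesis using False by (simp add: sets_rest_algebra)
      qed
    qed
    then show ?thesis
      using WM FM unfolding indep_var_eq indep_set_def by simp
  qed
  then show ?thesis unfolding indep_of_def using sub by (auto simp: space_rest_algebra)
qed

section \<open>The resolvent in an eigenbasis\<close>

text \<open>
  An orthonormal family of \<open>n\<close> vectors in dimension \<open>n\<close> is complete, because a left inverse of a
  square matrix is a right inverse.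
\<close>

lemma eigenbasis_complete:
  fixes v :: "nat \<Rightarrow> nat \<Rightarrow> real"
  assumes "\<And>k l. k < n \<Longrightarrow> l < n \<Longrightarrow> (\<Sum>p<n. v k p * v l p) = (if k = l then 1 else 0)"
    and "p < n" "q < n"
  shows "(\<Sum>k<n. v k p * v k q) = (if p = q then 1 else 0)"
proof -
  define V where "V = mat n n (\<lambda>(k, p). v k p)"
  have V: "V \<in> carrier_mat n n" by (simp add: V_def)
  have "V * transpose_mat V = 1\<^sub>m n"
  proof (rule eq_matI)
    fix k l assume "k < dim_row (1\<^sub>m n)" "l < dim_col (1\<^sub>m n)"
    then have kl: "k < n" "l < n" by auto
    have "(V * transpose_mat V) $$ (k, l) = (\<Sum>p<n. v k p * v l p)"
      using kl by (auto simp: V_def scalar_prod_def intro!: sum.cong)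
    then show "(V * transpose_mat V) $$ (k, l) = 1\<^sub>m n $$ (k, l)" using assms(1)[OF kl] kl by simp
  qed (auto simp: V_def)
  then have "transpose_mat V * V = 1\<^sub>m n"
    using mat_mult_left_right_inverse[OF V] V by simp
  then have "(transpose_mat V * V) $$ (p, q) = (if p = q then 1 else 0)" using assms by simp
  moreover have "(transpose_mat V * V) $$ (p, q) = (\<Sum>k<n. v k p * v k q)"
    using assms(2,3) by (auto simp: V_def scalar_prod_def intro!: sum.cong)
  ultimately show ?thesis by simp
qed

text \<open>
  Expanding in the eigenbasis turns the form at the spike into the Stieltjes transform of the
  discrete measure that puts the squared overlaps at the eigenvalues.
\<close>

lemma res_form_spectral:
  fixes v :: "nat \<Rightarrow> nat \<Rightarrow> real" and l :: "nat \<Rightarrow> real"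
  assumes B: "symm n B" and z: "Im z > 0"
    and orth: "\<And>k l. k < n \<Longrightarrow> l < n \<Longrightarrow> (\<Sum>p<n. v k p * v l p) = (if k = l then 1 else 0)"
    and eig: "\<And>k i. k < n \<Longrightarrow> i < n \<Longrightarrow> (\<Sum>j<n. B i j * v k j) = l k * v k i"
  shows "res_form n B z x y =
    (\<Sum>k<n. of_real ((\<Sum>p<n. v k p * x p) * (\<Sum>p<n. v k p * y p)) * (1 / (of_real (l k) - z)))"
proof -
  define c where "c k = (\<Sum>q<n. v k q * y q)" for k
  have lz: "of_real (l k) - z \<noteq> 0" for k using z by (auto simp: complex_eq_iff)
  define s where "s p = (\<Sum>k<n. of_real (v k p * c k) * (1 / (of_real (l k) - z)))" for p
  have solve: "s p = (\<Sum>q<n. resolvent n B z p q * of_real (y q))" if p: "p < n" for p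
  proof (rule resolvent_solves[OF B z _ p])
    fix i assume i: "i < n"
    have "(\<Sum>j<n. of_real (B i j) * s j) =
        (\<Sum>j<n. \<Sum>k<n. of_real (B i j * v k j) * (of_real (c k) * (1 / (of_real (l k) - z))))"
      by (simp add: s_def sum_distrib_left mult_ac)
    also have "\<dots> = (\<Sum>k<n. \<Sum>j<n. of_real (B i j * v k j) * (of_real (c k) * (1 / (of_real (l k) - z))))"
      by (rule sum.swap)
    also have "\<dots> = (\<Sum>k<n. of_real (l k * v k i) * (of_real (c k) * (1 / (of_real (l k) - z))))"
      unfolding sum_distrib_right[symmetric] of_real_sum[symmetric] using eig[OF _ i] by (intro sum.cong) auto
    finally have "(\<Sum>j<n. of_real (B i j) * s j) - z * s i =
       (\<Sum>k<n. of_real (l k * v k i) * (of_real (c k) * (1 / (of_real (l k) - z))) -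
          z * (of_real (v k i * c k) * (1 / (of_real (l k) - z))))"
      by (simp add: s_def sum_distrib_left sum_subtractf)
    also have "\<dots> = (\<Sum>k<n. of_real (v k i * c k))"
    proof (intro sum.cong refl)
      fix k
      have "L * V * (C * r) - z * (V * C * r) = V * C * ((L - z) * r)" for L V C r :: complex
        by (simp add: algebra_simps)
      then show "of_real (l k * v k i) * (of_real (c k) * (1 / (of_real (l k) - z))) -
          z * (of_real (v k i * c k) * (1 / (of_real (l k) - z))) = of_real (v k i * c k)"
        using lz by (simp only: of_real_mult nonzero_mult_div_cancel_left right_inverse divide_inverse mult_1 mult_1_right
          not_False_eq_True)
    qed
    also have "\<dots> = of_real (\<Sum>k<n. \<Sum>q<n. v k i * v k q * y q)"
      by (simp add: c_def sum_distrib_left mult.assoc)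
    also have "(\<Sum>k<n. \<Sum>q<n. v k i * v k q * y q) = (\<Sum>q<n. (\<Sum>k<n. v k i * v k q) * y q)"
      unfolding sum_distrib_right by (rule sum.swap)
    also have "\<dots> = (\<Sum>q<n. if i = q then y q else 0)"
      using eigenbasis_complete[OF orth i] by (intro sum.cong) auto
    also have "\<dots> = y i" using i by simp
    finally show "(\<Sum>j<n. of_real (B i j) * s j) - z * s i = of_real (y i)" .
  qed
  have "res_form n B z x y = (\<Sum>p<n. of_real (x p) * s p)"
    unfolding res_form_expand_left[of n B z x y] by (intro sum.cong refl) (simp add: solve res_form_unit_left)
  also have "\<dots> = (\<Sum>p<n. \<Sum>k<n. of_real (v k p * x p) * (of_real (c k) * (1 / (of_real (l k) - z))))"
    by (simp add: s_def sum_distrib_left mult_ac)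
  also have "\<dots> = (\<Sum>k<n. \<Sum>p<n. of_real (v k p * x p) * (of_real (c k) * (1 / (of_real (l k) - z))))"
    by (rule sum.swap)
  also have "\<dots> = (\<Sum>k<n. of_real ((\<Sum>p<n. v k p * x p) * c k) * (1 / (of_real (l k) - z)))"
    unfolding sum_distrib_right[symmetric] of_real_sum[symmetric] by simp
  finally show ?thesis by (simp add: c_def)
qed

lemma res_trace_spectral:
  fixes v :: "nat \<Rightarrow> nat \<Rightarrow> real" and l :: "nat \<Rightarrow> real"
  assumes B: "symm n B" and z: "Im z > 0"
    and orth: "\<And>k l. k < n \<Longrightarrow> l < n \<Longrightarrow> (\<Sum>p<n. v k p * v l p) = (if k = l then 1 else 0)"
    and eig: "\<And>k i. k < n \<Longrightarrow> i < n \<Longrightarrow> (\<Sum>j<n. B i j * v k j) = l k * v k i"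
  shows "res_trace n B z = (\<Sum>k<n. of_real (1 / real n) * (1 / (of_real (l k) - z)))"
proof -
  have e: "(\<Sum>p<n. v k p * unit_vec_fun q p) = v k q" if "q < n" for k q
  proof -
    have "(\<Sum>p<n. v k p * unit_vec_fun q p) = (\<Sum>p<n. if p = q then v k q else 0)"
      by (intro sum.cong) (auto simp: unit_vec_fun_def)
    then show ?thesis using that by simp
  qed
  have "(\<Sum>p<n. res_form n B z (unit_vec_fun p) (unit_vec_fun p)) =
     (\<Sum>p<n. \<Sum>k<n. of_real (v k p * v k p) * (1 / (of_real (l k) - z)))"
  proof (intro sum.cong refl)
    fix p assume "p \<in> {..<n}"
    moreover have "res_form n B z (unit_vec_fun p) (unit_vec_fun p) = (\<Sum>k<n. of_real
        ((\<Sum>q<n. v k q * unit_vec_fun p q) * (\<Sum>q<n. v k q * unit_vec_fun p q)) * (1 / (of_real (l k) - z)))"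
      by (rule res_form_spectral[OF B z orth eig])
    ultimately show "res_form n B z (unit_vec_fun p) (unit_vec_fun p) =
        (\<Sum>k<n. of_real (v k p * v k p) * (1 / (of_real (l k) - z)))" by (simp add: e)
  qed
  also have "\<dots> = (\<Sum>k<n. \<Sum>p<n. of_real (v k p * v k p) * (1 / (of_real (l k) - z)))"
    by (rule sum.swap)
  also have "\<dots> = (\<Sum>k<n. 1 / (of_real (l k) - z))"
    unfolding sum_distrib_right[symmetric] of_real_sum[symmetric] using orth by (intro sum.cong) auto
  finally show ?thesis by (simp add: res_trace_def sum_divide_distrib mult.commute)
qed

lemma ordered_eigenbasis_functional:
  assumes "ordered_eigenbasis N A l v" "A \<in> carrier_mat N N"
  shows "\<And>i j. i < N \<Longrightarrow> j < N \<Longrightarrow> (\<Sum>p<N. vec_index (v i) p * vec_index (v j) p) = (if i = j then 1 else 0)"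
    and "\<And>k i. k < N \<Longrightarrow> i < N \<Longrightarrow> (\<Sum>j<N. A $$ (i, j) * vec_index (v k) j) = l k * vec_index (v k) i"
    and "\<And>k. k < N \<Longrightarrow> v k \<in> carrier_vec N"
proof -
  have v: "v k \<in> carrier_vec N" "A *\<^sub>v v k = l k \<cdot>\<^sub>v v k" if "k < N" for k
    using assms that by (auto simp: ordered_eigenbasis_def eigenvector_def)
  show "v k \<in> carrier_vec N" if "k < N" for k using v that by blast
  show "(\<Sum>p<N. vec_index (v i) p * vec_index (v j) p) = (if i = j then 1 else 0)" if "i < N" "j < N" for i j
  proof -
    have "scalar_prod (v i) (v j) = (\<Sum>p<N. vec_index (v i) p * vec_index (v j) p)"
      using v(1)[OF that(2)] by (auto simp: scalar_prod_def intro!: sum.cong)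
    then show ?thesis using assms(1) that by (simp add: ordered_eigenbasis_def)
  qed
  show "(\<Sum>j<N. A $$ (i, j) * vec_index (v k) j) = l k * vec_index (v k) i" if "k < N" "i < N" for k i
  proof -
    have "vec_index (A *\<^sub>v v k) i = (\<Sum>j<N. A $$ (i, j) * vec_index (v k) j)"
      using v(1)[OF that(1)] assms(2) that by (auto simp: scalar_prod_def intro!: sum.cong)
    moreover have "vec_index (l k \<cdot>\<^sub>v v k) i = l k * vec_index (v k) i"
      using v(1)[OF that(1)] that by simp
    ultimately show ?thesis using v(2)[OF that(1)] by simp
  qed
qed

section \<open>The semicircle law and Chebyshev polynomials\<close>

text \<open>
  The Chebyshev polynomials of the second kind at \<open>x / 2\<close>. They are the orthogonal
  polynomials of the semicircle law, so all but the constant one integrate to 0 against it.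
\<close>

fun cheb :: "nat \<Rightarrow> real \<Rightarrow> real" where
  "cheb 0 x = 1"
| "cheb (Suc 0) x = x"
| "cheb (Suc (Suc n)) x = x * cheb (Suc n) x - cheb n x"

text \<open>
  With \<open>x = - 2 cos t\<close> instead of \<open>2 cos t\<close> the substitution is increasing on \<open>[0, pi]\<close>.
\<close>

lemma cheb_cos: "cheb n (- 2 * cos t) * sin t = (-1) ^ n * sin (real (Suc n) * t)"
proof (induction n "- 2 * cos t" rule: cheb.induct)
  case 2
  show ?case using sin_double[of t] by (simp add: mult.commute)
next
  case (3 n)
  have "sin (real (Suc (Suc (Suc n))) * t) + sin (real (Suc n) * t) = 2 * cos t * sin (real (Suc (Suc n)) * t)"
    using sin_plus_sin[of "real (Suc (Suc (Suc n))) * t" "real (Suc n) * t"]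
    by (simp add: algebra_simps add_divide_distrib)
  then have e: "sin (real (Suc (Suc (Suc n))) * t) = 2 * cos t * sin (real (Suc (Suc n)) * t) - sin (real (Suc n) * t)"
    by linarith
  have "cheb (Suc (Suc n)) (- 2 * cos t) * sin t =
     - 2 * cos t * (cheb (Suc n) (- 2 * cos t) * sin t) - cheb n (- 2 * cos t) * sin t"
    by (simp add: algebra_simps)
  also have "\<dots> = (-1) ^ n * (2 * cos t * sin (real (Suc (Suc n)) * t) - sin (real (Suc n) * t))"
    using 3 by (simp add: algebra_simps)
  finally show ?case unfolding e by simp
qed simp

lemma abs_sin_mult_le: "\<bar>sin (real n * t)\<bar> \<le> real n * \<bar>sin t\<bar>"
proof (induction n)
  case (Suc n)
  have "\<bar>sin (real (Suc n) * t)\<bar> = \<bar>sin (real n * t) * cos t + cos (real n * t) * sin t\<bar>"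
    by (simp add: distrib_right sin_add algebra_simps)
  also have "\<dots> \<le> \<bar>sin (real n * t)\<bar> * \<bar>cos t\<bar> + \<bar>cos (real n * t)\<bar> * \<bar>sin t\<bar>"
    by (metis abs_mult abs_triangle_ineq)
  also have "\<dots> \<le> \<bar>sin (real n * t)\<bar> * 1 + 1 * \<bar>sin t\<bar>"
    by (intro add_mono mult_mono) auto
  finally show ?case using Suc by (simp add: algebra_simps)
qed simp

lemma cheb_endpoint: "s\<^sup>2 = 1 \<Longrightarrow> cheb n (2 * s) = s ^ n * real (Suc n)"
proof (induction n "2 * s" rule: cheb.induct)
  case (3 n)
  have "cheb (Suc (Suc n)) (2 * s) = s\<^sup>2 * (2 * s ^ n * real (Suc (Suc n))) - s ^ n * real (Suc n)"
    using 3 by (simp add: power2_eq_square mult_ac)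
  also have "\<dots> = s\<^sup>2 * s ^ n * real (Suc (Suc (Suc n)))"
    using 3(3) by (simp add: algebra_simps)
  finally show ?case by (simp add: power2_eq_square mult_ac)
qed auto

lemma abs_cheb_le:
  assumes "x \<in> {-2..2}"
  shows "\<bar>cheb n x\<bar> \<le> real (Suc n)"
proof -
  define t where "t = arccos (- x / 2)"
  have x: "x = - 2 * cos t" using assms by (simp add: t_def)
  show ?thesis
  proof (cases "sin t = 0")
    case True
    then have "(- cos t)\<^sup>2 = 1" using sin_cos_squared_add[of t] by simp
    then have "\<bar>- cos t\<bar> = 1" "cheb n x = (- cos t) ^ n * real (Suc n)"
      using cheb_endpoint[of "- cos t" n] by (auto simp: x abs_square_eq_1)
    then show ?thesis by (simp add: abs_mult power_abs)
  next
    case False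
    have "\<bar>cheb n x\<bar> * \<bar>sin t\<bar> = \<bar>sin (real (Suc n) * t)\<bar>"
      using arg_cong[OF cheb_cos[of n t], of abs] by (simp add: x abs_mult power_abs)
    also have "\<dots> \<le> real (Suc n) * \<bar>sin t\<bar>" by (rule abs_sin_mult_le)
    finally show ?thesis using False by (meson mult_le_cancel_right_pos zero_less_abs_iff)
  qed
qed

lemma sc_density_nonneg: "0 \<le> sc_density x"
proof (cases "x \<in> {-2..2}")
  case True
  then have "x\<^sup>2 \<le> 2\<^sup>2" by (subst abs_le_square_iff[symmetric]) auto
  then show ?thesis by (simp add: sc_density_def)
qed (simp add: sc_density_def)

lemma sc_density_outside: "x \<notin> {-2<..<2} \<Longrightarrow> sc_density x = 0"
proof -
  assume "x \<notin> {-2<..<2}"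
  then consider "x = 2" | "x = -2" | "x \<notin> {-2..2}" by fastforce
  then show ?thesis by cases (auto simp: sc_density_def)
qed

lemma sc_density_pos:
  assumes "x \<in> {-2<..<2}"
  shows "0 < sc_density x"
proof -
  have "x\<^sup>2 < 2\<^sup>2" using assms abs_square_less_1[of "x / 2"] by (auto simp: power_divide)
  then show ?thesis using assms by (simp add: sc_density_def)
qed

lemma sc_density_le: "sc_density x \<le> 1 / pi"
proof (cases "x \<in> {-2..2}")
  case True
  have "sqrt (4 - x\<^sup>2) \<le> sqrt 4" by (rule real_sqrt_le_mono) simp
  then show ?thesis using True by (simp add: sc_density_def field_simps)
qed (simp add: sc_density_def)

lemma sc_density_measurable [measurable]: "sc_density \<in> borel_measurable borel"
  unfolding sc_density_def by measurable

lemma integrable_sc_mult: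
  fixes h :: "real \<Rightarrow> 'b :: {real_normed_field, banach, second_countable_topology}"
  assumes "h \<in> borel_measurable borel" "\<And>x. x \<in> {-2<..<2} \<Longrightarrow> norm (h x) \<le> C"
  shows "integrable lborel (\<lambda>x. of_real (sc_density x) * h x)"
proof (rule Bochner_Integration.integrable_bound)
  show "integrable lborel (\<lambda>x::real. (\<bar>C\<bar> / pi) * indicator {-2..2} x)"
    by (intro integrable_mult_right) (simp add: integrable_indicator_iff)
  show "(\<lambda>x. of_real (sc_density x) * h x) \<in> borel_measurable lborel" using assms(1) by measurable
  show "AE x in lborel. norm (of_real (sc_density x) * h x) \<le> norm ((\<bar>C\<bar> / pi) * indicator {-2..2} x)"
  proof (intro AE_I2)
    fix x
    show "norm (of_real (sc_density x) * h x) \<le> norm ((\<bar>C\<bar> / pi) * indicator {-2..2} x)"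
    proof (cases "x \<in> {-2<..<2}")
      case True
      have "norm (of_real (sc_density x) * h x) \<le> (1 / pi) * \<bar>C\<bar>"
        unfolding norm_mult norm_of_real
        using assms(2)[OF True] sc_density_le[of x] sc_density_nonneg[of x] by (intro mult_mono) auto
      then show ?thesis using True by (simp add: abs_mult)
    qed (simp add: sc_density_outside)
  qed
qed

lemma integrable_sc: "integrable lborel sc_density"
  using integrable_sc_mult[of "\<lambda>_. 1::real" 1] by simp

lemma cheb_measurable [measurable]: "cheb n \<in> borel_measurable borel"
proof -
  have "(\<lambda>x. cheb n x) \<in> borel_measurable borel"
    by (induction n rule: cheb.induct[of "\<lambda>n x. (\<lambda>x. cheb n x) \<in> borel_measurable borel" _ 0]) auto
  then show ?thesis by simp
qed

lemma sc_substitution: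
  fixes t :: real
  assumes "t \<in> {0..pi}"
  shows "sc_density (- 2 * cos t) * (2 * sin t) = 2 / pi * (sin t)\<^sup>2"
proof -
  have s: "0 \<le> sin t" using assms by (simp add: sin_ge_zero)
  have "4 - (- 2 * cos t)\<^sup>2 = (2 * sin t)\<^sup>2"
    using sin_squared_eq[of t] by (simp add: power_mult_distrib)
  then have "sqrt (4 - (- 2 * cos t)\<^sup>2) = 2 * sin t" using s by (simp only: real_sqrt_abs)
  moreover have "- 2 * cos t \<in> {-2..2}"
    unfolding atLeastAtMost_iff using cos_ge_minus_one[of t] cos_le_one[of t] by linarith
  ultimately show ?thesis by (simp add: sc_density_def power2_eq_square)
qed

lemma integral_sc_cheb: "(LINT x|lborel. sc_density x * cheb n x) = (if n = 0 then 1 else 0)"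
proof -
  let ?g = "\<lambda>t::real. - 2 * cos t"
  have "integrable lborel (\<lambda>x. sc_density x * cheb n x)"
    using integrable_sc_mult[of "cheb n" "real (Suc n)"] abs_cheb_le[of _ n] by force
  then have i: "set_integrable lborel {?g 0..?g pi} (\<lambda>x. sc_density x * cheb n x)"
    unfolding set_integrable_def by (rule integrable_mult_indicator[rotated]) auto
  have "(LINT x|lborel. sc_density x * cheb n x) = (LBINT x. sc_density x * cheb n x * indicator {?g 0..?g pi} x)"
    by (intro Bochner_Integration.integral_cong refl) (auto simp: sc_density_def indicator_def)
  also have "\<dots> = (LBINT t. sc_density (?g t) * cheb n (?g t) * (2 * sin t) * indicator {0..pi} t)"
    by (rule integral_substitution(2)[where g = ?g and a = 0 and b = pi, OF i]) (auto intro!: derivative_eq_intros continuous_intros sin_ge_zero)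
  also have "\<dots> = (LBINT t. (2 / pi * (-1) ^ n) * (sin t * sin (real (Suc n) * t)) * indicator {0..pi} t)"
  proof (intro Bochner_Integration.integral_cong refl)
    fix t :: real
    have "sc_density (?g t) * cheb n (?g t) * (2 * sin t) = (2 / pi * (-1) ^ n) * (sin t * sin (real (Suc n) * t))"
      if "t \<in> {0..pi}"
    proof -
      have "sc_density (?g t) * cheb n (?g t) * (2 * sin t) = (sc_density (?g t) * (2 * sin t)) * cheb n (?g t)"
        by (simp only: mult_ac)
      also have "\<dots> = (2 / pi) * sin t * (cheb n (?g t) * sin t)"
        unfolding sc_substitution[OF that] by (simp add: power2_eq_square)
      finally have "sc_density (?g t) * cheb n (?g t) * (2 * sin t) = (2 / pi) * sin t * (cheb n (?g t) * sin t)" .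
      then show ?thesis unfolding cheb_cos by simp
    qed
    then show "sc_density (?g t) * cheb n (?g t) * (2 * sin t) * indicator {0..pi} t =
       (2 / pi * (-1) ^ n) * (sin t * sin (real (Suc n) * t)) * indicator {0..pi} t"
      by (auto simp: indicator_def)
  qed
  also have "\<dots> = (if n = 0 then 1 else 0)"
  proof (cases "n = 0")
    case True
    let ?F = "\<lambda>t. 2 / pi * (t / 2 - sin (2 * t) / 4)"
    have "(LBINT t. (2 / pi * (-1) ^ n) * (sin t * sin (real (Suc n) * t)) * indicator {0..pi} t) = ?F pi - ?F 0"
    proof (rule integral_FTC_Icc_real)
      fix t :: real
      have e: "(2 / pi * (-1) ^ n) * (sin t * sin (real (Suc n) * t)) = 2 / pi * ((1 - cos (2 * t)) / 2)"
        using True by (simp add: cos_double_sin power2_eq_square)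
      show "(?F has_real_derivative (2 / pi * (-1) ^ n) * (sin t * sin (real (Suc n) * t))) (at t)"
        unfolding e by (auto intro!: derivative_eq_intros simp: field_simps)
    qed (auto intro!: continuous_intros)
    then show ?thesis using True by simp
  next
    case False
    let ?F = "\<lambda>t. (2 / pi * (-1) ^ n) * (sin (real n * t) / (2 * real n) - sin (real (n + 2) * t) / (2 * real (n + 2)))"
    have "(LBINT t. (2 / pi * (-1) ^ n) * (sin t * sin (real (Suc n) * t)) * indicator {0..pi} t) = ?F pi - ?F 0"
    proof (rule integral_FTC_Icc_real)
      fix t :: real
      have e: "sin t * sin (real (Suc n) * t) = cos (real n * t) / 2 - cos (real (n + 2) * t) / 2"
        using sin_times_sin[of "real (Suc n) * t" t] by (simp add: algebra_simps)
      have d: "((\<lambda>t. sin (k * t) / (2 * k)) has_real_derivative cos (k * t) / 2) (at t)" if "k \<noteq> 0" for k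
        using that by (auto intro!: derivative_eq_intros)
      show "(?F has_real_derivative (2 / pi * (-1) ^ n) * (sin t * sin (real (Suc n) * t))) (at t)"
        unfolding e using False by (intro DERIV_cmult DERIV_diff d) auto
    qed (auto intro!: continuous_intros)
    also have "\<dots> = 0"
      using sin_npi[of n] sin_npi[of "n + 2"] by simp
    finally show ?thesis using False by simp
  qed
  finally show ?thesis .
qed

lemma integral_sc: "(LINT x|lborel. sc_density x) = 1"
  using integral_sc_cheb[of 0] by simp

lemma cheb_generating_partial:
  fixes w :: complex
  shows "(1 + w\<^sup>2 - w * of_real x) * (\<Sum>k<Suc N. w ^ k * of_real (cheb k x)) =
    1 - w ^ Suc N * of_real (cheb (Suc N) x) + w ^ (N + 2) * of_real (cheb N x)"
  by (induction N) (auto simp: algebra_simps power2_eq_square)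

text \<open>
  The denominator factors as \<open>(1 - w exp(i t)) (1 - w exp(- i t))\<close> for \<open>x = 2 cos t\<close>.
\<close>

lemma cheb_denominator_bound:
  fixes w :: complex
  assumes "x \<in> {-2..2}" "cmod w < 1"
  shows "(1 - cmod w)\<^sup>2 \<le> cmod (1 + w\<^sup>2 - w * of_real x)"
proof -
  define t where "t = arccos (x / 2)"
  have x: "x = 2 * cos t" using assms(1) by (simp add: t_def)
  have "of_real x = cis t + cis (- t)" by (simp add: x complex_eq_iff)
  then have "1 + w\<^sup>2 - w * of_real x = (1 - w * cis t) * (1 - w * cis (- t))"
    by (simp add: algebra_simps power2_eq_square cis_mult)
  moreover have "1 - cmod w \<le> cmod (1 - w * cis s)" for s
    using norm_triangle_ineq2[of 1 "w * cis s"] by (simp add: norm_mult)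
  ultimately show ?thesis
    using assms(2) by (auto simp: norm_mult power2_eq_square intro!: mult_mono)
qed

lemma tendsto_mult_power_zero:
  assumes "0 \<le> r" "r < (1::real)"
  shows "(\<lambda>N. C * (r ^ Suc N * real (N + 2) + r ^ (N + 2) * real (Suc N))) \<longlonglongrightarrow> 0"
proof -
  have a: "(\<lambda>N. real N * r ^ N) \<longlonglongrightarrow> 0" using powser_times_n_limit_0[of r] assms by simp
  have b: "(\<lambda>N. r ^ N) \<longlonglongrightarrow> 0" using assms by (simp add: LIMSEQ_realpow_zero)
  have "(\<lambda>N. C * (r * (real N * r ^ N) + 2 * r * r ^ N + (r\<^sup>2 * (real N * r ^ N) + r\<^sup>2 * r ^ N))) \<longlonglongrightarrow>
     C * (r * 0 + 2 * r * 0 + (r\<^sup>2 * 0 + r\<^sup>2 * 0))"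
    by (intro tendsto_intros a b)
  then show ?thesis by (simp add: algebra_simps power2_eq_square)
qed

text \<open>
  The generating function of the Chebyshev polynomials is \<open>1 / (1 + w\<^sup>2 - w x)\<close>, and all polynomials
  but the constant one integrate to 0. Working with partial sums and an explicit remainder of size
  \<open>O(N \<bar>w\<bar>\<^sup>N)\<close> avoids exchanging an infinite sum with the integral.
\<close>

theorem integral_sc_generating:
  fixes w :: complex
  assumes w: "cmod w < 1"
  shows "integrable lborel (\<lambda>x. of_real (sc_density x) * (1 / (1 + w\<^sup>2 - w * of_real x)))"
    and "(LINT x|lborel. of_real (sc_density x) * (1 / (1 + w\<^sup>2 - w * of_real x))) = 1"
proof -
  let ?d = "\<lambda>x. 1 + w\<^sup>2 - w * complex_of_real x"
  let ?b = "1 / (1 - cmod w)\<^sup>2"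
  have b: "0 \<le> ?b" by simp
  have db: "cmod (1 / ?d x) \<le> ?b" and d0: "?d x \<noteq> 0" if "x \<in> {-2<..<2}" for x
  proof -
    have "0 < (1 - cmod w)\<^sup>2" using w by simp
    moreover have "(1 - cmod w)\<^sup>2 \<le> cmod (?d x)" using cheb_denominator_bound[OF _ w, of x] that by simp
    ultimately show "cmod (1 / ?d x) \<le> ?b" "?d x \<noteq> 0"
      by (auto simp: norm_divide intro!: divide_left_mono mult_pos_pos)
  qed
  show i1: "integrable lborel (\<lambda>x. of_real (sc_density x) * (1 / ?d x))"
    by (rule integrable_sc_mult[where C = ?b]) (use db in auto)
  let ?I = "LINT x|lborel. of_real (sc_density x) * (1 / ?d x)"
  let ?e = "\<lambda>N x. (w ^ Suc N * of_real (cheb (Suc N) x) - w ^ (N + 2) * of_real (cheb N x)) * (1 / ?d x)"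
  let ?B = "\<lambda>N. (cmod w ^ Suc N * real (N + 2) + cmod w ^ (N + 2) * real (Suc N)) * ?b"
  have eb: "cmod (?e N x) \<le> ?B N" if "x \<in> {-2<..<2}" for N x
  proof -
    have "cmod (w ^ Suc N * of_real (cheb (Suc N) x) - w ^ (N + 2) * of_real (cheb N x)) \<le>
      cmod w ^ Suc N * real (N + 2) + cmod w ^ (N + 2) * real (Suc N)"
      using abs_cheb_le[of x "Suc N"] abs_cheb_le[of x N] that
      by (intro order_trans[OF norm_triangle_ineq4] add_mono)
         (auto simp: norm_mult norm_power simp del: cheb.simps intro!: mult_left_mono)
    then show ?thesis unfolding norm_mult[of _ "1 / ?d x"] using db[OF that] by (intro mult_mono) auto
  qed
  have ie: "integrable lborel (\<lambda>x. of_real (sc_density x) * ?e N x)" for N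
    by (rule integrable_sc_mult[where C = "?B N"]) (use eb in \<open>auto simp del: cheb.simps\<close>)
  have I: "?I - 1 = (LINT x|lborel. of_real (sc_density x) * ?e N x)" for N
  proof -
    let ?s = "\<lambda>x. \<Sum>k<Suc N. w ^ k * of_real (sc_density x * cheb k x)"
    have "of_real (sc_density x) * (1 / ?d x) - of_real (sc_density x) * ?e N x = ?s x" for x
    proof (cases "x \<in> {-2<..<2}")
      case True
      have "1 - (w ^ Suc N * of_real (cheb (Suc N) x) - w ^ (N + 2) * of_real (cheb N x)) =
         ?d x * (\<Sum>k<Suc N. w ^ k * of_real (cheb k x))"
        using cheb_generating_partial[of w x N] by simp
      then have "1 / ?d x - ?e N x = (\<Sum>k<Suc N. w ^ k * of_real (cheb k x))"
        using d0[OF True] by (simp add: field_simps)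
      then have "of_real (sc_density x) * (1 / ?d x - ?e N x) =
         of_real (sc_density x) * (\<Sum>k<Suc N. w ^ k * of_real (cheb k x))" by simp
      then show ?thesis unfolding right_diff_distrib sum_distrib_left by (simp add: mult_ac)
    qed (simp add: sc_density_outside)
    then have "?I - (LINT x|lborel. of_real (sc_density x) * ?e N x) = (LINT x|lborel. ?s x)"
      by (subst Bochner_Integration.integral_diff[symmetric, OF i1 ie]) (rule Bochner_Integration.integral_cong, auto)
    also have "\<dots> = (\<Sum>k<Suc N. w ^ k * (LINT x|lborel. complex_of_real (sc_density x * cheb k x)))"
    proof (subst Bochner_Integration.integral_sum)
      fix k
      have "integrable lborel (\<lambda>x. of_real (sc_density x) * cheb k x)"
        by (rule integrable_sc_mult[where C = "real (Suc k)"]) (use abs_cheb_le in auto)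
      then have "integrable lborel (\<lambda>x. complex_of_real (sc_density x * cheb k x))"
        by (intro integrable_of_real) simp
      then show "integrable lborel (\<lambda>x. w ^ k * complex_of_real (sc_density x * cheb k x))"
        by (rule integrable_mult_right)
    qed simp
    also have "\<dots> = (\<Sum>k<Suc N. if k = 0 then 1 else 0)"
      unfolding integral_complex_of_real integral_sc_cheb by (intro sum.cong) auto
    also have "\<dots> = 1" by simp
    finally show ?thesis by (simp add: algebra_simps)
  qed
  have "cmod (?I - 1) \<le> ?B N" for N
  proof -
    have "cmod (?I - 1) \<le> (LINT x|lborel. cmod (of_real (sc_density x) * ?e N x))"
      unfolding I[of N] by (rule Bochner_Integration.integral_norm_bound)
    also have "\<dots> \<le> (LINT x|lborel. sc_density x * ?B N)"
    proof (rule integral_mono)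
      show "cmod (of_real (sc_density x) * ?e N x) \<le> sc_density x * ?B N" for x
      proof (cases "x \<in> {-2<..<2}")
        case True
        then show ?thesis unfolding norm_mult[of "of_real (sc_density x)"] norm_of_real
          using eb[OF True] sc_density_nonneg[of x] by (intro mult_mono) auto
      qed (simp add: sc_density_outside)
    qed (use integrable_norm[OF ie] integrable_sc in auto)
    finally show ?thesis by (simp add: integral_sc)
  qed
  moreover have "?B \<longlonglongrightarrow> 0" using tendsto_mult_power_zero[OF norm_ge_zero w, of ?b] by (simp add: mult.commute)
  ultimately have "cmod (?I - 1) \<le> 0" by (intro LIMSEQ_le_const) auto
  then show "?I = 1" by simp
qed

section \<open>The limiting measure of the overlaps\<close>

definition overlap_density :: "real \<Rightarrow> real \<Rightarrow> real" where
  "overlap_density \<theta> x = sc_density x * overlap_profile x \<theta>"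

text \<open>
  The right-hand side is the Chebyshev generating function \<open>1 / (1 + w\<^sup>2 - w x)\<close> with \<open>w = \<theta>\<close>.
\<close>

lemma overlap_profile_eq: "\<theta> > 0 \<Longrightarrow> overlap_profile x \<theta> = 1 / (1 + \<theta>\<^sup>2 - \<theta> * x)"
  by (simp add: overlap_profile_def power2_eq_square algebra_simps)

lemma profile_denominator_pos:
  fixes \<theta> x :: real
  assumes "\<theta> > 0" "x < 2"
  shows "0 < 1 + \<theta>\<^sup>2 - \<theta> * x"
proof -
  have "\<theta> * x < \<theta> * 2" using assms by simp
  moreover have "0 \<le> (1 - \<theta>)\<^sup>2" by simp
  ultimately show ?thesis by (simp add: power2_eq_square algebra_simps)
qed

lemma overlap_density_nonneg: "\<theta> > 0 \<Longrightarrow> 0 \<le> overlap_density \<theta> x"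
  using profile_denominator_pos[of \<theta> x] sc_density_nonneg[of x]
  by (cases "x \<in> {-2<..<2}") (auto simp: overlap_density_def overlap_profile_eq sc_density_outside)

lemma overlap_density_pos: "\<theta> > 0 \<Longrightarrow> x \<in> {-2<..<2} \<Longrightarrow> 0 < overlap_density \<theta> x"
  using profile_denominator_pos[of \<theta> x] sc_density_pos[of x]
  by (auto simp: overlap_density_def overlap_profile_eq)

lemma overlap_density_outside: "x \<notin> {-2<..<2} \<Longrightarrow> overlap_density \<theta> x = 0"
  by (simp add: overlap_density_def sc_density_outside)

lemma integral_sc_generating_real:
  fixes r :: real
  assumes "0 \<le> r" "r < 1"
  shows "integrable lborel (\<lambda>x. sc_density x * (1 / (1 + r\<^sup>2 - r * x)))"
    and "(LINT x|lborel. sc_density x * (1 / (1 + r\<^sup>2 - r * x))) = 1"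
proof -
  have r: "cmod (of_real r) < 1" using assms by simp
  have e: "of_real (sc_density x) * (1 / (1 + (of_real r)\<^sup>2 - of_real r * of_real x)) =
     complex_of_real (sc_density x * (1 / (1 + r\<^sup>2 - r * x)))" for x
    by simp
  note g = integral_sc_generating[OF r, unfolded e]
  show "integrable lborel (\<lambda>x. sc_density x * (1 / (1 + r\<^sup>2 - r * x)))"
    using integrable_Re[OF g(1)] by (simp only: Re_complex_of_real)
  show "(LINT x|lborel. sc_density x * (1 / (1 + r\<^sup>2 - r * x))) = 1"
    using g(2) unfolding integral_complex_of_real by (simp only: of_real_eq_1_iff)
qed

text \<open>
  The generating identity at \<open>w = 1\<close>, on the boundary of its domain. The integrand is unbounded near
  2, so integrability and value are obtained together from a nonnegative integral.
\<close>

lemma integral_sc_critical: "has_bochner_integral lborel (\<lambda>x. sc_density x * (1 / (2 - x))) 1"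
proof (rule has_bochner_integral_nn_integral)
  let ?f = "\<lambda>x. sc_density x * (1 / (2 - x))" and ?g = "\<lambda>t::real. - 2 * cos t"
  show "?f \<in> borel_measurable lborel" by measurable
  show "AE x in lborel. 0 \<le> ?f x"
    using sc_density_nonneg by (intro AE_I2) (metis divide_nonneg_nonneg mult_nonneg_nonneg linorder_not_le
      sc_density_outside greaterThanLessThan_iff less_eq_real_def mult_zero_left diff_ge_0_iff_ge zero_le_one)
  have "(\<integral>\<^sup>+x. ennreal (?f x) \<partial>lborel) = (\<integral>\<^sup>+x. ennreal (?f x * indicator {?g 0..?g pi} x) \<partial>lborel)"
    by (intro nn_integral_cong) (auto simp: sc_density_def indicator_def)
  also have "\<dots> = (\<integral>\<^sup>+t. ennreal (?f (?g t) * (2 * sin t) * indicator {0..pi} t) \<partial>lborel)"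
  proof (rule nn_integral_substitution)
    show "set_borel_measurable borel {?g 0..?g pi} ?f"
      unfolding set_borel_measurable_def by measurable
  qed (auto intro!: derivative_eq_intros continuous_intros sin_ge_zero)
  also have "\<dots> = (\<integral>\<^sup>+t. ennreal ((1 / pi) * (1 - cos t) * indicator {0..pi} t) \<partial>lborel)"
  proof (intro nn_integral_cong_AE)
    \<comment> \<open>At t = pi, that is x = 2, the integrand is singular.\<close>
    have "AE t::real in lborel. t \<noteq> pi" by (rule AE_lborel_singleton)
    then show "AE t in lborel. ennreal (?f (?g t) * (2 * sin t) * indicator {0..pi} t) =
       ennreal ((1 / pi) * (1 - cos t) * indicator {0..pi} t)"
    proof (rule AE_mp, intro AE_I2 impI)
      fix t :: real assume t: "t \<noteq> pi"
      have "?f (?g t) * (2 * sin t) = (1 / pi) * (1 - cos t)" if "t \<in> {0..pi}"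
      proof -
        have "cos pi < cos t" using that t by (intro cos_monotone_0_pi) auto
        then have c: "1 + cos t \<noteq> 0" by simp
        have "?f (?g t) * (2 * sin t) = (sc_density (?g t) * (2 * sin t)) / (2 * (1 + cos t))"
          by (simp add: algebra_simps)
        also have "\<dots> = (sin t)\<^sup>2 / (pi * (1 + cos t))"
        proof -
          have "2 / pi * p / (2 * q) = p / (pi * q)" for p q :: real by simp
          then show ?thesis unfolding sc_substitution[OF that] .
        qed
        also have "(sin t)\<^sup>2 = (1 - cos t) * (1 + cos t)"
          by (simp add: sin_squared_eq power2_eq_square algebra_simps)
        finally show ?thesis using c by simp
      qed
      then show "ennreal (?f (?g t) * (2 * sin t) * indicator {0..pi} t) =
       ennreal ((1 / pi) * (1 - cos t) * indicator {0..pi} t)" by (auto simp: indicator_def)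
    qed
  qed
  also have "\<dots> = ennreal 1"
  proof -
    have "has_bochner_integral lborel (\<lambda>t. (1 / pi) * (1 - cos t) * indicator {0..pi} t)
        ((1 / pi) * (pi - sin pi) - (1 / pi) * (0 - sin 0))"
      by (rule has_bochner_integral_FTC_Icc_real) (auto intro!: derivative_eq_intros continuous_intros)
    then have h: "has_bochner_integral lborel (\<lambda>t. (1 / pi) * (1 - cos t) * indicator {0..pi} t) 1" by simp
    show ?thesis
      by (subst nn_integral_eq_integral) (use h in \<open>auto simp: has_bochner_integral_iff indicator_def\<close>)
  qed
  finally show "(\<integral>\<^sup>+x. ennreal (?f x) \<partial>lborel) = ennreal 1" .
qed simp

text \<open>
  For \<open>\<theta> < 1\<close> this is the generating identity at \<open>w = \<theta>\<close>. For \<open>\<theta> > 1\<close> the denominator is \<open>\<theta>\<^sup>2\<close> times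
  the one at \<open>1 / \<theta>\<close>, so the integral drops to \<open>1 / \<theta>\<^sup>2\<close>; the missing mass sits at the outlier.
\<close>

theorem integral_overlap_density:
  assumes "\<theta> > 0"
  shows "integrable lborel (overlap_density \<theta>)"
    and "(LINT x|lborel. overlap_density \<theta> x) = 1 - outlier_mass \<theta>"
proof -
  have "has_bochner_integral lborel (overlap_density \<theta>) (1 - outlier_mass \<theta>)"
  proof -
    consider "\<theta> < 1" | "\<theta> = 1" | "\<theta> > 1" by linarith
    then show ?thesis
    proof cases
      case 1
      then show ?thesis
        using integral_sc_generating_real[of \<theta>] assms
        by (simp add: has_bochner_integral_iff overlap_density_def[abs_def] overlap_profile_eq outlier_mass_def)
    next
      case 2
      then show ?thesis
        using integral_sc_critical by (simp add: overlap_density_def[abs_def] overlap_profile_eq outlier_mass_def)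
    next
      case 3
      have "1 + \<theta>\<^sup>2 - \<theta> * x = \<theta>\<^sup>2 * (1 + (1 / \<theta>)\<^sup>2 - (1 / \<theta>) * x)" for x
        using assms by (simp add: field_simps power2_eq_square)
      then have e: "overlap_density \<theta> x = (1 / \<theta>\<^sup>2) * (sc_density x * (1 / (1 + (1 / \<theta>)\<^sup>2 - (1 / \<theta>) * x)))" for x
        using assms by (simp add: overlap_density_def overlap_profile_eq)
      have r: "0 \<le> 1 / \<theta>" "1 / \<theta> < 1" using 3 by auto
      have "has_bochner_integral lborel (\<lambda>x. sc_density x * (1 / (1 + (1 / \<theta>)\<^sup>2 - (1 / \<theta>) * x))) 1"
        using integral_sc_generating_real[OF r] by (simp only: has_bochner_integral_iff)
      then have "has_bochner_integral lborel (overlap_density \<theta>) ((1 / \<theta>\<^sup>2) * 1)"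
        unfolding e[abs_def] by (rule has_bochner_integral_mult_right)
      then show ?thesis using 3 by (simp add: outlier_mass_def)
    qed
  qed
  then show "integrable lborel (overlap_density \<theta>)"
    and "(LINT x|lborel. overlap_density \<theta> x) = 1 - outlier_mass \<theta>"
    by (simp_all add: has_bochner_integral_iff)
qed

text \<open>
  The two roots of \<open>w\<^sup>2 - z w + 1 = 0\<close> have product 1, and neither is on the unit circle, where
  \<open>w + 1 / w\<close> would be real. In terms of the small root \<open>w\<close> all limits become rational.
\<close>

lemma upper_half_plane_joukowski:
  assumes "Im z > 0"
  obtains w where "w \<noteq> 0" "cmod w < 1" "z = w + 1 / w" "Im (1 / w) > 0"
proof -
  note concl = that
  define s where "s = csqrt (z\<^sup>2 - 4)"
  have "s\<^sup>2 = z\<^sup>2 - 4" by (simp add: s_def)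
  then have p: "(z + s) / 2 * ((z - s) / 2) = 1" by (simp add: algebra_simps power2_eq_square)
  have main: thesis if w: "w * v = 1" "z = w + v" "cmod w \<le> cmod v" for w v
  proof -
    have "w \<noteq> 0" using w(1) by auto
    then have nz: "w \<noteq> 0" "v = 1 / w" using w(1) by (simp_all add: nonzero_eq_divide_eq mult.commute)
    have n: "cmod w * cmod v = 1" using w(1) by (metis norm_mult norm_one)
    have Imv: "Im (1 / w) = - Im w / (cmod w)\<^sup>2"
      by (simp add: Im_divide cmod_power2)
    have "(cmod w)\<^sup>2 \<le> 1" using mult_left_mono[OF w(3) norm_ge_zero[of w]] n by (simp add: power2_eq_square)
    then have le: "cmod w \<le> 1" using power_le_one_iff[of "cmod w" 2] by simp
    have Imz: "Im z = - Im w * (1 / (cmod w)\<^sup>2 - 1)"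
      using w(2) nz Imv by (simp add: algebra_simps)
    have "cmod w \<noteq> 1" using Imz assms by auto
    with le have lt: "cmod w < 1" by simp
    have sq: "0 < (cmod w)\<^sup>2" "(cmod w)\<^sup>2 < 1" using nz lt by (auto simp: power_less_one_iff)
    then have "0 < 1 / (cmod w)\<^sup>2 - 1" by simp
    then have "0 < - Im w" using assms zero_less_mult_pos2[of "- Im w" "1 / (cmod w)\<^sup>2 - 1"] Imz by simp
    then have "Im (1 / w) > 0" unfolding Imv using sq(1) by (rule divide_pos_pos)
    moreover have "z = w + 1 / w" using w(2) nz(2) by simp
    ultimately show thesis using concl nz(1) lt by blast
  qed
  show thesis
  proof (cases "cmod ((z + s) / 2) \<le> cmod ((z - s) / 2)")
    case True
    then show thesis using main[OF p] by (simp add: field_simps)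
  next
    case False
    then show thesis using main[of "(z - s) / 2" "(z + s) / 2"] p by (simp add: field_simps)
  qed
qed

lemma stieltjes_sc:
  fixes w :: complex
  assumes "w \<noteq> 0" "cmod w < 1" "z = w + 1 / w"
  shows "integrable lborel (\<lambda>x. of_real (sc_density x) * (1 / (of_real x - z)))"
    and "(LINT x|lborel. of_real (sc_density x) * (1 / (of_real x - z))) = - w"
proof -
  define A where "A x = 1 + w\<^sup>2 - w * of_real x" for x
  have "of_real x - z = - A x / w" for x
    using assms by (simp add: A_def field_simps power2_eq_square)
  then have e': "of_real (sc_density x) * (1 / (of_real x - z)) = - w * (of_real (sc_density x) * (1 / A x))" for x
    by simp
  note e = e'[unfolded A_def]
  show "integrable lborel (\<lambda>x. of_real (sc_density x) * (1 / (of_real x - z)))"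
    unfolding e by (intro integrable_mult_right integral_sc_generating assms)
  show "(LINT x|lborel. of_real (sc_density x) * (1 / (of_real x - z))) = - w"
    unfolding e integral_mult_right_zero integral_sc_generating(2)[OF assms(2)] by simp
qed

text \<open>
  The limiting measure of the overlaps is \<open>overlap_density\<close> together with an atom of mass
  \<open>outlier_mass \<theta>\<close> at the outlier \<open>\<theta> + 1 / \<theta>\<close>. Its Stieltjes transform reduces to that of the
  semicircle law by partial fractions. The total mass 1, with the atom counted in, makes the same
  formula hold on both sides of \<open>\<theta> = 1\<close>.
\<close>

lemma stieltjes_overlap:
  fixes w :: complex
  assumes \<theta>: "\<theta> > 0" and w: "w \<noteq> 0" "cmod w < 1" "z = w + 1 / w" and z: "Im z > 0" and w': "Im (1 / w) > 0"
  shows "(LINT x|lborel. of_real (overlap_density \<theta> x) * (1 / (of_real x - z))) +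
     of_real (outlier_mass \<theta>) * (1 / (of_real (\<theta> + 1 / \<theta>) - z)) = - w / (1 - of_real \<theta> * w)"
proof -
  define Z where "Z = \<theta> + 1 / \<theta>"
  have Zz: "complex_of_real Z - z \<noteq> 0" using z by (auto simp: complex_eq_iff)
  have xz: "complex_of_real x - z \<noteq> 0" for x using z by (auto simp: complex_eq_iff)
  have tw: "1 - of_real \<theta> * w \<noteq> 0"
  proof
    assume "1 - of_real \<theta> * w = 0"
    then have "1 / w = of_real \<theta>" using w by (simp add: field_simps)
    then show False using w' by simp
  qed
  \<comment> \<open>Partial fractions in the two poles z and \<theta> + 1 / \<theta>.\<close>
  have e: "of_real (overlap_density \<theta> x) * (1 / (of_real x - z)) =
     (of_real (1 / \<theta>) * (of_real (sc_density x) * (1 / (of_real x - z))) + of_real (overlap_density \<theta> x)) / (of_real Z - z)"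
    for x
  proof (cases "x \<in> {-2<..<2}")
    case True
    have Zx: "Z - x \<noteq> 0" using profile_denominator_pos[OF \<theta>, of x] True \<theta>
      by (auto simp: Z_def field_simps power2_eq_square)
    have p: "overlap_density \<theta> x = sc_density x * (1 / \<theta>) * (1 / (Z - x))"
      by (simp add: overlap_density_def overlap_profile_def Z_def)
    have Zx': "complex_of_real Z - of_real x \<noteq> 0" using Zx by (metis of_real_diff of_real_eq_0_iff)
    have "1 / (of_real Z - of_real x) * (1 / (of_real x - z)) =
       (1 / (of_real x - z) + 1 / (of_real Z - of_real x)) / (complex_of_real Z - z)"
      using Zz xz[of x] Zx' by (simp add: divide_simps)
    then have "of_real (sc_density x) * of_real (1 / \<theta>) * (1 / (of_real Z - of_real x) * (1 / (of_real x - z))) =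
       of_real (sc_density x) * of_real (1 / \<theta>) * ((1 / (of_real x - z) + 1 / (of_real Z - of_real x)) / (complex_of_real Z - z))"
      by simp
    then show ?thesis unfolding p by (simp add: algebra_simps add_divide_distrib)
  qed (simp add: sc_density_outside overlap_density_outside)
  have i: "integrable lborel (\<lambda>x. complex_of_real (overlap_density \<theta> x))"
    by (intro integrable_of_real integral_overlap_density \<theta>)
  have "(LINT x|lborel. of_real (overlap_density \<theta> x) * (1 / (of_real x - z))) =
     (of_real (1 / \<theta>) * (- w) + of_real (1 - outlier_mass \<theta>)) / (of_real Z - z)"
    unfolding e integral_divide_zero
      Bochner_Integration.integral_add[OF integrable_mult_right[OF stieltjes_sc(1)[OF w]] i]
      integral_mult_right_zero stieltjes_sc(2)[OF w] integral_complex_of_real integral_overlap_density(2)[OF \<theta>] ..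
  then have "(LINT x|lborel. of_real (overlap_density \<theta> x) * (1 / (of_real x - z))) +
     of_real (outlier_mass \<theta>) * (1 / (of_real (\<theta> + 1 / \<theta>) - z)) = (1 - w / of_real \<theta>) / (of_real Z - z)"
    unfolding Z_def[symmetric] using Zz by (simp add: add_divide_distrib diff_divide_distrib)
  also have "\<dots> = - w / (1 - of_real \<theta> * w)"
  proof -
    have "(1 - w / of_real \<theta>) * (1 - of_real \<theta> * w) = - w * (of_real Z - z)"
      unfolding w(3) Z_def using w(1) \<theta> by (simp add: field_simps)
    then show ?thesis by (subst frac_eq_eq[OF Zz tw])
  qed
  finally show ?thesis .
qed

section \<open>Threshold, lower bound and monotonicity\<close>

lemma set_integral_pos:
  fixes g :: "real \<Rightarrow> real"
  assumes "integrable lborel g" "a < b" "\<And>x. x \<in> {a..b} \<Longrightarrow> 0 \<le> g x" "\<And>x. x \<in> {a<..<b} \<Longrightarrow> 0 < g x"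
  shows "0 < (LINT x:{a..b}|lborel. g x)"
proof -
  let ?h = "\<lambda>x. indicator {a..b} x *\<^sub>R g x"
  have i: "integrable lborel ?h" using assms(1) by (intro integrable_mult_indicator) auto
  have nn: "AE x in lborel. 0 \<le> ?h x" using assms(3) by (intro AE_I2) (auto simp: indicator_def)
  have "0 \<le> integral\<^sup>L lborel ?h" using nn by (rule integral_nonneg_AE)
  moreover have "integral\<^sup>L lborel ?h \<noteq> 0"
  proof
    assume "integral\<^sup>L lborel ?h = 0"
    then have "AE x in lborel. ?h x = 0" using integral_nonneg_eq_0_iff_AE[OF i nn] by simp
    then have "AE x in lborel. x \<notin> {a<..<b}"
      by (rule AE_mp) (use assms(4) in \<open>force intro!: AE_I2 simp: indicator_def split: if_splits\<close>)
    then have "emeasure lborel {a<..<b} = 0"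
      by (subst (asm) AE_iff_measurable[of "{a<..<b}"]) auto
    then show False using assms(2) by simp
  qed
  ultimately show ?thesis unfolding set_lebesgue_integral_def by linarith
qed

lemma set_integral_split:
  fixes g :: "real \<Rightarrow> real"
  assumes "integrable lborel g" "a \<le> m" "m \<le> b"
  shows "(LINT x:{a..b}|lborel. g x) = (LINT x:{a..m}|lborel. g x) + (LINT x:{m..b}|lborel. g x)"
proof -
  have s: "set_integrable lborel A g" if "A \<in> sets borel" for A
    unfolding set_integrable_def using assms(1) that by (intro integrable_mult_indicator) auto
  have "{a..b} = {a..m} \<union> {m..b}" using assms by auto
  moreover have "AE x in lborel. \<not> (x \<in> {a..m} \<and> x \<in> {m..b})"
    using AE_lborel_singleton[of m] by (rule AE_mp) (intro AE_I2, auto)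
  ultimately show ?thesis by (simp only:) (rule set_integral_Un_AE, auto intro: s)
qed

lemma set_integral_whole:
  fixes g :: "real \<Rightarrow> real"
  assumes "\<And>x. x \<notin> A \<Longrightarrow> g x = 0"
  shows "(LINT x:A|lborel. g x) = (LINT x|lborel. g x)"
  unfolding set_lebesgue_integral_def using assms
  by (intro Bochner_Integration.integral_cong refl) (auto simp: indicator_def)

lemma isCont_upper_integral:
  fixes g :: "real \<Rightarrow> real"
  assumes "integrable lborel g"
  shows "isCont (\<lambda>t. LINT x:{t..b}|lborel. g x) m"
  unfolding continuous_at_sequentially
proof (intro allI impI)
  fix s :: "nat \<Rightarrow> real" assume s: "s \<longlonglongrightarrow> m"
  have gm: "g \<in> borel_measurable lborel" using assms by auto
  show "((\<lambda>t. LINT x:{t..b}|lborel. g x) \<circ> s) \<longlonglongrightarrow> (LINT x:{m..b}|lborel. g x)"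
    unfolding o_def set_lebesgue_integral_def
  proof (rule integral_dominated_convergence[where w = "\<lambda>x. \<bar>g x\<bar>"])
    have "AE x in lborel. x \<noteq> m" by (rule AE_lborel_singleton)
    then show "AE x in lborel. (\<lambda>i. indicator {s i..b} x *\<^sub>R g x) \<longlonglongrightarrow> indicator {m..b} x *\<^sub>R g x"
    proof (rule AE_mp, intro AE_I2 impI)
      fix x assume "x \<noteq> m"
      then consider "m < x" | "x < m" by linarith
      then have "\<forall>\<^sub>F i in sequentially. indicator {s i..b} x = (indicator {m..b} x :: real)"
      proof cases
        case 1
        then show ?thesis
          by (intro eventually_mono[OF order_tendstoD(2)[OF s 1]]) (simp add: indicator_def)
      next
        case 2
        then show ?thesis
          by (intro eventually_mono[OF order_tendstoD(1)[OF s 2]]) (simp add: indicator_def)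
      qed
      then have "\<forall>\<^sub>F i in sequentially. indicator {s i..b} x *\<^sub>R g x = indicator {m..b} x *\<^sub>R g x"
        by (rule eventually_mono) simp
      then show "(\<lambda>i. indicator {s i..b} x *\<^sub>R g x) \<longlonglongrightarrow> indicator {m..b} x *\<^sub>R g x"
        by (rule tendsto_eventually)
    qed
  qed (use assms gm in \<open>auto simp: indicator_def\<close>)
qed

definition sc_tail :: "real \<Rightarrow> real" where
  "sc_tail m = (LINT x:{m..2}|lborel. sc_density x)"

lemma sc_tail_strict: "-2 \<le> m \<Longrightarrow> m < m' \<Longrightarrow> m' \<le> 2 \<Longrightarrow> sc_tail m' < sc_tail m"
  using set_integral_split[OF integrable_sc, of m m' 2]
    set_integral_pos[OF integrable_sc, of m m'] sc_density_nonneg sc_density_pos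
  by (simp add: sc_tail_def)

lemma sc_tail_ends: "sc_tail (-2) = 1" "sc_tail 2 = 0"
proof -
  show "sc_tail (-2) = 1"
    unfolding sc_tail_def by (subst set_integral_whole) (auto simp: sc_density_outside integral_sc)
  show "sc_tail 2 = 0"
    unfolding sc_tail_def set_lebesgue_integral_def
    by (rule integral_eq_zero_AE) (auto simp: indicator_def sc_density_outside)
qed

text \<open>
  The tail mass is continuous and strictly decreasing on the support, so the description by \<open>THE\<close>
  picks out a unique point.
\<close>

lemma sc_threshold:
  assumes "0 < c" "c \<le> 1"
  shows "-2 \<le> sc_threshold c" "sc_threshold c < 2" "sc_tail (sc_threshold c) = c"
proof -
  have "\<exists>m. -2 \<le> m \<and> m \<le> 2 \<and> sc_tail m = c"
  proof (rule IVT2')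
    show "continuous_on {-2..2} sc_tail"
      unfolding sc_tail_def by (intro continuous_at_imp_continuous_on ballI isCont_upper_integral integrable_sc)
  qed (use assms sc_tail_ends in auto)
  then obtain m where m: "-2 \<le> m" "m \<le> 2" "sc_tail m = c" by auto
  have "sc_threshold c = m"
    unfolding sc_threshold_def
  proof (rule the_equality)
    show "-2 \<le> m \<and> m \<le> 2 \<and> c = (LINT x:{m..2}|lborel. sc_density x)"
      using m by (simp add: sc_tail_def)
    fix m' assume "-2 \<le> m' \<and> m' \<le> 2 \<and> c = (LINT x:{m'..2}|lborel. sc_density x)"
    then have m': "-2 \<le> m'" "m' \<le> 2" "sc_tail m' = c" by (auto simp: sc_tail_def)
    show "m' = m"
      using sc_tail_strict[of m m'] sc_tail_strict[of m' m] m m' by (cases m m' rule: linorder_cases) auto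
  qed
  moreover have "m \<noteq> 2" using m assms sc_tail_ends by auto
  ultimately show "-2 \<le> sc_threshold c" "sc_threshold c < 2" "sc_tail (sc_threshold c) = c"
    using m by auto
qed

lemma sc_threshold_strict:
  assumes "0 < c" "c < c'" "c' \<le> 1"
  shows "sc_threshold c' < sc_threshold c"
proof (rule ccontr)
  assume "\<not> ?thesis"
  then have "sc_tail (sc_threshold c') \<le> sc_tail (sc_threshold c)"
    using sc_tail_strict[of "sc_threshold c" "sc_threshold c'"] sc_threshold[of c] sc_threshold[of c'] assms
    by (cases "sc_threshold c' = sc_threshold c") auto
  then show False using sc_threshold(3)[of c] sc_threshold(3)[of c'] assms by simp
qed

lemma overlap_integral_eq:
  "overlap_integral \<theta> c = (LINT x:{sc_threshold c..2}|lborel. overlap_density \<theta> x)"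
  by (simp add: overlap_integral_def overlap_density_def)

lemma overlap_whole: "(LINT x:{-2..2}|lborel. overlap_density \<theta> x) = (LINT x|lborel. overlap_density \<theta> x)"
  by (rule set_integral_whole) (auto simp: overlap_density_outside)

lemma overlap_total:
  assumes "\<theta> > 0" "-2 \<le> m" "m \<le> 2"
  shows "(LINT x:{-2..m}|lborel. overlap_density \<theta> x) + (LINT x:{m..2}|lborel. overlap_density \<theta> x) + outlier_mass \<theta> = 1"
  using set_integral_split[OF integral_overlap_density(1)[OF assms(1)] assms(2,3)]
    overlap_whole integral_overlap_density(2)[OF assms(1)]
  by simp

lemma outlier_mass_nonneg: "\<theta> > 0 \<Longrightarrow> 0 \<le> outlier_mass \<theta>"
  by (auto simp: outlier_mass_def)

lemma outlier_mass_mono: "0 < \<theta> \<Longrightarrow> \<theta> \<le> \<theta>' \<Longrightarrow> outlier_mass \<theta> \<le> outlier_mass \<theta>'"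
  by (auto simp: outlier_mass_def intro!: divide_left_mono power_mono mult_pos_pos)

lemma set_integrable_lborel: "integrable lborel (g :: real \<Rightarrow> real) \<Longrightarrow> A \<in> sets borel \<Longrightarrow> set_integrable lborel A g"
  unfolding set_integrable_def by (intro integrable_mult_indicator) auto

text \<open>
  The profile \<open>p\<close> increases in \<open>x\<close> and the total mass is 1. If \<open>p \<ge> 1\<close> above the threshold, compare
  with the semicircle there; otherwise \<open>p \<le> 1\<close> below the threshold, and the mass below is at most
  \<open>1 - c\<close>.
\<close>

theorem overlap_ge:
  assumes "\<theta> > 0" "0 < c" "c \<le> 1"
  shows "c \<le> overlap_integral \<theta> c + outlier_mass \<theta>"
proof -
  define m where "m = sc_threshold c"
  have m: "-2 \<le> m" "m < 2" "sc_tail m = c" using sc_threshold[OF assms(2,3)] by (auto simp: m_def)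
  note i = integral_overlap_density(1)[OF assms(1)]
  have mono: "overlap_profile x \<theta> \<le> overlap_profile y \<theta>" if "x \<le> y" "y < 2" for x y
    unfolding overlap_profile_eq[OF assms(1)]
    using that assms(1) profile_denominator_pos[OF assms(1), of x] profile_denominator_pos[OF assms(1), of y]
    by (intro divide_left_mono mult_pos_pos) auto
  show ?thesis
  \<comment> \<open>The profile increases, so it is at least 1 on the whole upper part or at most 1 on the whole
     lower part.\<close>
  proof (cases "1 \<le> overlap_profile m \<theta>")
    case True
    have "c = (LINT x:{m..2}|lborel. sc_density x)" using m(3) by (simp add: sc_tail_def)
    also have "\<dots> \<le> (LINT x:{m..2}|lborel. overlap_density \<theta> x)"
    proof (rule set_integral_mono)
      fix x assume x: "x \<in> {m..2}"
      show "sc_density x \<le> overlap_density \<theta> x"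
      proof (cases "x < 2")
        case lt: True
        have "1 \<le> overlap_profile x \<theta>" using True mono[of m x] x lt by simp
        then show ?thesis using sc_density_nonneg[of x] mult_left_mono[of 1 "overlap_profile x \<theta>" "sc_density x"]
          by (simp add: overlap_density_def)
      qed (simp add: overlap_density_outside sc_density_outside)
    qed (auto intro!: set_integrable_lborel i integrable_sc)
    finally show ?thesis using outlier_mass_nonneg[OF assms(1)] by (simp add: overlap_integral_eq m_def)
  next
    case False
    have "(LINT x:{-2..m}|lborel. overlap_density \<theta> x) \<le> (LINT x:{-2..m}|lborel. sc_density x)"
    proof (rule set_integral_mono)
      fix x assume x: "x \<in> {-2..m}"
      have "overlap_profile x \<theta> \<le> 1" using False mono[of x m] x m by simp
      then show "overlap_density \<theta> x \<le> sc_density x"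
        using sc_density_nonneg[of x] mult_left_mono[of "overlap_profile x \<theta>" 1 "sc_density x"]
        by (simp add: overlap_density_def)
    qed (auto intro!: set_integrable_lborel i integrable_sc)
    also have "\<dots> = 1 - c"
      using set_integral_split[OF integrable_sc, of "-2" m 2] m sc_tail_ends by (simp add: sc_tail_def)
    finally show ?thesis using overlap_total[OF assms(1), of m] m by (simp add: overlap_integral_eq m_def)
  qed
qed

theorem overlap_strict_mono_c:
  assumes "\<theta> > 0" "0 < c" "c < c'" "c' \<le> 1"
  shows "overlap_integral \<theta> c < overlap_integral \<theta> c'"
proof -
  have lt: "sc_threshold c' < sc_threshold c" using sc_threshold_strict[of c c'] assms by simp
  have "-2 \<le> sc_threshold c'" "sc_threshold c < 2" using sc_threshold[of c] sc_threshold[of c'] assms by auto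
  then show ?thesis
    using lt set_integral_split[OF integral_overlap_density(1)[OF assms(1)], of "sc_threshold c'" "sc_threshold c" 2]
      set_integral_pos[OF integral_overlap_density(1)[OF assms(1)] lt] overlap_density_nonneg[OF assms(1)]
      overlap_density_pos[OF assms(1)]
    by (auto simp: overlap_integral_eq)
qed

lemma overlap_at_1:
  assumes "\<theta> > 0"
  shows "overlap_integral \<theta> 1 + outlier_mass \<theta> = 1"
proof -
  have "sc_threshold 1 \<le> -2"
  proof (rule ccontr)
    assume "\<not> sc_threshold 1 \<le> -2"
    then have "sc_tail (sc_threshold 1) < sc_tail (-2)" using sc_threshold(2)[of 1] by (intro sc_tail_strict) auto
    then show False using sc_threshold(3)[of 1] sc_tail_ends by simp
  qed
  then have "sc_threshold 1 = -2" using sc_threshold(1)[of 1] by simp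
  then show ?thesis
    using overlap_whole integral_overlap_density(2)[OF assms] by (simp add: overlap_integral_eq)
qed

text \<open>
  The difference of the two profiles changes sign once, at \<open>x = \<theta> + \<theta>'\<close>. As both measures have total
  mass 1, it suffices that the smaller parameter gives more mass below the threshold.
\<close>

theorem overlap_strict_mono_theta:
  assumes "0 < \<theta>" "\<theta> < \<theta>'" "0 < c" "c < 1"
  shows "overlap_integral \<theta> c + outlier_mass \<theta> < overlap_integral \<theta>' c + outlier_mass \<theta>'"
proof -
  define m where "m = sc_threshold c"
  have \<theta>': "0 < \<theta>'" using assms by simp
  have m: "-2 \<le> m" "m < 2" using sc_threshold[of c] assms by (auto simp: m_def)
  have "m \<noteq> -2" using sc_threshold(3)[of c] assms sc_tail_ends by (auto simp: m_def)
  then have m': "-2 < m" using m by simp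
  note i = integral_overlap_density(1)[OF assms(1)] integral_overlap_density(1)[OF \<theta>']
  define d where "d x = overlap_density \<theta> x - overlap_density \<theta>' x" for x
  have id: "integrable lborel d" unfolding d_def[abs_def] using i by simp
  have Id: "(LINT x:A|lborel. d x) = (LINT x:A|lborel. overlap_density \<theta> x) - (LINT x:A|lborel. overlap_density \<theta>' x)"
    if "A \<in> sets borel" for A
    unfolding d_def using i that by (intro set_integral_diff set_integrable_lborel) auto
  have d: "d x = sc_density x * ((\<theta>' - \<theta>) * (\<theta> + \<theta>' - x) / ((1 + \<theta>\<^sup>2 - \<theta> * x) * (1 + \<theta>'\<^sup>2 - \<theta>' * x)))"
    if "x < 2" for x
  proof -
    have "1 / (1 + \<theta>\<^sup>2 - \<theta> * x) - 1 / (1 + \<theta>'\<^sup>2 - \<theta>' * x) =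
      ((1 + \<theta>'\<^sup>2 - \<theta>' * x) - (1 + \<theta>\<^sup>2 - \<theta> * x)) / ((1 + \<theta>\<^sup>2 - \<theta> * x) * (1 + \<theta>'\<^sup>2 - \<theta>' * x))"
      using profile_denominator_pos[OF assms(1) that] profile_denominator_pos[OF \<theta>' that]
      by (subst diff_frac_eq) auto
    also have "(1 + \<theta>'\<^sup>2 - \<theta>' * x) - (1 + \<theta>\<^sup>2 - \<theta> * x) = (\<theta>' - \<theta>) * (\<theta> + \<theta>' - x)"
      by (simp add: power2_eq_square algebra_simps)
    finally show ?thesis
      unfolding d_def overlap_density_def overlap_profile_eq[OF assms(1)] overlap_profile_eq[OF \<theta>']
      by (simp add: right_diff_distrib[symmetric] del: times_divide_eq_right)
  qed
  have dpos: "0 < d x" if "x \<in> {-2<..<2}" "x < \<theta> + \<theta>'" for x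
    using that assms sc_density_pos[of x] profile_denominator_pos[OF assms(1), of x] profile_denominator_pos[OF \<theta>', of x]
    by (subst d) (auto intro!: mult_pos_pos divide_pos_pos)
  have dneg: "0 < - d x" if "x \<in> {-2<..<2}" "\<theta> + \<theta>' < x" for x
  proof -
    have "0 < sc_density x * ((\<theta>' - \<theta>) * (x - (\<theta> + \<theta>')) / ((1 + \<theta>\<^sup>2 - \<theta> * x) * (1 + \<theta>'\<^sup>2 - \<theta>' * x)))"
      using that assms sc_density_pos[of x] profile_denominator_pos[OF assms(1), of x] profile_denominator_pos[OF \<theta>', of x]
      by (auto intro!: mult_pos_pos divide_pos_pos)
    also have "\<dots> = - d x" using that by (subst d) (auto simp: algebra_simps minus_divide_left)
    finally show ?thesis .
  qed
  have d0: "d x = 0" if "x \<notin> {-2<..<2}" for x using that by (simp add: d_def overlap_density_outside)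
  have dz: "d x = 0" if "x = \<theta> + \<theta>'" for x
    using that d[of x] d0[of x] by (cases "x < 2") auto
  have "0 < (LINT x:{-2..m}|lborel. d x)"
  \<comment> \<open>d is positive to the left of its zero and negative to the right of it. If the zero lies to
     the left of m, the sign on the right part and the sign of the total mass decide.\<close>
  proof (cases "m \<le> \<theta> + \<theta>'")
    case True
    show ?thesis
    proof (rule set_integral_pos[OF id m'])
      show pos: "0 < d x" if "x \<in> {-2<..<m}" for x using dpos[of x] that True m by auto
      show "0 \<le> d x" if "x \<in> {-2..m}" for x
        using dpos[of x] dz[of x] d0[of x] that True m by (cases "x = \<theta> + \<theta>'"; cases "x = -2") (auto simp: less_imp_le)
    qed
  next
    case False
    have "0 < (LINT x:{m..2}|lborel. - d x)"
    proof (rule set_integral_pos)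
      show "0 < - d x" if "x \<in> {m<..<2}" for x using dneg[of x] that False m' by auto
      show "0 \<le> - d x" if "x \<in> {m..2}" for x
        using dneg[of x] d0[of x] that False m' by (cases "x = 2") (auto simp: less_imp_le)
    qed (use id m in auto)
    then have "(LINT x:{m..2}|lborel. d x) < 0" by (simp add: set_lebesgue_integral_def)
    moreover have "0 \<le> (LINT x:{-2..m}|lborel. d x) + (LINT x:{m..2}|lborel. d x)"
      using overlap_total[OF assms(1) m(1)] overlap_total[OF \<theta>' m(1)] m outlier_mass_mono[of \<theta> \<theta>'] assms
      by (simp add: Id)
    ultimately show ?thesis by simp
  qed
  then show ?thesis
    using overlap_total[OF assms(1) m(1)] overlap_total[OF \<theta>' m(1)] m by (simp add: Id overlap_integral_eq m_def)
qed

section \<open>Events of probability tending to one\<close>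

text \<open>
  With probability tending to 1. The exceptional set need only be contained in a measurable set of
  vanishing measure, so that \<open>Q\<close> can be any predicate of the eigenvalues and eigenvectors.
\<close>

definition whp :: "(nat \<Rightarrow> 'a measure) \<Rightarrow> (nat \<Rightarrow> 'a \<Rightarrow> bool) \<Rightarrow> bool" where
  "whp M Q \<longleftrightarrow> (\<exists>A. (\<forall>N. A N \<in> sets (M N)) \<and> (\<forall>N>0. \<forall>\<omega>\<in>space (M N). \<not> Q N \<omega> \<longrightarrow> \<omega> \<in> A N) \<and>
     (\<lambda>N. measure (M N) (A N)) \<longlonglongrightarrow> 0)"

lemma whpI:
  assumes "\<And>N. A N \<in> sets (M N)" "\<And>N \<omega>. N > 0 \<Longrightarrow> \<omega> \<in> space (M N) \<Longrightarrow> \<not> Q N \<omega> \<Longrightarrow> \<omega> \<in> A N"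
    "(\<lambda>N. measure (M N) (A N)) \<longlonglongrightarrow> 0"
  shows "whp M Q"
  unfolding whp_def using assms by (intro exI[of _ A]) auto

lemma whp_mono:
  assumes "whp M Q" "\<And>N \<omega>. N > 0 \<Longrightarrow> \<omega> \<in> space (M N) \<Longrightarrow> Q N \<omega> \<Longrightarrow> Q' N \<omega>"
  shows "whp M Q'"
  using assms unfolding whp_def by meson

lemma whp_conj:
  assumes "whp M Q" "whp M Q'"
  shows "whp M (\<lambda>N \<omega>. Q N \<omega> \<and> Q' N \<omega>)"
proof -
  obtain A where A: "\<And>N. A N \<in> sets (M N)" "\<And>N \<omega>. N > 0 \<Longrightarrow> \<omega> \<in> space (M N) \<Longrightarrow> \<not> Q N \<omega> \<Longrightarrow> \<omega> \<in> A N"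
    "(\<lambda>N. measure (M N) (A N)) \<longlonglongrightarrow> 0" using assms(1) unfolding whp_def by blast
  obtain A' where A': "\<And>N. A' N \<in> sets (M N)" "\<And>N \<omega>. N > 0 \<Longrightarrow> \<omega> \<in> space (M N) \<Longrightarrow> \<not> Q' N \<omega> \<Longrightarrow> \<omega> \<in> A' N"
    "(\<lambda>N. measure (M N) (A' N)) \<longlonglongrightarrow> 0" using assms(2) unfolding whp_def by blast
  show ?thesis
  proof (rule whpI)
    show "A N \<union> A' N \<in> sets (M N)" for N using A A' by auto
    show "(\<lambda>N. measure (M N) (A N \<union> A' N)) \<longlonglongrightarrow> 0"
    proof (rule tendsto_sandwich[OF _ _ tendsto_const])
      show "(\<lambda>N. measure (M N) (A N) + measure (M N) (A' N)) \<longlonglongrightarrow> 0"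
        using tendsto_add[OF A(3) A'(3)] by simp
      show "\<forall>\<^sub>F N in sequentially. measure (M N) (A N \<union> A' N) \<le> measure (M N) (A N) + measure (M N) (A' N)"
        using A A' by (intro always_eventually allI measure_Un_le)
    qed auto
    show "\<omega> \<in> A N \<union> A' N" if "N > 0" "\<omega> \<in> space (M N)" "\<not> (Q N \<omega> \<and> Q' N \<omega>)" for N \<omega>
      using that A(2) A'(2) by blast
  qed
qed

lemma whp_eventually:
  assumes "\<forall>\<^sub>F N in sequentially. \<forall>\<omega>\<in>space (M N). Q N \<omega>"
  shows "whp M Q"
proof (rule whpI)
  let ?A = "\<lambda>N. if \<forall>\<omega>\<in>space (M N). Q N \<omega> then {} else space (M N)"
  show "?A N \<in> sets (M N)" for N by simp
  show "(\<lambda>N. measure (M N) (?A N)) \<longlonglongrightarrow> 0"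
    using assms by (intro tendsto_eventually) (auto elim: eventually_mono)
qed auto

lemma whp_all_less:
  fixes n :: nat
  assumes "\<And>k. k < n \<Longrightarrow> whp M (Q k)"
  shows "whp M (\<lambda>N \<omega>. \<forall>k<n. Q k N \<omega>)"
  using assms
proof (induction n)
  case 0
  show ?case by (rule whp_eventually) simp
next
  case (Suc n)
  have "whp M (\<lambda>N \<omega>. (\<forall>k<n. Q k N \<omega>) \<and> Q n N \<omega>)" using Suc by (intro whp_conj) auto
  then show ?case by (rule whp_mono) (auto simp: less_Suc_eq)
qed

lemma whp_imp_tendsto_in_prob:
  assumes M: "\<And>N. prob_space (M N)" and "\<And>\<epsilon>. \<epsilon> > 0 \<Longrightarrow> whp M (\<lambda>N \<omega>. \<bar>X N \<omega> - l\<bar> \<le> \<epsilon>)"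
  shows "tendsto_in_prob M X l"
  unfolding tendsto_in_prob_def
proof (intro allI impI)
  fix \<epsilon> :: real assume "\<epsilon> > 0"
  from assms(2)[OF this] obtain A where A: "\<And>N. A N \<in> sets (M N)"
    "\<And>N \<omega>. N > 0 \<Longrightarrow> \<omega> \<in> space (M N) \<Longrightarrow> \<not> \<bar>X N \<omega> - l\<bar> \<le> \<epsilon> \<Longrightarrow> \<omega> \<in> A N"
    "(\<lambda>N. measure (M N) (A N)) \<longlonglongrightarrow> 0" unfolding whp_def by blast
  show "(\<lambda>N. measure (M N) {\<omega> \<in> space (M N). \<epsilon> < \<bar>X N \<omega> - l\<bar>}) \<longlonglongrightarrow> 0"
  proof (rule tendsto_sandwich[OF _ _ _ A(3)])
    show "\<forall>\<^sub>F N in sequentially. measure (M N) {\<omega> \<in> space (M N). \<epsilon> < \<bar>X N \<omega> - l\<bar>} \<le> measure (M N) (A N)"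
    proof (rule eventually_mono[OF eventually_gt_at_top[of 0]])
      fix N :: nat assume "0 < N"
      interpret prob_space "M N" by (rule M)
      show "measure (M N) {\<omega> \<in> space (M N). \<epsilon> < \<bar>X N \<omega> - l\<bar>} \<le> measure (M N) (A N)"
        using A(1) A(2)[OF \<open>0 < N\<close>] by (intro finite_measure_mono) fastforce+
    qed
  qed auto
qed

section \<open>From Stieltjes transforms to masses of intervals\<close>

text \<open>
  \<open>pi\<close> times the Poisson kernel of the upper half plane, as a function of the boundary point \<open>x\<close>.
\<close>

definition poisson :: "real \<Rightarrow> real \<Rightarrow> real \<Rightarrow> real" where
  "poisson E \<eta> x = Im (1 / (of_real x - Complex E \<eta>))"

lemma poisson_eq: "poisson E \<eta> x = \<eta> / ((x - E)\<^sup>2 + \<eta>\<^sup>2)"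
  by (simp add: poisson_def Im_divide)

lemma Im_mult_of_real: "Im (of_real r * z) = r * Im z"
  by simp

lemma poisson_measurable [measurable]: "poisson E \<eta> \<in> borel_measurable borel"
  unfolding poisson_eq[abs_def] by measurable

lemma stieltjes_kernel_bound: "Im z > 0 \<Longrightarrow> cmod (1 / (of_real x - z)) \<le> 1 / Im z"
  using abs_Im_le_cmod[of "of_real x - z"] by (simp add: norm_divide frac_le)

lemma poisson_abs_le: "\<eta> > 0 \<Longrightarrow> \<bar>poisson E \<eta> x\<bar> \<le> 1 / \<eta>"
  using order_trans[OF abs_Im_le_cmod stieltjes_kernel_bound[of "Complex E \<eta>" x]] by (simp add: poisson_def)

lemma poisson_lipschitz:
  assumes "\<eta> > 0"
  shows "\<bar>poisson E \<eta> x - poisson E' \<eta> x\<bar> \<le> \<bar>E - E'\<bar> / \<eta>\<^sup>2"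
proof -
  let ?z = "Complex E \<eta>" and ?z' = "Complex E' \<eta>"
  have nz: "of_real x - ?z \<noteq> 0" "of_real x - ?z' \<noteq> 0" using assms by (auto simp: complex_eq_iff)
  have "\<bar>poisson E \<eta> x - poisson E' \<eta> x\<bar> \<le> cmod (1 / (of_real x - ?z) - 1 / (of_real x - ?z'))"
    unfolding poisson_def minus_complex.sel(2)[symmetric] by (rule abs_Im_le_cmod)
  also have "1 / (of_real x - ?z) - 1 / (of_real x - ?z') =
      (?z - ?z') * ((1 / (of_real x - ?z)) * (1 / (of_real x - ?z')))"
    using nz by (simp add: field_simps)
  also have "cmod \<dots> \<le> \<bar>E - E'\<bar> * ((1 / \<eta>) * (1 / \<eta>))"
  proof -
    have "?z - ?z' = of_real (E - E')" by (simp add: complex_eq_iff)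
    then have "cmod (?z - ?z') = \<bar>E - E'\<bar>" by (simp only: norm_of_real)
    then show ?thesis
      unfolding norm_mult using assms stieltjes_kernel_bound[of ?z x] stieltjes_kernel_bound[of ?z' x]
      by (intro mult_mono) (auto simp del: divide_inverse)
  qed
  finally show ?thesis by (simp add: power2_eq_square)
qed

text \<open>
  The integral of the Poisson kernel over \<open>E\<close> from \<open>a\<close> to \<open>b\<close>: for small \<open>\<eta>\<close> a smooth version of the
  indicator of \<open>[a, b]\<close>.
\<close>

definition smooth_step :: "real \<Rightarrow> real \<Rightarrow> real \<Rightarrow> real \<Rightarrow> real" where
  "smooth_step \<eta> a b x = (arctan ((x - a) / \<eta>) - arctan ((x - b) / \<eta>)) / pi"

definition poisson_sum :: "real \<Rightarrow> real \<Rightarrow> real \<Rightarrow> nat \<Rightarrow> real \<Rightarrow> real" where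
  "poisson_sum \<eta> a b n x = ((b - a) / real n / pi) * (\<Sum>k<n. poisson (a + real k * ((b - a) / real n)) \<eta> x)"

text \<open>
  Uniformity in \<open>x\<close> is what allows finitely many Stieltjes transforms to control the mass of an
  interval.
\<close>

lemma smooth_step_riemann:
  assumes \<eta>: "\<eta> > 0" and ab: "a < b" and n: "n > 0"
  shows "\<bar>smooth_step \<eta> a b x - poisson_sum \<eta> a b n x\<bar> \<le> (b - a)\<^sup>2 / (pi * \<eta>\<^sup>2 * real n)"
proof -
  define h where "h = (b - a) / real n"
  have h: "h > 0" using ab n by (simp add: h_def)
  let ?E = "\<lambda>k. a + real k * h"
  let ?F = "\<lambda>E. - arctan ((x - E) / \<eta>)"
  have F: "(?F has_real_derivative poisson E \<eta> x) (at E)" for E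
  proof -
    have "1 / (1 + ((x - E) / \<eta>)\<^sup>2) * (1 / \<eta>) = poisson E \<eta> x"
    proof -
      have "1 + ((x - E) / \<eta>)\<^sup>2 = ((x - E)\<^sup>2 + \<eta>\<^sup>2) / \<eta>\<^sup>2" using \<eta> by (simp add: field_simps)
      then show ?thesis using \<eta> by (simp add: poisson_eq power2_eq_square)
    qed
    moreover have "(?F has_real_derivative 1 / (1 + ((x - E) / \<eta>)\<^sup>2) * (1 / \<eta>)) (at E)"
      using \<eta> by (auto intro!: derivative_eq_intros simp: inverse_eq_divide)
    ultimately show ?thesis by simp
  qed
  have cell: "\<bar>?F (?E (Suc k)) - ?F (?E k) - h * poisson (?E k) \<eta> x\<bar> \<le> h * (h / \<eta>\<^sup>2)" for k
  proof -
    have lt: "?E k < ?E (Suc k)" using h by (simp add: algebra_simps)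
    obtain \<xi> where \<xi>: "?E k < \<xi>" "\<xi> < ?E (Suc k)" "?F (?E (Suc k)) - ?F (?E k) = (?E (Suc k) - ?E k) * poisson \<xi> \<eta> x"
      using MVT2[OF lt F] by blast
    have d: "?E (Suc k) - ?E k = h" by (simp add: algebra_simps)
    have "?F (?E (Suc k)) - ?F (?E k) - h * poisson (?E k) \<eta> x = h * (poisson \<xi> \<eta> x - poisson (?E k) \<eta> x)"
      unfolding \<xi>(3) d by (simp add: algebra_simps)
    moreover have "\<bar>poisson \<xi> \<eta> x - poisson (?E k) \<eta> x\<bar> \<le> h / \<eta>\<^sup>2"
    proof -
      have "\<bar>poisson \<xi> \<eta> x - poisson (?E k) \<eta> x\<bar> \<le> \<bar>\<xi> - ?E k\<bar> / \<eta>\<^sup>2" by (rule poisson_lipschitz[OF \<eta>])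
      also have "\<dots> \<le> h / \<eta>\<^sup>2" using \<xi> d by (intro divide_right_mono) auto
      finally show ?thesis .
    qed
    ultimately show ?thesis using h by (simp only: abs_mult) (intro mult_mono, auto)
  qed
  have En: "?E n = b" "?E 0 = a" using n by (auto simp: h_def)
  have "(\<Sum>k<n. ?F (?E (Suc k)) - ?F (?E k)) = ?F (?E n) - ?F (?E 0)"
    by (rule sum_lessThan_telescope)
  then have tel: "(\<Sum>k<n. ?F (?E (Suc k)) - ?F (?E k)) = arctan ((x - a) / \<eta>) - arctan ((x - b) / \<eta>)"
    unfolding En by simp
  have "\<bar>(\<Sum>k<n. ?F (?E (Suc k)) - ?F (?E k) - h * poisson (?E k) \<eta> x)\<bar> \<le> (\<Sum>k<n. h * (h / \<eta>\<^sup>2))"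
    by (intro order_trans[OF sum_abs] sum_mono cell)
  also have "\<dots> = (b - a)\<^sup>2 / (\<eta>\<^sup>2 * real n)" using n by (simp add: h_def power2_eq_square)
  finally have "\<bar>(arctan ((x - a) / \<eta>) - arctan ((x - b) / \<eta>)) - h * (\<Sum>k<n. poisson (?E k) \<eta> x)\<bar> \<le>
      (b - a)\<^sup>2 / (\<eta>\<^sup>2 * real n)"
    unfolding sum_subtractf[of _ "\<lambda>k. h * poisson (?E k) \<eta> x"] tel sum_distrib_left .
  then have "\<bar>(arctan ((x - a) / \<eta>) - arctan ((x - b) / \<eta>)) - h * (\<Sum>k<n. poisson (?E k) \<eta> x)\<bar> / pi \<le>
      (b - a)\<^sup>2 / (\<eta>\<^sup>2 * real n) / pi" by (intro divide_right_mono) auto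
  moreover have "smooth_step \<eta> a b x - poisson_sum \<eta> a b n x =
     ((arctan ((x - a) / \<eta>) - arctan ((x - b) / \<eta>)) - h * (\<Sum>k<n. poisson (?E k) \<eta> x)) / pi"
    unfolding smooth_step_def poisson_sum_def h_def[symmetric] by (simp add: diff_divide_distrib)
  ultimately show ?thesis by (simp add: abs_divide mult_ac)
qed

lemma smooth_step_bounds:
  assumes "\<eta> > 0" "a < b"
  shows "0 \<le> smooth_step \<eta> a b x" "smooth_step \<eta> a b x \<le> 1"
proof -
  have "arctan ((x - b) / \<eta>) \<le> arctan ((x - a) / \<eta>)"
    using assms by (intro arctan_monotone' divide_right_mono) auto
  then show "0 \<le> smooth_step \<eta> a b x" by (simp add: smooth_step_def)
  have "arctan ((x - a) / \<eta>) - arctan ((x - b) / \<eta>) \<le> pi"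
    using arctan_bounded[of "(x - a) / \<eta>"] arctan_bounded[of "(x - b) / \<eta>"] by linarith
  then show "smooth_step \<eta> a b x \<le> 1" by (simp add: smooth_step_def)
qed

lemma smooth_step_outside:
  assumes \<eta>: "\<eta> > 0" and \<delta>: "x \<le> a - \<delta> \<or> b + \<delta> \<le> x" and ar: "pi / 2 - \<epsilon> * pi \<le> arctan (\<delta> / \<eta>)"
  shows "smooth_step \<eta> a b x \<le> \<epsilon>"
proof -
  have "arctan ((x - a) / \<eta>) - arctan ((x - b) / \<eta>) \<le> \<epsilon> * pi"
    using \<delta>
  proof
    assume "x \<le> a - \<delta>"
    then have "arctan ((x - a) / \<eta>) \<le> arctan (- (\<delta> / \<eta>))"
      using \<eta> divide_right_mono[of "x - a" "- \<delta>" \<eta>] by (intro arctan_monotone') auto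
    then show ?thesis using ar arctan_bounded[of "(x - b) / \<eta>"] unfolding arctan_minus by linarith
  next
    assume "b + \<delta> \<le> x"
    then have "arctan (\<delta> / \<eta>) \<le> arctan ((x - b) / \<eta>)"
      using \<eta> by (intro arctan_monotone' divide_right_mono) auto
    then show ?thesis using ar arctan_bounded[of "(x - a) / \<eta>"] by linarith
  qed
  then show ?thesis by (simp add: smooth_step_def divide_le_eq)
qed

lemma smooth_step_inside:
  assumes \<eta>: "\<eta> > 0" and x: "a + \<delta> \<le> x" "x \<le> b - \<delta>" and ar: "pi / 2 - \<epsilon> * pi \<le> arctan (\<delta> / \<eta>)"
  shows "1 - 2 * \<epsilon> \<le> smooth_step \<eta> a b x"
proof -
  have "arctan (\<delta> / \<eta>) \<le> arctan ((x - a) / \<eta>)"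
    using \<eta> x by (intro arctan_monotone' divide_right_mono) auto
  moreover have "arctan ((x - b) / \<eta>) \<le> arctan (- (\<delta> / \<eta>))"
    using \<eta> x divide_right_mono[of "x - b" "- \<delta>" \<eta>] by (intro arctan_monotone') auto
  ultimately have "(1 - 2 * \<epsilon>) * pi \<le> arctan ((x - a) / \<eta>) - arctan ((x - b) / \<eta>)"
    using ar unfolding arctan_minus by (simp add: algebra_simps)
  then show ?thesis by (simp add: smooth_step_def le_divide_eq)
qed

lemma exists_arctan_near:
  assumes "\<delta> > 0" "\<epsilon> > 0"
  shows "\<exists>\<eta>>0. pi / 2 - \<epsilon> * pi \<le> arctan (\<delta> / \<eta>)"
proof -
  have "\<forall>\<^sub>F y in at_top. pi / 2 - \<epsilon> * pi < arctan y"
    using assms by (intro order_tendstoD(1)[OF tendsto_arctan_at_top]) simp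
  then obtain y0 where y0: "\<And>y. y \<ge> y0 \<Longrightarrow> pi / 2 - \<epsilon> * pi < arctan y"
    unfolding eventually_at_top_linorder by blast
  define y where "y = max y0 1"
  have "\<delta> / (\<delta> / y) = y" "\<delta> / y > 0" using assms by (auto simp: y_def)
  then show ?thesis using y0[of y] by (intro exI[of _ "\<delta> / y"]) (auto simp: y_def)
qed

text \<open>
  Random discrete probability measures, with weights \<open>wt\<close> at points \<open>la\<close>, whose Stieltjes transforms
  converge pointwise in probability to that of the measure with density \<open>f\<close> and an atom of mass \<open>\<kappa>\<close>
  at \<open>Z\<close>. It is used for the empirical measure of the eigenvalues and for the measure of
  overlaps.
\<close>

locale stieltjes_convergence =
  fixes M :: "nat \<Rightarrow> 'a measure" and wt la :: "nat \<Rightarrow> 'a \<Rightarrow> nat \<Rightarrow> real"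
    and f :: "real \<Rightarrow> real" and \<kappa> Z :: real
  assumes wt: "whp M (\<lambda>N \<omega>. (\<forall>i<N. 0 \<le> wt N \<omega> i) \<and> (\<Sum>i<N. wt N \<omega> i) = 1)"
    and f: "integrable lborel f" "\<And>x. 0 \<le> f x" and \<kappa>: "0 \<le> \<kappa>" and total: "(LINT x|lborel. f x) + \<kappa> = 1"
    and conv: "\<And>z \<epsilon>. Im z > 0 \<Longrightarrow> \<epsilon> > 0 \<Longrightarrow> whp M (\<lambda>N \<omega>.
       cmod ((\<Sum>i<N. of_real (wt N \<omega> i) * (1 / (of_real (la N \<omega> i) - z))) -
         ((LINT x|lborel. of_real (f x) * (1 / (of_real x - z))) + of_real \<kappa> * (1 / (of_real Z - z)))) \<le> \<epsilon>)"
begin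

definition spectral_sum :: "(real \<Rightarrow> real) \<Rightarrow> nat \<Rightarrow> 'a \<Rightarrow> real" where
  "spectral_sum \<phi> N \<omega> = (\<Sum>i<N. wt N \<omega> i * \<phi> (la N \<omega> i))"

definition limit_mass :: "(real \<Rightarrow> real) \<Rightarrow> real" where
  "limit_mass \<phi> = (LINT x|lborel. f x * \<phi> x) + \<kappa> * \<phi> Z"

lemma integrable_mult_bounded:
  fixes \<phi> :: "real \<Rightarrow> real"
  assumes "\<phi> \<in> borel_measurable borel" "\<And>x. \<bar>\<phi> x\<bar> \<le> C"
  shows "integrable lborel (\<lambda>x. f x * \<phi> x)"
proof (rule Bochner_Integration.integrable_bound[OF integrable_mult_right[OF f(1), of C]])
  show "(\<lambda>x. f x * \<phi> x) \<in> borel_measurable lborel" using f(1) assms(1) by (auto dest: borel_measurable_integrable)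
  show "AE x in lborel. norm (f x * \<phi> x) \<le> norm (C * f x)"
  proof (intro AE_I2)
    fix x
    have "\<bar>\<phi> x\<bar> * f x \<le> \<bar>C\<bar> * f x"
      using assms(2)[of x] f(2)[of x] by (intro mult_right_mono) auto
    then show "norm (f x * \<phi> x) \<le> norm (C * f x)" using f(2)[of x] by (simp add: abs_mult mult.commute)
  qed
qed

lemma conv_poisson:
  assumes \<eta>: "\<eta> > 0" and \<epsilon>: "\<epsilon> > 0"
  shows "whp M (\<lambda>N \<omega>. \<bar>spectral_sum (poisson E \<eta>) N \<omega> - limit_mass (poisson E \<eta>)\<bar> \<le> \<epsilon>)"
proof (rule whp_mono[OF conv[of "Complex E \<eta>" \<epsilon>]])
  fix N \<omega>
  let ?z = "Complex E \<eta>"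
  let ?A = "(\<Sum>i<N. of_real (wt N \<omega> i) * (1 / (of_real (la N \<omega> i) - ?z)))"
  let ?I = "(LINT x|lborel. of_real (f x) * (1 / (of_real x - ?z)))"
  assume *: "cmod (?A - (?I + of_real \<kappa> * (1 / (of_real Z - ?z)))) \<le> \<epsilon>"
  have i: "integrable lborel (\<lambda>x. of_real (f x) * (1 / (of_real x - ?z)))"
  proof (rule Bochner_Integration.integrable_bound[OF integrable_mult_right[OF f(1), of "1 / \<eta>"]])
    show "(\<lambda>x. of_real (f x) * (1 / (of_real x - ?z))) \<in> borel_measurable lborel"
      using f(1) by (auto dest!: borel_measurable_integrable)
    show "AE x in lborel. norm (of_real (f x) * (1 / (of_real x - ?z))) \<le> norm (1 / \<eta> * f x)"
    proof (intro AE_I2)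
      fix x
      have "norm (of_real (f x) * (1 / (of_real x - ?z))) \<le> \<bar>f x\<bar> * (1 / \<eta>)"
        unfolding norm_mult norm_of_real using stieltjes_kernel_bound[of ?z x] \<eta> by (intro mult_left_mono) auto
      then show "norm (of_real (f x) * (1 / (of_real x - ?z))) \<le> norm (1 / \<eta> * f x)"
        using \<eta> by (simp add: abs_mult)
    qed
  qed
  have "Im ?I = (LINT x|lborel. f x * poisson E \<eta> x)"
    unfolding integral_Im[OF i, symmetric] poisson_def
    by (intro Bochner_Integration.integral_cong refl) (simp only: Im_mult_of_real)
  then have "Im (?A - (?I + of_real \<kappa> * (1 / (of_real Z - ?z)))) = spectral_sum (poisson E \<eta>) N \<omega> - limit_mass (poisson E \<eta>)"
    unfolding spectral_sum_def limit_mass_def poisson_def by (simp only: minus_complex.sel plus_complex.sel Im_sum Im_mult_of_real)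
  then show "\<bar>spectral_sum (poisson E \<eta>) N \<omega> - limit_mass (poisson E \<eta>)\<bar> \<le> \<epsilon>"
    using * abs_Im_le_cmod[of "?A - (?I + of_real \<kappa> * (1 / (of_real Z - ?z)))"] by simp
qed (use assms in auto)

lemma limit_mass_diff_le:
  assumes "\<phi> \<in> borel_measurable borel" "\<psi> \<in> borel_measurable borel"
    and "\<And>x. \<bar>\<phi> x\<bar> \<le> C" "\<And>x. \<bar>\<psi> x\<bar> \<le> C'" "\<And>x. \<phi> x \<le> \<psi> x + \<tau>"
  shows "limit_mass \<phi> \<le> limit_mass \<psi> + \<tau>"
proof -
  have "(LINT x|lborel. f x * \<phi> x) \<le> (LINT x|lborel. f x * \<psi> x + \<tau> * f x)"
  proof (rule integral_mono)
    show "integrable lborel (\<lambda>x. f x * \<phi> x)" by (rule integrable_mult_bounded[OF assms(1,3)])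
    show "integrable lborel (\<lambda>x. f x * \<psi> x + \<tau> * f x)"
      by (intro Bochner_Integration.integrable_add integrable_mult_right f(1) integrable_mult_bounded[OF assms(2,4)])
    show "f x * \<phi> x \<le> f x * \<psi> x + \<tau> * f x" for x
      using mult_left_mono[OF assms(5)[of x] f(2)[of x]] by (simp add: algebra_simps)
  qed
  also have "\<dots> = (LINT x|lborel. f x * \<psi> x) + \<tau> * (LINT x|lborel. f x)"
    using integrable_mult_bounded[OF assms(2,4)] f(1) by simp
  finally have "(LINT x|lborel. f x * \<phi> x) \<le> (LINT x|lborel. f x * \<psi> x) + \<tau> * (LINT x|lborel. f x)" .
  moreover have "\<kappa> * \<phi> Z \<le> \<kappa> * \<psi> Z + \<tau> * \<kappa>"
    using mult_left_mono[OF assms(5)[of Z] \<kappa>] by (simp add: algebra_simps)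
  moreover have "\<tau> * (LINT x|lborel. f x) + \<tau> * \<kappa> = \<tau>" using total by (simp flip: distrib_left)
  ultimately show ?thesis unfolding limit_mass_def by linarith
qed

lemma spectral_sum_diff_le:
  assumes "\<forall>i<N. 0 \<le> wt N \<omega> i" "(\<Sum>i<N. wt N \<omega> i) = 1" "\<And>x. \<phi> x \<le> \<psi> x + \<tau>"
  shows "spectral_sum \<phi> N \<omega> \<le> spectral_sum \<psi> N \<omega> + \<tau>"
proof -
  have "spectral_sum \<phi> N \<omega> \<le> (\<Sum>i<N. wt N \<omega> i * \<psi> (la N \<omega> i) + \<tau> * wt N \<omega> i)"
    unfolding spectral_sum_def
  proof (rule sum_mono)
    fix i assume "i \<in> {..<N}"
    then show "wt N \<omega> i * \<phi> (la N \<omega> i) \<le> wt N \<omega> i * \<psi> (la N \<omega> i) + \<tau> * wt N \<omega> i"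
      using mult_left_mono[OF assms(3)[of "la N \<omega> i"], of "wt N \<omega> i"] assms(1) by (simp add: algebra_simps)
  qed
  also have "\<dots> = spectral_sum \<psi> N \<omega> + \<tau>"
    unfolding spectral_sum_def sum.distrib sum_distrib_left[symmetric] assms(2) by simp
  finally show ?thesis .
qed

lemma poisson_sum_abs_le:
  assumes "\<eta> > 0" "a < b" "n > 0"
  shows "\<bar>poisson_sum \<eta> a b n x\<bar> \<le> (b - a) / pi / \<eta>"
proof -
  have "\<bar>\<Sum>k<n. poisson (a + real k * ((b - a) / real n)) \<eta> x\<bar> \<le> (\<Sum>k<n. 1 / \<eta>)"
    by (intro order_trans[OF sum_abs] sum_mono poisson_abs_le assms)
  then have "\<bar>poisson_sum \<eta> a b n x\<bar> \<le> ((b - a) / real n / pi) * (real n * (1 / \<eta>))"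
    unfolding poisson_sum_def abs_mult using assms by (intro mult_mono) auto
  then show ?thesis using assms by simp
qed

text \<open>
  The imaginary part of the Stieltjes transform at \<open>E + i \<eta>\<close> is the integral of the Poisson kernel,
  and a smoothed step is uniformly close to a finite combination of such kernels.
\<close>

lemma conv_smooth_step:
  assumes \<eta>: "\<eta> > 0" and ab: "a < b" and \<epsilon>: "\<epsilon> > 0"
  shows "whp M (\<lambda>N \<omega>. \<bar>spectral_sum (smooth_step \<eta> a b) N \<omega> - limit_mass (smooth_step \<eta> a b)\<bar> \<le> \<epsilon>)"
proof -
  define K where "K = (b - a)\<^sup>2 / (pi * \<eta>\<^sup>2)"
  \<comment> \<open>The mesh makes the Riemann error at most a quarter of the tolerance; the tolerance for each
     Poisson kernel is scaled so that the n errors together use another quarter.\<close>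
  obtain n where n: "real n > K / (\<epsilon> / 4)" using reals_Archimedean2 by blast
  have K: "K > 0" using ab \<eta> by (simp add: K_def)
  have n0: "n > 0" using n K \<epsilon> by (metis divide_pos_pos of_nat_0_less_iff order_less_trans zero_less_numeral)
  have Kn: "K / real n \<le> \<epsilon> / 4" using n n0 \<epsilon> by (simp add: field_simps)
  let ?E = "\<lambda>k. a + real k * ((b - a) / real n)"
  let ?p = "poisson_sum \<eta> a b n" and ?s = "smooth_step \<eta> a b"
  define \<epsilon>' where "\<epsilon>' = \<epsilon> / 4 * pi / (b - a)"
  have \<epsilon>': "\<epsilon>' > 0" using \<epsilon> ab by (simp add: \<epsilon>'_def)
  have "\<bar>?s x - ?p x\<bar> \<le> \<epsilon> / 4" for x
    using order_trans[OF smooth_step_riemann[OF \<eta> ab n0, of x], of "\<epsilon> / 4"] Kn by (simp add: K_def)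
  then have near: "?s x \<le> ?p x + \<epsilon> / 4" "?p x \<le> ?s x + \<epsilon> / 4" for x
    unfolding abs_le_iff by (smt (verit, ccfv_SIG))+
  have m: "?p \<in> borel_measurable borel" "?s \<in> borel_measurable borel"
    unfolding poisson_sum_def[abs_def] smooth_step_def[abs_def] by measurable
  have sb: "\<bar>?s x\<bar> \<le> 1" for x using smooth_step_bounds[OF \<eta> ab, of x] by simp
  note pb = poisson_sum_abs_le[OF \<eta> ab n0]
  have Lnear: "limit_mass ?s \<le> limit_mass ?p + \<epsilon> / 4" "limit_mass ?p \<le> limit_mass ?s + \<epsilon> / 4"
    using limit_mass_diff_le[OF m(2,1) sb pb near(1)] limit_mass_diff_le[OF m(1,2) pb sb near(2)] by auto
  have Lp: "limit_mass ?p = ((b - a) / real n / pi) * (\<Sum>k<n. limit_mass (poisson (?E k) \<eta>))"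
  proof -
    have i: "integrable lborel (\<lambda>x. f x * poisson (?E k) \<eta> x)" for k
      by (rule integrable_mult_bounded[OF poisson_measurable poisson_abs_le[OF \<eta>]])
    have "(LINT x|lborel. f x * ?p x) = (LINT x|lborel. ((b - a) / real n / pi) * (\<Sum>k<n. f x * poisson (?E k) \<eta> x))"
      by (intro Bochner_Integration.integral_cong refl) (simp add: poisson_sum_def sum_distrib_left mult_ac)
    also have "\<dots> = ((b - a) / real n / pi) * (\<Sum>k<n. LINT x|lborel. f x * poisson (?E k) \<eta> x)"
      unfolding integral_mult_right_zero using i by (subst Bochner_Integration.integral_sum) auto
    finally show ?thesis unfolding limit_mass_def
      by (simp add: poisson_sum_def sum.distrib distrib_left sum_distrib_left mult_ac)
  qed
  have Sp: "spectral_sum ?p N \<omega> = ((b - a) / real n / pi) * (\<Sum>k<n. spectral_sum (poisson (?E k) \<eta>) N \<omega>)" for N \<omega>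
  proof -
    have "spectral_sum ?p N \<omega> = (\<Sum>i<N. \<Sum>k<n. ((b - a) / real n / pi) * (wt N \<omega> i * poisson (?E k) \<eta> (la N \<omega> i)))"
      unfolding spectral_sum_def poisson_sum_def by (simp add: sum_distrib_left mult_ac)
    also have "\<dots> = (\<Sum>k<n. \<Sum>i<N. ((b - a) / real n / pi) * (wt N \<omega> i * poisson (?E k) \<eta> (la N \<omega> i)))"
      by (rule sum.swap)
    finally show ?thesis unfolding spectral_sum_def by (simp add: sum_distrib_left)
  qed
  have "whp M (\<lambda>N \<omega>. (\<forall>k<n. \<bar>spectral_sum (poisson (?E k) \<eta>) N \<omega> - limit_mass (poisson (?E k) \<eta>)\<bar> \<le> \<epsilon>') \<and>
     ((\<forall>i<N. 0 \<le> wt N \<omega> i) \<and> (\<Sum>i<N. wt N \<omega> i) = 1))"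
    by (intro whp_conj whp_all_less conv_poisson wt \<eta> \<epsilon>')
  then show ?thesis
  proof (rule whp_mono)
    fix N \<omega>
    assume *: "(\<forall>k<n. \<bar>spectral_sum (poisson (?E k) \<eta>) N \<omega> - limit_mass (poisson (?E k) \<eta>)\<bar> \<le> \<epsilon>') \<and>
      ((\<forall>i<N. 0 \<le> wt N \<omega> i) \<and> (\<Sum>i<N. wt N \<omega> i) = 1)"
    have "\<bar>\<Sum>k<n. spectral_sum (poisson (?E k) \<eta>) N \<omega> - limit_mass (poisson (?E k) \<eta>)\<bar> \<le> (\<Sum>k<n. \<epsilon>')"
      by (intro order_trans[OF sum_abs] sum_mono) (use * in auto)
    then have "((b - a) / real n / pi) * \<bar>\<Sum>k<n. spectral_sum (poisson (?E k) \<eta>) N \<omega> - limit_mass (poisson (?E k) \<eta>)\<bar> \<le>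
       ((b - a) / real n / pi) * (real n * \<epsilon>')"
      using ab by (intro mult_left_mono) auto
    also have "\<dots> = \<epsilon> / 4"
    proof -
      have gen: "(d / real n / pi) * (real n * (\<epsilon> / 4 * pi / d)) = \<epsilon> / 4" if "d \<noteq> 0" for d
        using that n0 by simp
      have "b - a \<noteq> 0" using ab by simp
      then show ?thesis unfolding \<epsilon>'_def by (rule gen)
    qed
    finally have "\<bar>spectral_sum ?p N \<omega> - limit_mass ?p\<bar> \<le> \<epsilon> / 4"
      unfolding Sp Lp right_diff_distrib[symmetric] sum_subtractf[symmetric] abs_mult using ab by simp
    moreover have "spectral_sum ?s N \<omega> \<le> spectral_sum ?p N \<omega> + \<epsilon> / 4" "spectral_sum ?p N \<omega> \<le> spectral_sum ?s N \<omega> + \<epsilon> / 4"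
      using * near by (auto intro!: spectral_sum_diff_le)
    ultimately show "\<bar>spectral_sum ?s N \<omega> - limit_mass ?s\<bar> \<le> \<epsilon>" using Lnear by linarith
  qed
qed

text \<open>
  Half of the weak convergence: an open interval asymptotically carries at least the limiting mass
  of a smaller closed one. Since total masses are 1, upper bounds follow by applying this to the
  complement.
\<close>

theorem mass_lower_bound:
  assumes "a < a2" "a2 \<le> b2" "b2 < b" and \<epsilon>: "\<epsilon> > 0"
  shows "whp M (\<lambda>N \<omega>. (LINT x:{a2..b2}|lborel. f x) + \<kappa> * indicator {a2..b2} Z - \<epsilon> \<le>
     (\<Sum>i | i < N \<and> a < la N \<omega> i \<and> la N \<omega> i < b. wt N \<omega> i))"
proof -
  \<comment> \<open>The ends a + delta and b - delta of the smoothed step keep distance delta from both intervals.\<close>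
  define \<delta> where "\<delta> = min (a2 - a) (b - b2) / 2"
  have \<delta>: "\<delta> > 0" "a + 2 * \<delta> \<le> a2" "b2 \<le> b - 2 * \<delta>" using assms by (auto simp: \<delta>_def)
  obtain \<eta> where \<eta>: "\<eta> > 0" "pi / 2 - (\<epsilon> / 4) * pi \<le> arctan (\<delta> / \<eta>)"
    using exists_arctan_near[OF \<delta>(1), of "\<epsilon> / 4"] \<epsilon> by auto
  let ?s = "smooth_step \<eta> (a + \<delta>) (b - \<delta>)"
  have ab: "a + \<delta> < b - \<delta>" using \<delta> assms by linarith
  have m: "?s \<in> borel_measurable borel" unfolding smooth_step_def[abs_def] by measurable
  have sb: "\<bar>?s x\<bar> \<le> 1" for x using smooth_step_bounds[OF \<eta>(1) ab, of x] by simp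
  have "indicator {a2..b2} x \<le> ?s x + \<epsilon> / 2" for x
  proof (cases "x \<in> {a2..b2}")
    case True
    have "1 - 2 * (\<epsilon> / 4) \<le> ?s x"
      by (rule smooth_step_inside[OF \<eta>(1) _ _ \<eta>(2)]) (use True \<delta> in auto)
    then show ?thesis using True by simp
  qed (use smooth_step_bounds[OF \<eta>(1) ab, of x] \<epsilon> in simp)
  then have "limit_mass (indicator {a2..b2}) \<le> limit_mass ?s + \<epsilon> / 2"
    by (intro limit_mass_diff_le[where C = 1 and C' = 1] m sb) (auto simp: indicator_def)
  moreover have "limit_mass (indicator {a2..b2}) = (LINT x:{a2..b2}|lborel. f x) + \<kappa> * indicator {a2..b2} Z"
    unfolding limit_mass_def set_lebesgue_integral_def by (simp add: mult.commute)
  ultimately have Ls: "(LINT x:{a2..b2}|lborel. f x) + \<kappa> * indicator {a2..b2} Z \<le> limit_mass ?s + \<epsilon> / 2" by simp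
  have "whp M (\<lambda>N \<omega>. \<bar>spectral_sum ?s N \<omega> - limit_mass ?s\<bar> \<le> \<epsilon> / 4 \<and> ((\<forall>i<N. 0 \<le> wt N \<omega> i) \<and> (\<Sum>i<N. wt N \<omega> i) = 1))"
    using \<epsilon> by (intro whp_conj conv_smooth_step wt \<eta> ab) auto
  then show ?thesis
  proof (rule whp_mono)
    fix N \<omega>
    assume *: "\<bar>spectral_sum ?s N \<omega> - limit_mass ?s\<bar> \<le> \<epsilon> / 4 \<and> ((\<forall>i<N. 0 \<le> wt N \<omega> i) \<and> (\<Sum>i<N. wt N \<omega> i) = 1)"
    have "?s x \<le> indicator {a<..<b} x + \<epsilon> / 4" for x
    proof (cases "x \<in> {a<..<b}")
      case False
      have "?s x \<le> \<epsilon> / 4" by (rule smooth_step_outside[OF \<eta>(1) _ \<eta>(2)]) (use False in auto)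
      then show ?thesis using False by simp
    qed (use smooth_step_bounds[OF \<eta>(1) ab, of x] \<epsilon> in simp)
    then have "spectral_sum ?s N \<omega> \<le> spectral_sum (indicator {a<..<b}) N \<omega> + \<epsilon> / 4" using * by (intro spectral_sum_diff_le) auto
    moreover have "spectral_sum (indicator {a<..<b}) N \<omega> = (\<Sum>i | i < N \<and> a < la N \<omega> i \<and> la N \<omega> i < b. wt N \<omega> i)"
      unfolding spectral_sum_def by (rule sum.mono_neutral_cong_right) (auto simp: indicator_def)
    ultimately show "(LINT x:{a2..b2}|lborel. f x) + \<kappa> * indicator {a2..b2} Z - \<epsilon> \<le>
     (\<Sum>i | i < N \<and> a < la N \<omega> i \<and> la N \<omega> i < b. wt N \<omega> i)" using * Ls by linarith
  qed
qed

end

section \<open>Convergence of the Stieltjes transforms\<close>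

lemma (in prob_space) integrable_norm_square:
  fixes f :: "'a \<Rightarrow> complex"
  assumes "f \<in> borel_measurable M" "\<And>x. x \<in> space M \<Longrightarrow> cmod (f x) \<le> C"
  shows "integrable M (\<lambda>x. (cmod (f x))\<^sup>2)"
proof (rule integrable_const_bound[where B = "C\<^sup>2"])
  show "AE x in M. norm ((cmod (f x))\<^sup>2) \<le> C\<^sup>2"
  proof (intro AE_I2)
    fix x assume "x \<in> space M"
    then have "(cmod (f x))\<^sup>2 \<le> C\<^sup>2" using assms(2) by (intro power_mono) auto
    then show "norm ((cmod (f x))\<^sup>2) \<le> C\<^sup>2" by simp
  qed
qed (use assms(1) in measurable)

context spiked_wigner
begin

lemma residuals_integrable:
  assumes z: "Im z > 0"
  shows "integrable M (\<lambda>\<omega>. (cmod (trace_residual z \<omega>))\<^sup>2)" "integrable M (\<lambda>\<omega>. (cmod (form_residual z \<omega>))\<^sup>2)"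
    and "trace_residual z \<in> borel_measurable M" "form_residual z \<in> borel_measurable M"
proof -
  let ?c = "1 / Im z"
  have c: "0 \<le> ?c" using z by simp
  have sM: "(\<lambda>\<omega>. res_trace n (B \<omega>) z) \<in> borel_measurable M" by (intro res_trace_measurable B_measurable)
  have gM: "(\<lambda>\<omega>. res_form n (B \<omega>) z (u \<omega>) (u \<omega>)) \<in> borel_measurable M"
    by (intro res_form_measurable B_measurable u_measurable)
  show tM: "trace_residual z \<in> borel_measurable M" unfolding trace_residual_def[abs_def] using sM by measurable
  show fM: "form_residual z \<in> borel_measurable M" unfolding form_residual_def[abs_def] using sM gM by measurable
  have g: "cmod (res_form n (B \<omega>) z (u \<omega>) (u \<omega>)) \<le> ?c" if "\<omega> \<in> space M" for \<omega>
    by (intro res_form_bound symm_B u_unit that z)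
  have s: "cmod (res_trace n (B \<omega>) z) \<le> ?c" if "\<omega> \<in> space M" for \<omega>
    by (intro res_trace_bound that z)
  have tri: "cmod (1 + p * x + y * x) \<le> 1 + cmod p * ?c + ?c * ?c" if "cmod x \<le> ?c" "cmod y \<le> ?c" for p x y
  proof -
    have "cmod (1 + p * x + y * x) \<le> cmod 1 + cmod (p * x) + cmod (y * x)"
      using norm_triangle_ineq[of "1 + p * x" "y * x"] norm_triangle_ineq[of 1 "p * x"] by linarith
    moreover have "cmod (p * x) \<le> cmod p * ?c" unfolding norm_mult using that by (intro mult_left_mono) auto
    moreover have "cmod (y * x) \<le> ?c * ?c" unfolding norm_mult using that c by (intro mult_mono) auto
    ultimately show ?thesis by simp
  qed
  have t: "cmod (trace_residual z \<omega>) \<le> 1 + cmod z * ?c + ?c * ?c" if "\<omega> \<in> space M" for \<omega>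
    unfolding trace_residual_def by (rule tri[OF s[OF that] s[OF that]])
  have f: "cmod (form_residual z \<omega>) \<le> 1 + cmod (z - of_real \<theta>) * ?c + ?c * ?c" if "\<omega> \<in> space M" for \<omega>
    unfolding form_residual_def by (rule tri[OF g[OF that] s[OF that]])
  show "integrable M (\<lambda>\<omega>. (cmod (trace_residual z \<omega>))\<^sup>2)"
    by (rule integrable_norm_square[OF tM t])
  show "integrable M (\<lambda>\<omega>. (cmod (form_residual z \<omega>))\<^sup>2)"
    by (rule integrable_norm_square[OF fM f])
qed

end

text \<open>
  The vector has norm 1 only almost surely; on the exceptional null set it is replaced by a unit
  vector, so that pointwise bounds hold at every sample point.
\<close>

definition normalized :: "nat \<Rightarrow> (nat \<Rightarrow> 'a \<Rightarrow> real) \<Rightarrow> 'a \<Rightarrow> nat \<Rightarrow> real" where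
  "normalized N u \<omega> i = (if (\<Sum>k<N. (u k \<omega>)\<^sup>2) = 1 then u i \<omega> else unit_vec_fun 0 i)"

lemma wigner_moment_bound:
  assumes "wigner_entries M W"
  shows "\<exists>K\<ge>1. \<forall>N>0. \<forall>i<N. \<forall>j<N. (LINT \<omega>|M N. (W N i j \<omega>)\<^sup>2)\<^sup>2 \<le> K \<and> (LINT \<omega>|M N. W N i j \<omega> ^ 4) \<le> K"
proof -
  have "\<exists>\<beta>>0. \<forall>N>0. \<forall>i<N. \<forall>j<N. \<forall>k. (LINT \<omega>|M N. W N i j \<omega> ^ (2 * k)) \<le> (\<beta> * real k) ^ k"
    using assms unfolding wigner_entries_def by (elim conjE)
  then obtain \<beta> :: real where \<beta>: "\<beta> > 0"
    and b': "\<forall>N>0. \<forall>i<N. \<forall>j<N. \<forall>k. (LINT \<omega>|M N. W N i j \<omega> ^ (2 * k)) \<le> (\<beta> * real k) ^ k"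
    by (elim exE conjE)
  note b = b'[rule_format]
  have "(LINT \<omega>|M N. (W N i j \<omega>)\<^sup>2)\<^sup>2 \<le> max 1 (4 * \<beta>\<^sup>2) \<and> (LINT \<omega>|M N. W N i j \<omega> ^ 4) \<le> max 1 (4 * \<beta>\<^sup>2)"
    if "N > 0" "i < N" "j < N" for N i j
  proof
    have "(LINT \<omega>|M N. (W N i j \<omega>)\<^sup>2) \<le> \<beta>" using b[OF that, of 1] by simp
    then have "(LINT \<omega>|M N. (W N i j \<omega>)\<^sup>2)\<^sup>2 \<le> \<beta>\<^sup>2" by (intro power_mono) auto
    also have "\<beta>\<^sup>2 \<le> max 1 (4 * \<beta>\<^sup>2)" by (rule max.coboundedI2) simp
    finally show "(LINT \<omega>|M N. (W N i j \<omega>)\<^sup>2)\<^sup>2 \<le> max 1 (4 * \<beta>\<^sup>2)" .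
    have "(LINT \<omega>|M N. W N i j \<omega> ^ 4) \<le> (\<beta> * 2)\<^sup>2" using b[OF that, of 2] by simp
    then show "(LINT \<omega>|M N. W N i j \<omega> ^ 4) \<le> max 1 (4 * \<beta>\<^sup>2)" by (simp add: power_mult_distrib)
  qed
  then show ?thesis by (intro exI[of _ "max 1 (4 * \<beta>\<^sup>2)"]) auto
qed

lemma spiked_wigner_model:
  assumes P: "prob_space (M N)" and W: "wigner_entries M W" and N: "N > 0"
    and ind: "indep_mat_vec (M N) N (W N) (u N)"
    and K: "K \<ge> 1" "\<And>i j. i < N \<Longrightarrow> j < N \<Longrightarrow> (LINT \<omega>|M N. (W N i j \<omega>)\<^sup>2)\<^sup>2 \<le> K"
      "\<And>i j. i < N \<Longrightarrow> j < N \<Longrightarrow> (LINT \<omega>|M N. W N i j \<omega> ^ 4) \<le> K"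
  shows "spiked_wigner (M N) N (W N) (normalized N (u N)) (rest_algebra (M N) N (W N) (u N)) K"
proof -
  interpret prob_space "M N" by (rule P)
  have iv: "indep_vars (\<lambda>_. borel) (\<lambda>(i, j). W N i j) (upper_pairs N)"
    and sym: "\<And>i j \<omega>. i < N \<Longrightarrow> j < N \<Longrightarrow> \<omega> \<in> space (M N) \<Longrightarrow> W N i j \<omega> = W N j i \<omega>"
    and int: "\<And>i j k. i < N \<Longrightarrow> j < N \<Longrightarrow> integrable (M N) (\<lambda>\<omega>. W N i j \<omega> ^ k)"
    and odd: "\<And>i j k. i < N \<Longrightarrow> j < N \<Longrightarrow> (LINT \<omega>|M N. W N i j \<omega> ^ (2 * k + 1)) = 0"
    and var: "\<And>i j. i < N \<Longrightarrow> j < N \<Longrightarrow> i < j \<Longrightarrow> (LINT \<omega>|M N. (W N i j \<omega>)\<^sup>2) = 1"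
  proof -
    note c1 = W[unfolded wigner_entries_def]
    note c2 = conjunct2[OF c1] note c3 = conjunct2[OF c2] note c4 = conjunct2[OF c3]
    note c5 = conjunct2[OF c4] note c6 = conjunct2[OF c5]
    show "indep_vars (\<lambda>_. borel) (\<lambda>(i, j). W N i j) (upper_pairs N)" using conjunct1[OF c1] N by simp
    show "W N i j \<omega> = W N j i \<omega>" if "i < N" "j < N" "\<omega> \<in> space (M N)" for i j \<omega>
      using conjunct1[OF c2, rule_format, OF N that] .
    show "integrable (M N) (\<lambda>\<omega>. W N i j \<omega> ^ k)" if "i < N" "j < N" for i j k
      using conjunct1[OF c4, rule_format, OF N that] .
    show "(LINT \<omega>|M N. W N i j \<omega> ^ (2 * k + 1)) = 0" if "i < N" "j < N" for i j k
      using conjunct1[OF c5, rule_format, OF N that] .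
    show "(LINT \<omega>|M N. (W N i j \<omega>)\<^sup>2) = 1" if "i < N" "j < N" "i < j" for i j
      using conjunct1[OF c6, rule_format, OF N that] .
  qed
  show ?thesis
  proof
    show "expectation (\<lambda>\<omega>. (W N i j \<omega>)\<^sup>2) = 1" if "i < N" "j < N" "i \<noteq> j" for i j
    proof (cases "i < j")
      case False
      have "expectation (\<lambda>\<omega>. (W N i j \<omega>)\<^sup>2) = expectation (\<lambda>\<omega>. (W N j i \<omega>)\<^sup>2)"
        using sym[OF that(1,2)] by (intro Bochner_Integration.integral_cong) auto
      then show ?thesis using var[of j i] that False by simp
    qed (use var that in simp)
    show "expectation (W N i j) = 0" if "i < N" "j < N" for i j using odd[OF that, of 0] by simp
    show "expectation (\<lambda>\<omega>. W N i j \<omega> ^ 3) = 0" if "i < N" "j < N" for i j using odd[OF that, of 1] by simp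
    show "(\<Sum>i<N. (normalized N (u N) \<omega> i)\<^sup>2) = 1" for \<omega>
    proof (cases "(\<Sum>k<N. (u N k \<omega>)\<^sup>2) = 1")
      case False
      then have "(\<Sum>i<N. (normalized N (u N) \<omega> i)\<^sup>2) = (\<Sum>i<N. if i = 0 then 1 else 0)"
        by (intro sum.cong) (auto simp: normalized_def unit_vec_fun_def)
      then show ?thesis using N by simp
    qed (simp add: normalized_def)
    show "(\<lambda>\<omega>. normalized N (u N) \<omega> k) \<in> borel_measurable (rest_algebra (M N) N (W N) (u N) i j)"
      if "i < N" "j < N" "k < N" for i j k
    proof -
      have s: "(\<lambda>\<omega>. \<Sum>k<N. (u N k \<omega>)\<^sup>2) \<in> borel_measurable (rest_algebra (M N) N (W N) (u N) i j)"
        by (intro borel_measurable_sum borel_measurable_power u_rest_measurable) simp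
      have "{\<omega> \<in> space (rest_algebra (M N) N (W N) (u N) i j). (\<Sum>k<N. (u N k \<omega>)\<^sup>2) = 1} \<in>
        sets (rest_algebra (M N) N (W N) (u N) i j)"
        using s by measurable
      then show ?thesis unfolding normalized_def
        by (intro measurable_If u_rest_measurable that) simp_all
    qed
  qed (use N K int sym in \<open>auto intro!: indep_of_rest_algebra[OF iv ind] W_rest_measurable[OF sym]\<close>)
qed

lemma whp_small_of_second_moment:
  fixes T :: "nat \<Rightarrow> 'a \<Rightarrow> complex"
  assumes P: "\<And>N. prob_space (M N)"
    and int: "\<And>N. N > 0 \<Longrightarrow> integrable (M N) (\<lambda>\<omega>. (cmod (T N \<omega>))\<^sup>2)"
    and bound: "\<And>N. N > 0 \<Longrightarrow> (LINT \<omega>|M N. (cmod (T N \<omega>))\<^sup>2) \<le> C / sqrt (real N)"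
    and meas: "\<And>N. N > 0 \<Longrightarrow> T N \<in> borel_measurable (M N)" and \<epsilon>: "\<epsilon> > 0"
  shows "whp M (\<lambda>N \<omega>. cmod (T N \<omega>) \<le> \<epsilon>)"
proof (rule whpI)
  let ?A = "\<lambda>N. if N = 0 then {} else {\<omega> \<in> space (M N). \<epsilon>\<^sup>2 \<le> (cmod (T N \<omega>))\<^sup>2}"
  show "?A N \<in> sets (M N)" for N
    using meas[of N] by (cases "N = 0") (auto intro!: borel_measurable_le)
  show "\<omega> \<in> ?A N" if "N > 0" "\<omega> \<in> space (M N)" "\<not> cmod (T N \<omega>) \<le> \<epsilon>" for N \<omega>
    using that \<epsilon> by (auto intro!: power_mono)
  show "(\<lambda>N. measure (M N) (?A N)) \<longlonglongrightarrow> 0"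
  proof (rule tendsto_sandwich[OF _ _ tendsto_const])
    show "\<forall>\<^sub>F N in sequentially. measure (M N) (?A N) \<le> (C / \<epsilon>\<^sup>2) * (1 / sqrt (real N))"
    proof (rule eventually_mono[OF eventually_gt_at_top[of 0]])
      fix N :: nat assume N: "0 < N"
      interpret prob_space "M N" by (rule P)
      have "measure (M N) (?A N) \<le> (LINT \<omega>|M N. (cmod (T N \<omega>))\<^sup>2) / \<epsilon>\<^sup>2"
        using integral_Markov_inequality_measure[OF int[OF N], of "{}" "\<epsilon>\<^sup>2"] N \<epsilon> by simp
      also have "\<dots> \<le> (C / sqrt (real N)) / \<epsilon>\<^sup>2" using bound[OF N] by (intro divide_right_mono) auto
      also have "\<dots> = (C / \<epsilon>\<^sup>2) * (1 / sqrt (real N))" by (simp add: mult.commute)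
      finally show "measure (M N) (?A N) \<le> (C / \<epsilon>\<^sup>2) * (1 / sqrt (real N))" .
    qed
    have "(\<lambda>N. inverse (sqrt (real N))) \<longlonglongrightarrow> 0"
      by (intro tendsto_inverse_0_at_top filterlim_compose[OF sqrt_at_top filterlim_real_sequentially])
    then have "(\<lambda>N. (C / \<epsilon>\<^sup>2) * (1 / sqrt (real N))) \<longlonglongrightarrow> (C / \<epsilon>\<^sup>2) * 0"
      by (intro tendsto_mult tendsto_const) (simp add: inverse_eq_divide)
    then show "(\<lambda>N. (C / \<epsilon>\<^sup>2) * (1 / sqrt (real N))) \<longlonglongrightarrow> 0" by simp
  qed auto
qed

text \<open>
  With \<open>z = w + 1 / w\<close> the quadratic factors as \<open>(s + w) (s + 1 / w)\<close>, and the second factor stays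
  away from 0 because a Stieltjes transform has nonnegative imaginary part.
\<close>

lemma trace_stability:
  assumes "w \<noteq> 0" "z = w + 1 / w" "Im (1 / w) > 0" "Im s \<ge> 0"
  shows "cmod (s + w) \<le> cmod (1 + z * s + s * s) / Im (1 / w)"
proof -
  have "1 + z * s + s * s = (s + w) * (s + 1 / w)"
    using assms(1) unfolding assms(2) by (simp add: algebra_simps add_divide_distrib)
  then have "cmod (1 + z * s + s * s) = cmod (s + w) * cmod (s + 1 / w)" by (simp only: norm_mult)
  moreover have "Im (1 / w) \<le> cmod (s + 1 / w)"
    using abs_Im_le_cmod[of "s + 1 / w"] assms(4) by simp
  then have "cmod (s + w) * Im (1 / w) \<le> cmod (s + w) * cmod (s + 1 / w)" by (intro mult_left_mono) auto
  ultimately show ?thesis using assms(3) by (simp add: pos_le_divide_eq)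
qed

text \<open>
  Once \<open>s\<close> is close to \<open>- w\<close> the equation for \<open>g\<close> is linear with leading coefficient \<open>1 / w - \<theta>\<close>,
  whose imaginary part is at least \<open>Im (1 / w)\<close>.
\<close>

lemma form_stability:
  fixes \<theta> :: real
  assumes "w \<noteq> 0" "z = w + 1 / w" "Im (1 / w) > 0" "cmod g \<le> 1 / Im z"
  shows "cmod (g + w / (1 - of_real \<theta> * w)) \<le>
     (cmod (1 + (z - of_real \<theta>) * g + s * g) + cmod (s + w) / Im z) / Im (1 / w)"
proof -
  let ?d = "1 / w - of_real \<theta>"
  have d: "Im (1 / w) \<le> cmod ?d" using abs_Im_le_cmod[of ?d] by simp
  then have d0: "?d \<noteq> 0" using assms(3) by (metis norm_zero not_less)
  have "1 - of_real \<theta> * w = w * ?d" using assms(1) by (simp add: algebra_simps)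
  then have r: "w / (1 - of_real \<theta> * w) = 1 / ?d" using assms(1) by simp
  have "(1 + (z - of_real \<theta>) * g + s * g) - (s + w) * g = ?d * (g + 1 / ?d)"
    using d0 unfolding assms(2) by (simp add: distrib_left) (simp add: algebra_simps)
  then have "cmod ?d * cmod (g + 1 / ?d) = cmod ((1 + (z - of_real \<theta>) * g + s * g) - (s + w) * g)"
    by (simp only: norm_mult)
  also have "\<dots> \<le> cmod (1 + (z - of_real \<theta>) * g + s * g) + cmod (s + w) * (1 / Im z)"
  proof (intro order_trans[OF norm_triangle_ineq4] add_left_mono)
    show "cmod ((s + w) * g) \<le> cmod (s + w) * (1 / Im z)"
      unfolding norm_mult using assms(4) by (rule mult_left_mono) simp
  qed
  finally have "cmod ?d * cmod (g + 1 / ?d) \<le> cmod (1 + (z - of_real \<theta>) * g + s * g) + cmod (s + w) / Im z" by simp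
  moreover have "Im (1 / w) * cmod (g + 1 / ?d) \<le> cmod ?d * cmod (g + 1 / ?d)" using d by (intro mult_right_mono) auto
  ultimately have "cmod (g + 1 / ?d) * Im (1 / w) \<le> cmod (1 + (z - of_real \<theta>) * g + s * g) + cmod (s + w) / Im z"
    by (simp add: mult.commute)
  then show ?thesis unfolding r using assms(3) by (simp only: pos_le_divide_eq)
qed

lemma eigenbasis_parseval:
  fixes v :: "nat \<Rightarrow> nat \<Rightarrow> real"
  assumes orth: "\<And>k l. k < n \<Longrightarrow> l < n \<Longrightarrow> (\<Sum>p<n. v k p * v l p) = (if k = l then 1 else 0)"
  shows "(\<Sum>k<n. (\<Sum>p<n. v k p * x p)\<^sup>2) = (\<Sum>p<n. (x p)\<^sup>2)"
proof -
  have "(\<Sum>k<n. (\<Sum>p<n. v k p * x p)\<^sup>2) = (\<Sum>k<n. \<Sum>p<n. \<Sum>q<n. (v k p * v k q) * (x p * x q))"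
    unfolding power2_eq_square sum_product by (simp add: mult_ac)
  also have "\<dots> = (\<Sum>p<n. \<Sum>k<n. \<Sum>q<n. (v k p * v k q) * (x p * x q))" by (rule sum.swap)
  also have "\<dots> = (\<Sum>p<n. \<Sum>q<n. \<Sum>k<n. (v k p * v k q) * (x p * x q))"
    by (intro sum.cong refl sum.swap)
  also have "\<dots> = (\<Sum>p<n. \<Sum>q<n. if p = q then x p * x q else 0)"
    unfolding sum_distrib_right[symmetric] using eigenbasis_complete[OF orth] by (intro sum.cong refl) auto
  also have "\<dots> = (\<Sum>p<n. (x p)\<^sup>2)" by (simp add: power2_eq_square)
  finally show ?thesis .
qed

lemma stieltjes_im_nonneg:
  assumes "Im z > 0" "0 \<le> c"
  shows "0 \<le> Im (of_real c * (1 / (of_real x - z)))"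
proof -
  have "Im (1 / (of_real x - z)) = Im z / (cmod (of_real x - z))\<^sup>2"
    by (simp add: Im_divide cmod_power2)
  then show ?thesis using assms by (simp only: Im_mult_of_real) simp
qed

locale spiked_model =
  fixes M :: "nat \<Rightarrow> 'a measure"
    and W :: "nat \<Rightarrow> nat \<Rightarrow> nat \<Rightarrow> 'a \<Rightarrow> real"
    and u :: "nat \<Rightarrow> nat \<Rightarrow> 'a \<Rightarrow> real"
    and l :: "nat \<Rightarrow> 'a \<Rightarrow> nat \<Rightarrow> real"
    and v :: "nat \<Rightarrow> 'a \<Rightarrow> nat \<Rightarrow> real Matrix.vec"
    and \<theta> :: real
  assumes P: "\<And>N. prob_space (M N)"
    and W: "wigner_entries M W"
    and u: "\<And>N. N > 0 \<Longrightarrow> uniform_on_sphere (M N) N (u N)"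
    and ind: "\<And>N. N > 0 \<Longrightarrow> indep_mat_vec (M N) N (W N) (u N)"
    and \<theta>: "\<theta> > 0"
    and basis: "\<And>N \<omega>. N > 0 \<Longrightarrow> \<omega> \<in> space (M N) \<Longrightarrow>
           ordered_eigenbasis N (spiked_mat \<theta> N (W N) (u N) \<omega>) (l N \<omega>) (v N \<omega>)"
begin

definition overlap :: "nat \<Rightarrow> 'a \<Rightarrow> nat \<Rightarrow> real" where
  "overlap N \<omega> k = (\<Sum>p<N. vec_index (v N \<omega> k) p * u N p \<omega>)\<^sup>2"

definition on_sphere :: "nat \<Rightarrow> 'a \<Rightarrow> bool" where
  "on_sphere N \<omega> \<longleftrightarrow> (\<Sum>k<N. (u N k \<omega>)\<^sup>2) = 1"

lemma whp_on_sphere: "whp M on_sphere"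
proof (rule whpI)
  let ?A = "\<lambda>N. if N = 0 then {} else {\<omega> \<in> space (M N). (\<Sum>k<N. (u N k \<omega>)\<^sup>2) \<noteq> 1}"
  have s: "(\<lambda>\<omega>. \<Sum>k<N. (u N k \<omega>)\<^sup>2) \<in> borel_measurable (M N)" if "N > 0" for N
    using u[OF that] unfolding uniform_on_sphere_def by (intro borel_measurable_sum borel_measurable_power) simp
  show A: "?A N \<in> sets (M N)" for N
  proof (cases "N = 0")
    case False
    then have "(\<lambda>\<omega>. \<Sum>k<N. (u N k \<omega>)\<^sup>2) \<in> borel_measurable (M N)" using s by simp
    then have "{\<omega> \<in> space (M N). (\<Sum>k<N. (u N k \<omega>)\<^sup>2) \<noteq> 1} \<in> sets (M N)" by measurable
    then show ?thesis using False by simp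
  qed simp
  show "\<omega> \<in> ?A N" if "N > 0" "\<omega> \<in> space (M N)" "\<not> on_sphere N \<omega>" for N \<omega>
    using that by (simp add: on_sphere_def)
  have "measure (M N) (?A N) = 0" for N
  proof (cases "N = 0")
    case False
    then have "AE \<omega> in M N. (\<Sum>k<N. (u N k \<omega>)\<^sup>2) = 1" using u[of N] by (simp add: uniform_on_sphere_def)
    then have "emeasure (M N) (?A N) = 0" using A[of N] False by (subst (asm) AE_iff_measurable[of "?A N"]) auto
    then show ?thesis by (simp add: measure_def)
  qed simp
  then show "(\<lambda>N. measure (M N) (?A N)) \<longlonglongrightarrow> 0" by simp
qed

definition entries :: "nat \<Rightarrow> 'a \<Rightarrow> nat \<Rightarrow> nat \<Rightarrow> real" where
  "entries N \<omega> = spiked_wigner.B N (W N) (normalized N (u N)) \<theta> \<omega>"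

lemma spiked_wigner_uniform: "\<exists>K. \<forall>N>0. spiked_wigner (M N) N (W N) (normalized N (u N)) (rest_algebra (M N) N (W N) (u N)) K"
proof -
  obtain K where "K \<ge> 1" and K: "\<forall>N>0. \<forall>i<N. \<forall>j<N. (LINT \<omega>|M N. (W N i j \<omega>)\<^sup>2)\<^sup>2 \<le> K \<and> (LINT \<omega>|M N. W N i j \<omega> ^ 4) \<le> K"
    using wigner_moment_bound[OF W] by (elim exE conjE)
  then have "spiked_wigner (M N) N (W N) (normalized N (u N)) (rest_algebra (M N) N (W N) (u N)) K" if "N > 0" for N
    using spiked_wigner_model[of M N W u K, OF P W that ind[OF that]] that by simp
  then show ?thesis by blast
qed

lemma eigen_facts:
  assumes "N > 0" "\<omega> \<in> space (M N)" "on_sphere N \<omega>"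
  shows "\<And>k j. k < N \<Longrightarrow> j < N \<Longrightarrow>
      (\<Sum>p<N. vec_index (v N \<omega> k) p * vec_index (v N \<omega> j) p) = (if k = j then 1 else 0)"
    and "\<And>k i. k < N \<Longrightarrow> i < N \<Longrightarrow> (\<Sum>j<N. entries N \<omega> i j * vec_index (v N \<omega> k) j) = l N \<omega> k * vec_index (v N \<omega> k) i"
    and "\<And>k. k < N \<Longrightarrow> v N \<omega> k \<in> carrier_vec N"
    and "\<And>i j. i \<le> j \<Longrightarrow> j < N \<Longrightarrow> l N \<omega> j \<le> l N \<omega> i"
proof -
  obtain K where K: "\<forall>N>0. spiked_wigner (M N) N (W N) (normalized N (u N)) (rest_algebra (M N) N (W N) (u N)) K"
    using spiked_wigner_uniform by (elim exE)
  interpret spiked_wigner "M N" N "W N" "normalized N (u N)" "rest_algebra (M N) N (W N) (u N)" K \<theta>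
    using K[rule_format, OF assms(1)] .
  have c: "spiked_mat \<theta> N (W N) (u N) \<omega> \<in> carrier_mat N N"
    by (simp add: spiked_mat_def wigner_mat_def)
  have n: "normalized N (u N) \<omega> k = u N k \<omega>" for k
    using assms(3) by (simp add: normalized_def on_sphere_def)
  have e: "spiked_mat \<theta> N (W N) (u N) \<omega> $$ (i, j) = entries N \<omega> i j" if "i < N" "j < N" for i j
    using that by (simp add: spiked_mat_def wigner_mat_def entries_def B_def a_def n)
  note o = ordered_eigenbasis_functional[OF basis[OF assms(1,2)] c]
  show "\<And>k j. k < N \<Longrightarrow> j < N \<Longrightarrow>
      (\<Sum>p<N. vec_index (v N \<omega> k) p * vec_index (v N \<omega> j) p) = (if k = j then 1 else 0)"
    by (rule o(1))
  show "(\<Sum>j<N. entries N \<omega> i j * vec_index (v N \<omega> k) j) = l N \<omega> k * vec_index (v N \<omega> k) i"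
    if "k < N" "i < N" for k i
    using o(2)[OF that] e[OF that(2)] by simp
  show "\<And>k. k < N \<Longrightarrow> v N \<omega> k \<in> carrier_vec N" by (rule o(3))
  show "\<And>i j. i \<le> j \<Longrightarrow> j < N \<Longrightarrow> l N \<omega> j \<le> l N \<omega> i"
    using basis[OF assms(1,2)] by (simp add: ordered_eigenbasis_def)
qed

lemma overlap_weights:
  assumes "N > 0" "\<omega> \<in> space (M N)" "on_sphere N \<omega>"
  shows "(\<forall>i<N. 0 \<le> overlap N \<omega> i) \<and> (\<Sum>i<N. overlap N \<omega> i) = 1"
proof
  show "(\<Sum>i<N. overlap N \<omega> i) = 1"
    using eigenbasis_parseval[OF eigen_facts(1)[OF assms], of "\<lambda>p. u N p \<omega>"] assms(3)
    unfolding overlap_def on_sphere_def by simp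
qed (simp add: overlap_def)

text \<open>
  A small residual forces the transform to be close to the exact solution of its self-consistent
  equation; residuals are small with high probability by Chebyshev's inequality.
\<close>

lemma stieltjes_close:
  assumes z: "Im z > 0" and w: "w \<noteq> 0" "z = w + 1 / w" "Im (1 / w) > 0" and \<epsilon>: "\<epsilon> > 0"
  shows "whp M (\<lambda>N \<omega>. cmod ((\<Sum>i<N. of_real (1 / real N) * (1 / (of_real (l N \<omega> i) - z))) + w) \<le> \<epsilon>)"
    and "whp M (\<lambda>N \<omega>. cmod ((\<Sum>i<N. of_real (overlap N \<omega> i) * (1 / (of_real (l N \<omega> i) - z))) +
       w / (1 - of_real \<theta> * w)) \<le> \<epsilon>)"
proof -
  obtain K where K: "\<forall>N>0. spiked_wigner (M N) N (W N) (normalized N (u N)) (rest_algebra (M N) N (W N) (u N)) K"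
    using spiked_wigner_uniform by (elim exE)
  note model = K[rule_format]
  let ?T = "\<lambda>N. spiked_wigner.trace_residual N (W N) (normalized N (u N)) \<theta> z"
  let ?F = "\<lambda>N. spiked_wigner.form_residual N (W N) (normalized N (u N)) \<theta> z"
  from residuals_small[OF z, where K = K and \<theta> = \<theta> and 'a = 'a] obtain C where
    C: "\<forall>(M :: 'a measure) n W u R. spiked_wigner M n W u R K \<longrightarrow>
    (LINT \<omega>|M. (cmod (spiked_wigner.trace_residual n W u \<theta> z \<omega>))\<^sup>2) \<le> C / sqrt (real n) \<and>
    (LINT \<omega>|M. (cmod (spiked_wigner.form_residual n W u \<theta> z \<omega>))\<^sup>2) \<le> C / sqrt (real n)" by (elim exE)
  have T: "whp M (\<lambda>N \<omega>. cmod (?T N \<omega>) \<le> d)" if "d > 0" for d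
  proof (rule whp_small_of_second_moment[OF P _ _ _ that])
    fix N :: nat assume N: "N > 0"
    note m = model[OF N]
    show "(LINT \<omega>|M N. (cmod (?T N \<omega>))\<^sup>2) \<le> C / sqrt (real N)" using C[rule_format, OF m] by simp
    show "integrable (M N) (\<lambda>\<omega>. (cmod (?T N \<omega>))\<^sup>2)" "?T N \<in> borel_measurable (M N)"
      using spiked_wigner.residuals_integrable[OF m z] by simp_all
  qed
  have F: "whp M (\<lambda>N \<omega>. cmod (?F N \<omega>) \<le> d)" if "d > 0" for d
  proof (rule whp_small_of_second_moment[OF P _ _ _ that])
    fix N :: nat assume N: "N > 0"
    note m = model[OF N]
    show "(LINT \<omega>|M N. (cmod (?F N \<omega>))\<^sup>2) \<le> C / sqrt (real N)" using C[rule_format, OF m] by simp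
    show "integrable (M N) (\<lambda>\<omega>. (cmod (?F N \<omega>))\<^sup>2)" "?F N \<in> borel_measurable (M N)"
      using spiked_wigner.residuals_integrable[OF m z] by simp_all
  qed
  have spec: "res_trace N (entries N \<omega>) z = (\<Sum>i<N. of_real (1 / real N) * (1 / (of_real (l N \<omega> i) - z)))"
      "res_form N (entries N \<omega>) z (normalized N (u N) \<omega>) (normalized N (u N) \<omega>) =
        (\<Sum>i<N. of_real (overlap N \<omega> i) * (1 / (of_real (l N \<omega> i) - z)))"
      "?T N \<omega> = 1 + z * res_trace N (entries N \<omega>) z + res_trace N (entries N \<omega>) z * res_trace N (entries N \<omega>) z"
      "?F N \<omega> = 1 + (z - of_real \<theta>) * res_form N (entries N \<omega>) z (normalized N (u N) \<omega>) (normalized N (u N) \<omega>) +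
         res_trace N (entries N \<omega>) z * res_form N (entries N \<omega>) z (normalized N (u N) \<omega>) (normalized N (u N) \<omega>)"
      "cmod (res_form N (entries N \<omega>) z (normalized N (u N) \<omega>) (normalized N (u N) \<omega>)) \<le> 1 / Im z"
    if N: "N > 0" and \<omega>: "\<omega> \<in> space (M N)" and good: "on_sphere N \<omega>" for N \<omega>
  proof -
    interpret spiked_wigner "M N" N "W N" "normalized N (u N)" "rest_algebra (M N) N (W N) (u N)" K \<theta>
      by (rule model[OF N])
    have n: "normalized N (u N) \<omega> = (\<lambda>k. u N k \<omega>)"
      using good by (simp add: normalized_def on_sphere_def fun_eq_iff)
    have sB: "symm N (entries N \<omega>)" using symm_B[OF \<omega>] by (simp add: entries_def)
    note ef = eigen_facts[OF N \<omega> good]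
    show "res_trace N (entries N \<omega>) z = (\<Sum>i<N. of_real (1 / real N) * (1 / (of_real (l N \<omega> i) - z)))"
      by (rule res_trace_spectral[OF sB z ef(1,2)])
    have "res_form N (entries N \<omega>) z (\<lambda>k. u N k \<omega>) (\<lambda>k. u N k \<omega>) = (\<Sum>k<N. of_real
        ((\<Sum>p<N. vec_index (v N \<omega> k) p * u N p \<omega>) * (\<Sum>p<N. vec_index (v N \<omega> k) p * u N p \<omega>)) *
        (1 / (of_real (l N \<omega> k) - z)))"
      by (rule res_form_spectral[OF sB z ef(1,2)])
    then show "res_form N (entries N \<omega>) z (normalized N (u N) \<omega>) (normalized N (u N) \<omega>) =
        (\<Sum>i<N. of_real (overlap N \<omega> i) * (1 / (of_real (l N \<omega> i) - z)))"
      unfolding n overlap_def power2_eq_square .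
    show "?T N \<omega> = 1 + z * res_trace N (entries N \<omega>) z + res_trace N (entries N \<omega>) z * res_trace N (entries N \<omega>) z"
      unfolding trace_residual_def entries_def ..
    show "?F N \<omega> = 1 + (z - of_real \<theta>) * res_form N (entries N \<omega>) z (normalized N (u N) \<omega>) (normalized N (u N) \<omega>) +
         res_trace N (entries N \<omega>) z * res_form N (entries N \<omega>) z (normalized N (u N) \<omega>) (normalized N (u N) \<omega>)"
      unfolding form_residual_def entries_def ..
    show "cmod (res_form N (entries N \<omega>) z (normalized N (u N) \<omega>) (normalized N (u N) \<omega>)) \<le> 1 / Im z"
      by (intro res_form_bound sB z u_unit \<omega>)
  qed
  have tr: "cmod (res_trace N (entries N \<omega>) z + w) \<le> cmod (?T N \<omega>) / Im (1 / w)"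
    if N: "N > 0" and \<omega>: "\<omega> \<in> space (M N)" and good: "on_sphere N \<omega>" for N \<omega>
    unfolding spec(3)[OF that]
  proof (rule trace_stability[OF w])
    show "0 \<le> Im (res_trace N (entries N \<omega>) z)"
      unfolding spec(1)[OF that] Im_sum by (intro sum_nonneg stieltjes_im_nonneg z) simp
  qed
  show "whp M (\<lambda>N \<omega>. cmod ((\<Sum>i<N. of_real (1 / real N) * (1 / (of_real (l N \<omega> i) - z))) + w) \<le> \<epsilon>)"
  proof (rule whp_mono[OF whp_conj[OF whp_on_sphere T]])
    show "0 < \<epsilon> * Im (1 / w)" using \<epsilon> w(3) by simp
    fix N \<omega> assume *: "N > 0" "\<omega> \<in> space (M N)" "on_sphere N \<omega> \<and> cmod (?T N \<omega>) \<le> \<epsilon> * Im (1 / w)"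
    then have "cmod (res_trace N (entries N \<omega>) z + w) \<le> (\<epsilon> * Im (1 / w)) / Im (1 / w)"
      using w(3) by (intro order_trans[OF tr] divide_right_mono) auto
    also have "\<dots> = \<epsilon>" using w(3) by simp
    finally show "cmod ((\<Sum>i<N. of_real (1 / real N) * (1 / (of_real (l N \<omega> i) - z))) + w) \<le> \<epsilon>"
      using spec(1)[of N \<omega>] * by simp
  qed
  let ?d = "\<epsilon> * Im (1 / w) / 2" and ?d' = "\<epsilon> * Im (1 / w) / 2 * Im z * Im (1 / w)"
  show "whp M (\<lambda>N \<omega>. cmod ((\<Sum>i<N. of_real (overlap N \<omega> i) * (1 / (of_real (l N \<omega> i) - z))) +
       w / (1 - of_real \<theta> * w)) \<le> \<epsilon>)"
  proof (rule whp_mono[OF whp_conj[OF whp_on_sphere whp_conj[OF T F]]])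
    show "0 < ?d'" "0 < ?d" using \<epsilon> w(3) z by simp_all
    fix N \<omega> assume *: "N > 0" "\<omega> \<in> space (M N)" "on_sphere N \<omega> \<and> cmod (?T N \<omega>) \<le> ?d' \<and> cmod (?F N \<omega>) \<le> ?d"
    then have g: "on_sphere N \<omega>" by simp
    note sp = spec[OF *(1,2) g]
    have "cmod (res_trace N (entries N \<omega>) z + w) \<le> ?d' / Im (1 / w)"
      using w(3) * by (intro order_trans[OF tr[OF *(1,2) g]] divide_right_mono) auto
    also have "\<dots> = ?d * Im z" using w(3) by (simp add: mult_ac)
    finally have s: "cmod (res_trace N (entries N \<omega>) z + w) / Im z \<le> ?d" using z by (simp add: pos_divide_le_eq)
    have "cmod ((\<Sum>i<N. of_real (overlap N \<omega> i) * (1 / (of_real (l N \<omega> i) - z))) + w / (1 - of_real \<theta> * w)) \<le>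
       (cmod (?F N \<omega>) + cmod (res_trace N (entries N \<omega>) z + w) / Im z) / Im (1 / w)"
      unfolding sp(2)[symmetric] sp(4) by (rule form_stability[OF w sp(5)])
    also have "\<dots> \<le> (?d + ?d) / Im (1 / w)"
      using s * w(3) by (intro divide_right_mono add_mono) auto
    also have "\<dots> = \<epsilon>" using w(3) by simp
    finally show "cmod ((\<Sum>i<N. of_real (overlap N \<omega> i) * (1 / (of_real (l N \<omega> i) - z))) +
       w / (1 - of_real \<theta> * w)) \<le> \<epsilon>" .
  qed
qed

lemma empirical_convergence: "stieltjes_convergence M (\<lambda>N \<omega> i. 1 / real N) l sc_density 0 0"
proof
  show "whp M (\<lambda>N \<omega>. (\<forall>i<N. 0 \<le> 1 / real N) \<and> (\<Sum>i<N. 1 / real N) = 1)"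
    by (rule whp_eventually, rule eventually_mono[OF eventually_gt_at_top[of 0]]) simp
  fix z :: complex and \<epsilon> :: real assume z: "Im z > 0" and \<epsilon>: "\<epsilon> > 0"
  obtain w where w: "w \<noteq> 0" "cmod w < 1" "z = w + 1 / w" "Im (1 / w) > 0"
    using upper_half_plane_joukowski[OF z] .
  show "whp M (\<lambda>N \<omega>. cmod ((\<Sum>i<N. of_real (1 / real N) * (1 / (of_real (l N \<omega> i) - z))) -
     ((LINT x|lborel. of_real (sc_density x) * (1 / (of_real x - z))) + of_real 0 * (1 / (of_real 0 - z)))) \<le> \<epsilon>)"
    using stieltjes_close(1)[OF z w(1,3,4) \<epsilon>] unfolding stieltjes_sc(2)[OF w(1,2,3)] by simp
qed (use integrable_sc sc_density_nonneg integral_sc in auto)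

lemma overlap_convergence:
  "stieltjes_convergence M overlap l (overlap_density \<theta>) (outlier_mass \<theta>) (\<theta> + 1 / \<theta>)"
proof
  show "whp M (\<lambda>N \<omega>. (\<forall>i<N. 0 \<le> overlap N \<omega> i) \<and> (\<Sum>i<N. overlap N \<omega> i) = 1)"
    using whp_on_sphere by (rule whp_mono) (rule overlap_weights)
  fix z :: complex and \<epsilon> :: real assume z: "Im z > 0" and \<epsilon>: "\<epsilon> > 0"
  obtain w where w: "w \<noteq> 0" "cmod w < 1" "z = w + 1 / w" "Im (1 / w) > 0"
    using upper_half_plane_joukowski[OF z] .
  show "whp M (\<lambda>N \<omega>. cmod ((\<Sum>i<N. of_real (overlap N \<omega> i) * (1 / (of_real (l N \<omega> i) - z))) -
     ((LINT x|lborel. of_real (overlap_density \<theta> x) * (1 / (of_real x - z))) +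
       of_real (outlier_mass \<theta>) * (1 / (of_real (\<theta> + 1 / \<theta>) - z)))) \<le> \<epsilon>)"
    using stieltjes_close(2)[OF z w(1,3,4) \<epsilon>] unfolding stieltjes_overlap[OF \<theta> w(1,2,3) z w(4)] by simp
qed (use integral_overlap_density[OF \<theta>] overlap_density_nonneg[OF \<theta>] outlier_mass_nonneg[OF \<theta>] in auto)

end

section \<open>Overlaps of the top eigenvectors\<close>

lemma all_top_above:
  fixes l :: "nat \<Rightarrow> real"
  assumes "\<And>i j. i \<le> j \<Longrightarrow> j < N \<Longrightarrow> l j \<le> l i" "k \<le> card {i. i < N \<and> t < l i}" "i < k"
  shows "t < l i"
proof (rule ccontr)
  assume n: "\<not> t < l i"
  have "{j. j < N \<and> t < l j} \<subseteq> {..<i}"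
  proof safe
    fix j assume j: "j < N" "t < l j"
    show "j < i" using assms(1)[of i j] j n by (cases "i \<le> j") auto
  qed
  then have "card {j. j < N \<and> t < l j} \<le> card {..<i}" by (intro card_mono) auto
  then show False using assms by simp
qed

lemma above_in_top:
  fixes l :: "nat \<Rightarrow> real"
  assumes "\<And>i j. i \<le> j \<Longrightarrow> j < N \<Longrightarrow> l j \<le> l i" "card {i. i < N \<and> t \<le> l i} \<le> k" "i < N" "t \<le> l i"
  shows "i < k"
proof (rule ccontr)
  assume "\<not> i < k"
  have "{..i} \<subseteq> {j. j < N \<and> t \<le> l j}"
  proof safe
    fix j assume j: "j \<le> i"
    show "j < N" using j assms(3) by simp
    show "t \<le> l j" using assms(1)[OF j assms(3)] assms(4) by simp
  qed
  then have "card {..i} \<le> card {j. j < N \<and> t \<le> l j}" by (intro card_mono) auto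
  then show False using assms(2) \<open>\<not> i < k\<close> by simp
qed

context spiked_model
begin

text \<open>
  The semicircle mass above \<open>t\<close> is larger than \<open>c\<close>, so the first \<open>c N\<close> eigenvalues do not suffice to
  fill it.
\<close>

lemma top_eigenvalues_above:
  assumes c: "0 < c" "c < 1" and t: "-2 < t" "t < sc_threshold c"
  shows "whp M (\<lambda>N \<omega>. \<forall>i<nat \<lfloor>c * real N\<rfloor>. t < l N \<omega> i)"
proof -
  interpret E: stieltjes_convergence M "\<lambda>N \<omega> i. 1 / real N" l sc_density 0 0
    by (rule empirical_convergence)
  define t' where "t' = (t + sc_threshold c) / 2"
  have th: "sc_threshold c < 2" "sc_tail (sc_threshold c) = c" using sc_threshold[of c] c by auto
  have t': "t < t'" "t' < sc_threshold c" using t by (auto simp: t'_def)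
  have lt: "c < sc_tail t'" using sc_tail_strict[of t' "sc_threshold c"] t t' th by simp
  \<comment> \<open>The cutoff 3 is an arbitrary point beyond the edge 2 of the support.\<close>
  have "whp M (\<lambda>N \<omega>. (LINT x:{t'..2}|lborel. sc_density x) + 0 * indicator {t'..2} 0 - (sc_tail t' - c) \<le>
     (\<Sum>i | i < N \<and> t < l N \<omega> i \<and> l N \<omega> i < 3. 1 / real N))"
    using t t' th lt by (intro E.mass_lower_bound) auto
  from whp_conj[OF whp_on_sphere this] show ?thesis
  proof (rule whp_mono)
    fix N \<omega>
    assume N: "N > 0" and \<omega>: "\<omega> \<in> space (M N)"
      and *: "on_sphere N \<omega> \<and> (LINT x:{t'..2}|lborel. sc_density x) + 0 * indicator {t'..2} 0 - (sc_tail t' - c) \<le>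
     (\<Sum>i | i < N \<and> t < l N \<omega> i \<and> l N \<omega> i < 3. 1 / real N)"
    have "c \<le> real (card {i. i < N \<and> t < l N \<omega> i \<and> l N \<omega> i < 3}) / real N"
      using conjunct2[OF *] unfolding sc_tail_def[symmetric] by simp
    also have "\<dots> \<le> real (card {i. i < N \<and> t < l N \<omega> i}) / real N"
    proof (rule divide_right_mono)
      have "card {i. i < N \<and> t < l N \<omega> i \<and> l N \<omega> i < 3} \<le> card {i. i < N \<and> t < l N \<omega> i}"
        by (rule card_mono) auto
      then show "real (card {i. i < N \<and> t < l N \<omega> i \<and> l N \<omega> i < 3}) \<le> real (card {i. i < N \<and> t < l N \<omega> i})"
        by simp
    qed simp
    finally have "c \<le> real (card {i. i < N \<and> t < l N \<omega> i}) / real N" .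
    moreover have "0 < real N" using N by simp
    ultimately have "c * real N \<le> real (card {i. i < N \<and> t < l N \<omega> i})" by (rule pos_le_divide_eq[THEN iffD1, rotated])
    then have "\<lfloor>c * real N\<rfloor> \<le> int (card {i. i < N \<and> t < l N \<omega> i})" using floor_mono by fastforce
    then have k: "nat \<lfloor>c * real N\<rfloor> \<le> card {i. i < N \<and> t < l N \<omega> i}" by (rule nat_le_iff[THEN iffD2])
    show "\<forall>i<nat \<lfloor>c * real N\<rfloor>. t < l N \<omega> i"
      by (intro allI impI) (rule all_top_above[OF eigen_facts(4)[OF N \<omega> conjunct1[OF *]] k])
  qed
qed

text \<open>
  The semicircle mass above \<open>t\<close> is smaller than \<open>c\<close>. The number of eigenvalues there is bounded through
  the complement, for which \<open>mass_lower_bound\<close> applies.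
\<close>

lemma large_eigenvalues_in_top:
  assumes c: "0 < c" "c < 1" and t: "sc_threshold c < t" "t < 2"
  shows "whp M (\<lambda>N \<omega>. \<forall>i<N. t \<le> l N \<omega> i \<longrightarrow> i < nat \<lfloor>c * real N\<rfloor>)"
proof -
  interpret E: stieltjes_convergence M "\<lambda>N \<omega> i. 1 / real N" l sc_density 0 0
    by (rule empirical_convergence)
  define t' where "t' = (t + sc_threshold c) / 2"
  have th: "-2 \<le> sc_threshold c" "sc_tail (sc_threshold c) = c" using sc_threshold[of c] c by auto
  have t': "t' < t" "sc_threshold c < t'" using t by (auto simp: t'_def)
  have lt: "sc_tail t' < c" using sc_tail_strict[of "sc_threshold c" t'] t t' th by simp
  define d where "d = (c - sc_tail t') / 2"
  have d: "d > 0" using lt by (simp add: d_def)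
  have I: "(LINT x:{-2..t'}|lborel. sc_density x) = 1 - sc_tail t'"
    using set_integral_split[OF integrable_sc, of "-2" t' 2] t t' th sc_tail_ends(1) by (simp add: sc_tail_def)
  have "whp M (\<lambda>N \<omega>. (LINT x:{-2..t'}|lborel. sc_density x) + 0 * indicator {-2..t'} 0 - d \<le>
     (\<Sum>i | i < N \<and> -3 < l N \<omega> i \<and> l N \<omega> i < t. 1 / real N))"
    using t t' th d by (intro E.mass_lower_bound) auto
  then have "whp M (\<lambda>N \<omega>. on_sphere N \<omega> \<and>
     (LINT x:{-2..t'}|lborel. sc_density x) + 0 * indicator {-2..t'} 0 - d \<le>
     (\<Sum>i | i < N \<and> -3 < l N \<omega> i \<and> l N \<omega> i < t. 1 / real N))"
    by (intro whp_conj whp_on_sphere)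
  then show ?thesis
  proof (rule whp_mono)
    fix N \<omega>
    assume N: "N > 0" and \<omega>: "\<omega> \<in> space (M N)"
      and *: "on_sphere N \<omega> \<and>
     (LINT x:{-2..t'}|lborel. sc_density x) + 0 * indicator {-2..t'} 0 - d \<le>
     (\<Sum>i | i < N \<and> -3 < l N \<omega> i \<and> l N \<omega> i < t. 1 / real N)"
    let ?A = "{i. i < N \<and> t \<le> l N \<omega> i}" and ?B = "{i. i < N \<and> -3 < l N \<omega> i \<and> l N \<omega> i < t}"
    have "(1 - sc_tail t') - d \<le> real (card ?B) / real N"
      using conjunct2[OF *] unfolding I by simp
    moreover have "(1 - sc_tail t') - d = 1 - c + d" by (simp add: d_def field_simps)
    ultimately have "1 - c + d \<le> real (card ?B) / real N" by simp
    moreover have "0 < real N" using N by simp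
    ultimately have B: "(1 - c + d) * real N \<le> real (card ?B)" by (rule pos_le_divide_eq[THEN iffD1, rotated])
    \<comment> \<open>The share of eigenvalues below t exceeds 1 - c, which leaves fewer than c N for the rest.\<close>
    have "card ?A + card ?B = card (?A \<union> ?B)" by (rule card_Un_disjoint[symmetric]) auto
    also have "\<dots> \<le> card {..<N}" by (intro card_mono) auto
    finally have "real (card ?A) + real (card ?B) \<le> real N" by simp
    with B have "real (card ?A) \<le> c * real N - d * real N" by (simp add: algebra_simps)
    moreover have "0 \<le> d * real N" using d by simp
    ultimately have "real (card ?A) \<le> c * real N" by linarith
    then have k: "card ?A \<le> nat \<lfloor>c * real N\<rfloor>" by (rule le_nat_floor)
    show "\<forall>i<N. t \<le> l N \<omega> i \<longrightarrow> i < nat \<lfloor>c * real N\<rfloor>"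
    proof (intro allI impI)
      fix i assume i: "i < N" "t \<le> l N \<omega> i"
      show "i < nat \<lfloor>c * real N\<rfloor>"
        by (rule above_in_top[OF eigen_facts(4)[OF N \<omega> conjunct1[OF *]] k i])
    qed
  qed
qed

definition overlap_tail :: "real \<Rightarrow> real" where
  "overlap_tail t = (LINT x:{t..2}|lborel. overlap_density \<theta> x)"

lemma isCont_overlap_tail: "isCont overlap_tail t"
  unfolding overlap_tail_def[abs_def] by (intro isCont_upper_integral integral_overlap_density \<theta>)

text \<open>
  The first \<open>c N\<close> eigenvalues are those above the threshold, up to a window that shrinks to a point
  and hence carries little limiting overlap mass. At \<open>c = 1\<close> the sum is Parseval's identity.
\<close>

lemma top_overlap_sum:
  assumes c: "0 < c" "c \<le> 1" and \<epsilon>: "\<epsilon> > 0"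
  shows "whp M (\<lambda>N \<omega>. \<bar>(\<Sum>i<nat \<lfloor>c * real N\<rfloor>. overlap N \<omega> i) - (overlap_integral \<theta> c + outlier_mass \<theta>)\<bar> \<le> \<epsilon>)"
proof (cases "c = 1")
  case True
  show ?thesis
    by (rule whp_mono[OF whp_on_sphere])
       (use True overlap_weights overlap_at_1[OF \<theta>] \<epsilon> in simp)
next
  case False
  with c have c1: "c < 1" by simp
  interpret U: stieltjes_convergence M overlap l "overlap_density \<theta>" "outlier_mass \<theta>" "\<theta> + 1 / \<theta>"
    by (rule overlap_convergence)
  define m where "m = sc_threshold c"
  have m: "-2 \<le> m" "m < 2" "sc_tail m = c" using sc_threshold[OF c] by (auto simp: m_def)
  then have m': "-2 < m" using sc_tail_ends c1 by (cases "m = -2") auto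
  have Z: "2 \<le> \<theta> + 1 / \<theta>"
  proof -
    have "0 \<le> (\<theta> - 1)\<^sup>2 / \<theta>" using \<theta> by simp
    also have "\<dots> = \<theta> + 1 / \<theta> - 2" using \<theta> by (simp add: field_simps power2_eq_square)
    finally show ?thesis by simp
  qed
  obtain r where r: "r > 0" "\<And>t. \<bar>t - m\<bar> < r \<Longrightarrow> \<bar>overlap_tail t - overlap_tail m\<bar> < \<epsilon> / 2"
  proof -
    have "\<exists>r>0. \<forall>t. dist t m < r \<longrightarrow> dist (overlap_tail t) (overlap_tail m) < \<epsilon> / 2"
      using isCont_overlap_tail[of m, unfolded continuous_at_eps_delta, rule_format, OF half_gt_zero[OF \<epsilon>]] .
    then show thesis using that by (auto simp: dist_real_def)
  qed
  \<comment> \<open>The four points m - 2 s, m - s, m + s, m + 2 s separate the mass estimates from the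
     eigenvalue locations.\<close>
  define s where "s = min r (min (2 - m) (m + 2)) / 4"
  have s: "s > 0" "2 * s < r" "2 * s < 2 - m" "2 * s < m + 2" using r(1) m m' by (auto simp: s_def)
  have near: "\<bar>overlap_tail (m - 2 * s) - overlap_tail m\<bar> < \<epsilon> / 2" "\<bar>overlap_tail (m + 2 * s) - overlap_tail m\<bar> < \<epsilon> / 2"
    using r(2)[of "m - 2 * s"] r(2)[of "m + 2 * s"] s by simp_all
  have low: "(LINT x:{-2..m - 2 * s}|lborel. overlap_density \<theta> x) + overlap_tail (m - 2 * s) + outlier_mass \<theta> = 1"
    using overlap_total[OF \<theta>, of "m - 2 * s"] s m by (simp add: overlap_tail_def)
  have high: "(LINT x:{m + 2 * s..\<theta> + 1 / \<theta> + 1}|lborel. overlap_density \<theta> x) = overlap_tail (m + 2 * s)"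
  proof -
    have "(LINT x:{2..\<theta> + 1 / \<theta> + 1}|lborel. overlap_density \<theta> x) = 0"
      unfolding set_lebesgue_integral_def
      by (rule integral_eq_zero_AE) (auto simp: indicator_def overlap_density_outside)
    then show ?thesis
      using set_integral_split[OF integral_overlap_density(1)[OF \<theta>], of "m + 2 * s" 2 "\<theta> + 1 / \<theta> + 1"] s Z
      by (simp add: overlap_tail_def)
  qed
  have e: "whp M (\<lambda>N \<omega>. (LINT x:{-2..m - 2 * s}|lborel. overlap_density \<theta> x) +
        outlier_mass \<theta> * indicator {-2..m - 2 * s} (\<theta> + 1 / \<theta>) - \<epsilon> / 2 \<le>
     (\<Sum>i | i < N \<and> -3 < l N \<omega> i \<and> l N \<omega> i < m - s. overlap N \<omega> i))"
    "whp M (\<lambda>N \<omega>. (LINT x:{m + 2 * s..\<theta> + 1 / \<theta> + 1}|lborel. overlap_density \<theta> x) +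
        outlier_mass \<theta> * indicator {m + 2 * s..\<theta> + 1 / \<theta> + 1} (\<theta> + 1 / \<theta>) - \<epsilon> / 2 \<le>
     (\<Sum>i | i < N \<and> m + s < l N \<omega> i \<and> l N \<omega> i < \<theta> + 1 / \<theta> + 2. overlap N \<omega> i))"
    by (rule U.mass_lower_bound; use s m \<epsilon> Z in linarith)+
  have t: "whp M (\<lambda>N \<omega>. \<forall>i<nat \<lfloor>c * real N\<rfloor>. m - s < l N \<omega> i)"
    by (rule top_eigenvalues_above[OF c(1) c1]) (use s m in \<open>auto simp: m_def[symmetric]\<close>)
  have b: "whp M (\<lambda>N \<omega>. \<forall>i<N. m + s \<le> l N \<omega> i \<longrightarrow> i < nat \<lfloor>c * real N\<rfloor>)"
    by (rule large_eigenvalues_in_top[OF c(1) c1]) (use s m in \<open>auto simp: m_def[symmetric]\<close>)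
  from whp_conj[OF whp_conj[OF whp_on_sphere whp_conj[OF t b]] whp_conj[OF e]]
  show ?thesis
  proof (rule whp_mono)
    fix N \<omega>
    let ?k = "nat \<lfloor>c * real N\<rfloor>" and ?v = "overlap N \<omega>"
    let ?L = "{i. i < N \<and> -3 < l N \<omega> i \<and> l N \<omega> i < m - s}"
    let ?H = "{i. i < N \<and> m + s < l N \<omega> i \<and> l N \<omega> i < \<theta> + 1 / \<theta> + 2}"
    assume N: "N > 0" and \<omega>: "\<omega> \<in> space (M N)"
      and *: "(on_sphere N \<omega> \<and> (\<forall>i<?k. m - s < l N \<omega> i) \<and> (\<forall>i<N. m + s \<le> l N \<omega> i \<longrightarrow> i < ?k)) \<and>
       (LINT x:{-2..m - 2 * s}|lborel. overlap_density \<theta> x) +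
        outlier_mass \<theta> * indicator {-2..m - 2 * s} (\<theta> + 1 / \<theta>) - \<epsilon> / 2 \<le> sum ?v ?L \<and>
       (LINT x:{m + 2 * s..\<theta> + 1 / \<theta> + 1}|lborel. overlap_density \<theta> x) +
        outlier_mass \<theta> * indicator {m + 2 * s..\<theta> + 1 / \<theta> + 1} (\<theta> + 1 / \<theta>) - \<epsilon> / 2 \<le> sum ?v ?H"
    have wt: "\<forall>i<N. 0 \<le> ?v i" "(\<Sum>i<N. ?v i) = 1" using overlap_weights[OF N \<omega>] * by auto
    have "c * real N \<le> real N" using c by (simp add: mult_left_le_one_le)
    then have kN: "?k \<le> N" by linarith
    have L: "(LINT x:{-2..m - 2 * s}|lborel. overlap_density \<theta> x) - \<epsilon> / 2 \<le> sum ?v ?L"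
      using * Z s by simp
    have H: "overlap_tail (m + 2 * s) + outlier_mass \<theta> - \<epsilon> / 2 \<le> sum ?v ?H"
      using * Z s unfolding high by simp
    \<comment> \<open>The top indices avoid the eigenvalues below m - s, so their share is at most what is left.\<close>
    have disj: "{..<?k} \<inter> ?L = {}" using * by force
    have "sum ?v {..<?k} + sum ?v ?L = sum ?v ({..<?k} \<union> ?L)"
      using disj by (intro sum.union_disjoint[symmetric]) auto
    also have "\<dots> \<le> sum ?v {..<N}" using wt kN by (intro sum_mono2) auto
    finally have up: "sum ?v {..<?k} + sum ?v ?L \<le> 1" using wt by simp
    \<comment> \<open>Conversely they contain all eigenvalues above m + s, including the outlier.\<close>
    have "?H \<subseteq> {..<?k}" using * by auto
    then have dn: "sum ?v ?H \<le> sum ?v {..<?k}" using wt kN by (intro sum_mono2) auto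
    have oi: "overlap_integral \<theta> c = overlap_tail m" by (simp add: overlap_integral_eq overlap_tail_def m_def)
    show "\<bar>(\<Sum>i<?k. ?v i) - (overlap_integral \<theta> c + outlier_mass \<theta>)\<bar> \<le> \<epsilon>"
      unfolding oi using L H up dn low near by linarith
  qed
qed

end

theorem theorem6:
  fixes M :: "nat \<Rightarrow> 'a measure"
    and W :: "nat \<Rightarrow> nat \<Rightarrow> nat \<Rightarrow> 'a \<Rightarrow> real"
    and u :: "nat \<Rightarrow> nat \<Rightarrow> 'a \<Rightarrow> real"
    and l :: "nat \<Rightarrow> 'a \<Rightarrow> nat \<Rightarrow> real"
    and v :: "nat \<Rightarrow> 'a \<Rightarrow> nat \<Rightarrow> real Matrix.vec"
    and \<theta> c :: real
  assumes "\<And>N. prob_space (M N)"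
    and "wigner_entries M W"
    and "\<And>N. N > 0 \<Longrightarrow> uniform_on_sphere (M N) N (u N)"
    and "\<And>N. N > 0 \<Longrightarrow> indep_mat_vec (M N) N (W N) (u N)"
    and "\<theta> > 0" and "0 < c" and "c \<le> 1"
    and "\<And>N \<omega>. N > 0 \<Longrightarrow> \<omega> \<in> space (M N) \<Longrightarrow>
           ordered_eigenbasis N (spiked_mat \<theta> N (W N) (u N) \<omega>) (l N \<omega>) (v N \<omega>)"
    and "\<And>N i j. i < N \<Longrightarrow> j < N \<Longrightarrow> (\<lambda>\<omega>. vec_index (v N \<omega> i) j) \<in> borel_measurable (M N)"
  shows "tendsto_in_prob M
           (\<lambda>N \<omega>. \<Sum>i<nat \<lfloor>c * real N\<rfloor>. (scalar_prod (v N \<omega> i) (random_vec N (u N) \<omega>))\<^sup>2)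
           (overlap_integral \<theta> c + outlier_mass \<theta>)
       \<and> overlap_integral \<theta> c + outlier_mass \<theta> \<ge> c
       \<and> strict_mono_on {0<..1} (\<lambda>c'. overlap_integral \<theta> c' + outlier_mass \<theta>)
       \<and> mono_on {0<..} (\<lambda>\<theta>'. overlap_integral \<theta>' c + outlier_mass \<theta>')
       \<and> (c < 1 \<longrightarrow> strict_mono_on {0<..} (\<lambda>\<theta>'. overlap_integral \<theta>' c + outlier_mass \<theta>'))"
proof (intro conjI)
  interpret spiked_model M W u l v \<theta>
    by (rule spiked_model.intro) (fact assms)+
  show "tendsto_in_prob M
           (\<lambda>N \<omega>. \<Sum>i<nat \<lfloor>c * real N\<rfloor>. (scalar_prod (v N \<omega> i) (random_vec N (u N) \<omega>))\<^sup>2)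
           (overlap_integral \<theta> c + outlier_mass \<theta>)"
  proof (rule whp_imp_tendsto_in_prob[OF assms(1)])
    fix \<epsilon> :: real assume "\<epsilon> > 0"
    from top_overlap_sum[OF assms(6,7) this]
    show "whp M (\<lambda>N \<omega>. \<bar>(\<Sum>i<nat \<lfloor>c * real N\<rfloor>. (scalar_prod (v N \<omega> i) (random_vec N (u N) \<omega>))\<^sup>2) -
        (overlap_integral \<theta> c + outlier_mass \<theta>)\<bar> \<le> \<epsilon>)"
    proof (rule whp_mono)
      fix N \<omega>
      have "scalar_prod (v N \<omega> i) (random_vec N (u N) \<omega>) = (\<Sum>p<N. vec_index (v N \<omega> i) p * u N p \<omega>)" for i
        by (auto simp: scalar_prod_def random_vec_def intro!: sum.cong)
      moreover assume "\<bar>(\<Sum>i<nat \<lfloor>c * real N\<rfloor>. overlap N \<omega> i) - (overlap_integral \<theta> c + outlier_mass \<theta>)\<bar> \<le> \<epsilon>"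
      ultimately show "\<bar>(\<Sum>i<nat \<lfloor>c * real N\<rfloor>. (scalar_prod (v N \<omega> i) (random_vec N (u N) \<omega>))\<^sup>2) -
        (overlap_integral \<theta> c + outlier_mass \<theta>)\<bar> \<le> \<epsilon>" by (simp add: overlap_def)
    qed
  qed
  show "overlap_integral \<theta> c + outlier_mass \<theta> \<ge> c"
    by (rule overlap_ge[OF assms(5,6,7)])
  show "strict_mono_on {0<..1} (\<lambda>c'. overlap_integral \<theta> c' + outlier_mass \<theta>)"
    by (intro strict_mono_onI) (use overlap_strict_mono_c[OF assms(5)] in auto)
  show "mono_on {0<..} (\<lambda>\<theta>'. overlap_integral \<theta>' c + outlier_mass \<theta>')"
  proof (intro mono_onI)
    fix r s :: real assume rs: "r \<in> {0<..}" "s \<in> {0<..}" "r \<le> s"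
    show "overlap_integral r c + outlier_mass r \<le> overlap_integral s c + outlier_mass s"
    proof (cases "c = 1 \<or> r = s")
      case False
      then show ?thesis using overlap_strict_mono_theta[of r s c] rs assms(6,7) by simp
    qed (use rs overlap_at_1 in auto)
  qed
  show "c < 1 \<longrightarrow> strict_mono_on {0<..} (\<lambda>\<theta>'. overlap_integral \<theta>' c + outlier_mass \<theta>')"
    by (intro impI strict_mono_onI) (use overlap_strict_mono_theta assms(6) in auto)
qed

end
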